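(* Let $E,\nu:\mathbb{R}\to(0,\infty)$ be $1$-periodic, piecewise continuous with a finite number of discontinuities in the unit cell, with $E^+,\nu^+<\infty$ and $E^-,\nu^->0$. Let $f$ satisfy $f(\cdot,t)\in L^2(\mathcal{D};\mathbb{R})$ for all $t\in\overline{\mathcal{T}}$ and $\|f\|_{\mathcal{Z}}<\infty$, and let $u^*\in V$. Let $\epsilon>0$ and let $u_\epsilon$ be the solution of the Kelvin-Voigt problem with material properties $E_\epsilon(x)=E(x/\epsilon)$, $\nu_\epsilon(x)=\nu(x/\epsilon)$, forcing $f$ and initial displacement $u^*$. Then for every $\delta>0$ there exist piecewise-constant $E^{PC}$ and $\nu^{PC}$ such that the solution $u_\epsilon^{PC}$ of the Kelvin-Voigt problem with material properties $E^{PC}(x/\epsilon)$, $\nu^{PC}(x/\epsilon)$, and the same $f$ and $u^*$, satisfies $$\|u_\epsilon^{PC}-u_\epsilon\|_{\mathcal{Z}}<\delta.$$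
   Context: Domain and spaces: $\mathcal{D}\subset\mathbb{R}$ is a bounded interval $[0,\Lambda]$, $\mathcal{T}=(0,T)$ with $T<\infty$, $V=H_0^1(\mathcal{D};\mathbb{R})$, $\langle\cdot,\cdot\rangle$ and $\|\cdot\|$ are the inner product and norm of $L^2(\mathcal{D};\mathbb{R})$, and $\mathcal{Z}=L^\infty(\mathcal{T};L^2(\mathcal{D};\mathbb{R}))$ with $\|r\|_{\mathcal{Z}}=\operatorname{ess\,sup}_{t\in\mathcal{T}}\|r(\cdot,t)\|$. For a bounded function $\xi$, $\xi^+$ and $\xi^-$ denote its essential supremum and essential infimum. Kelvin-Voigt problem (without inertia) with material properties $E_\epsilon,\nu_\epsilon\in L^\infty(\mathcal{D};(0,\infty))$ bounded below by positive constants: $$-\partial_x\left(E_\epsilon\,\partial_x u+\nu_\epsilon\,\partial^2_{xt}u\right)=f \text{ in } \mathcal{D}\times\mathcal{T},\qquad u|_{t=0}=u^*,\qquad u=0 \text{ on }\partial\mathcal{D}\times\mathcal{T},$$ understood in weak form: $u\in C(\overline{\mathcal{T}};V)$ with time derivative $\partial_t u\in L^2(\mathcal{T};V)$, $u|_{t=0}=u^*$, and for a.e. $t\in\mathcal{T}$ and all $\varphi\in V$, $$\int_{\mathcal{D}}\nu_\epsilon\,\partial_x(\partial_t u)\,\partial_x\varphi\,dx+\int_{\mathcal{D}}E_\epsilon\,\partial_x u\,\partial_x\varphi\,dx=\langle f,\varphi\rangle.$$ Piecewise continuous means continuous except at finitely many points of the unit cell, with finite one-sided limits there. Piecewise constant: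 a pair of $1$-periodic positive functions $(E^{PC},\nu^{PC})$ is piecewise constant if, for some integer $N\ge1$, both functions are constant on each of $N$ common intervals $[0,a_1),[a_1,a_2),\dots,[a_{N-1},1]$ of the unit cell. *)

theory Defs
  imports "HOL-Analysis.Analysis" "HOL-Probability.Essential_Supremum"
begin

text \<open>
  The spatial domain is \<open>{0..\<Lambda>}\<close>, the time interval \<open>{0<..<T}\<close>. Elements of
  \<open>L\<^sup>2\<close>, \<open>H\<^sup>1\<close>, \<open>H\<^sup>1\<^sub>0\<close> are represented by functions \<open>real \<Rightarrow> real\<close> (not by classes), so the norms
  below are seminorms. Space-time functions take the time argument first:
  \<open>u t\<close> is the function \<open>u(\<cdot>,t)\<close>.
\<close>

section \<open>Function spaces on the spatial domain\<close>

definition L2 :: "real \<Rightarrow> (real \<Rightarrow> real) set" where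
  "L2 \<Lambda> = {g. g \<in> borel_measurable (lebesgue_on {0..\<Lambda>}) \<and>
              integrable (lebesgue_on {0..\<Lambda>}) (\<lambda>x. (g x)\<^sup>2)}"

definition L2_inner :: "real \<Rightarrow> (real \<Rightarrow> real) \<Rightarrow> (real \<Rightarrow> real) \<Rightarrow> real" where
  "L2_inner \<Lambda> g h = (LINT x|lebesgue_on {0..\<Lambda>}. g x * h x)"

definition L2_norm :: "real \<Rightarrow> (real \<Rightarrow> real) \<Rightarrow> real" where
  "L2_norm \<Lambda> g = sqrt (L2_inner \<Lambda> g g)"

text \<open>\<open>C\<^sup>\<infinity>\<close> functions with compact support in the open interval \<open>{a<..<b}\<close>.\<close>

definition test_function :: "real \<Rightarrow> real \<Rightarrow> (real \<Rightarrow> real) \<Rightarrow> bool" where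
  "test_function a b \<phi> \<longleftrightarrow>
     (\<forall>k x. (deriv ^^ k) \<phi> differentiable (at x)) \<and> closure {x. \<phi> x \<noteq> 0} \<subseteq> {a<..<b}"

definition weak_deriv :: "real \<Rightarrow> (real \<Rightarrow> real) \<Rightarrow> (real \<Rightarrow> real) \<Rightarrow> bool" where
  "weak_deriv \<Lambda> v v' \<longleftrightarrow>
     (\<forall>\<phi>. test_function 0 \<Lambda> \<phi> \<longrightarrow> L2_inner \<Lambda> v (deriv \<phi>) = - L2_inner \<Lambda> v' \<phi>)"

definition H1 :: "real \<Rightarrow> (real \<Rightarrow> real) set" where
  "H1 \<Lambda> = {v \<in> L2 \<Lambda>. \<exists>v' \<in> L2 \<Lambda>. weak_deriv \<Lambda> v v'}"

text \<open>A representative of the weak derivative; it is unique almost everywhere in \<open>{0..\<Lambda>}\<close>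
  and only meaningful for functions in \<open>H1 \<Lambda>\<close>.\<close>

definition D\<^sub>x :: "real \<Rightarrow> (real \<Rightarrow> real) \<Rightarrow> (real \<Rightarrow> real)" where
  "D\<^sub>x \<Lambda> v = (SOME v'. v' \<in> L2 \<Lambda> \<and> weak_deriv \<Lambda> v v')"

definition H1_norm :: "real \<Rightarrow> (real \<Rightarrow> real) \<Rightarrow> real" where
  "H1_norm \<Lambda> v = sqrt ((L2_norm \<Lambda> v)\<^sup>2 + (L2_norm \<Lambda> (D\<^sub>x \<Lambda> v))\<^sup>2)"

definition H10 :: "real \<Rightarrow> (real \<Rightarrow> real) set" where
  "H10 \<Lambda> = {v \<in> H1 \<Lambda>. \<forall>e>0. \<exists>\<phi>. test_function 0 \<Lambda> \<phi> \<and> H1_norm \<Lambda> (\<lambda>x. v x - \<phi> x) < e}"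


section \<open>Functions of time with values in a seminormed function space\<close>

text \<open>
  The library's Bochner integral needs the target space to be a type. \<open>L2 \<Lambda>\<close> and \<open>H10 \<Lambda>\<close>
  depend on \<open>\<Lambda>\<close>, so the same construction is repeated for a set \<open>X\<close> of functions carrying
  a seminorm \<open>N\<close>, over a time set \<open>I\<close> of finite Lebesgue measure.
\<close>

definition simple_valued :: "real set \<Rightarrow> (real \<Rightarrow> real) set \<Rightarrow> (real \<Rightarrow> real \<Rightarrow> real) \<Rightarrow> bool" where
  "simple_valued I X s \<longleftrightarrow>
     s ` I \<subseteq> X \<and> finite (s ` I) \<and> (\<forall>g. {t \<in> I. s t = g} \<in> sets lebesgue)"

definition simple_integral :: "real set \<Rightarrow> (real \<Rightarrow> real \<Rightarrow> real) \<Rightarrow> (real \<Rightarrow> real)" where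
  "simple_integral I s = (\<lambda>x. \<Sum>g \<in> s ` I. measure lebesgue {t \<in> I. s t = g} * g x)"

definition strongly_measurable ::
  "real set \<Rightarrow> (real \<Rightarrow> real) set \<Rightarrow> ((real \<Rightarrow> real) \<Rightarrow> real) \<Rightarrow> (real \<Rightarrow> real \<Rightarrow> real) \<Rightarrow> bool" where
  "strongly_measurable I X N h \<longleftrightarrow>
     (\<forall>t\<in>I. h t \<in> X) \<and>
     (\<exists>S. (\<forall>n. simple_valued I X (S n)) \<and>
          (AE t in lebesgue_on I. (\<lambda>n. N (\<lambda>x. S n t x - h t x)) \<longlonglongrightarrow> 0))"

definition has_bochner ::
  "real set \<Rightarrow> (real \<Rightarrow> real) set \<Rightarrow> ((real \<Rightarrow> real) \<Rightarrow> real) \<Rightarrow> (real \<Rightarrow> real \<Rightarrow> real) \<Rightarrow>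
     (real \<Rightarrow> real) \<Rightarrow> bool" where
  "has_bochner I X N h J \<longleftrightarrow>
     strongly_measurable I X N h \<and> J \<in> X \<and>
     (\<exists>S. (\<forall>n. simple_valued I X (S n)) \<and>
          (\<lambda>n. \<integral>\<^sup>+ t. ennreal (N (\<lambda>x. S n t x - h t x)) \<partial>lebesgue_on I) \<longlonglongrightarrow> 0 \<and>
          (\<lambda>n. N (\<lambda>x. simple_integral I (S n) x - J x)) \<longlonglongrightarrow> 0)"

definition Z_norm :: "real \<Rightarrow> real \<Rightarrow> (real \<Rightarrow> real \<Rightarrow> real) \<Rightarrow> ereal" where
  "Z_norm \<Lambda> T r = esssup (lebesgue_on {0<..<T}) (\<lambda>t. ereal (L2_norm \<Lambda> (r t)))"

definition C_H10 :: "real \<Rightarrow> real \<Rightarrow> (real \<Rightarrow> real \<Rightarrow> real) set" where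
  "C_H10 \<Lambda> T = {u. \<forall>t\<in>{0..T}. u t \<in> H10 \<Lambda> \<and>
      ((\<lambda>s. H1_norm \<Lambda> (\<lambda>x. u s x - u t x)) \<longlongrightarrow> 0) (at t within {0..T})}"

definition L2_H10 :: "real \<Rightarrow> real \<Rightarrow> (real \<Rightarrow> real \<Rightarrow> real) set" where
  "L2_H10 \<Lambda> T = {v. strongly_measurable {0<..<T} (H10 \<Lambda>) (H1_norm \<Lambda>) v \<and>
      integrable (lebesgue_on {0<..<T}) (\<lambda>t. (H1_norm \<Lambda> (v t))\<^sup>2)}"

text \<open>\<open>v\<close> is the distributional time derivative of \<open>u\<close>, as \<open>H10 \<Lambda>\<close>-valued functions:
  \<open>\<integral> \<eta>' u dt = - \<integral> \<eta> v dt\<close> as Bochner integrals, for all scalar test functions \<open>\<eta>\<close>.\<close>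

definition time_deriv ::
  "real \<Rightarrow> real \<Rightarrow> (real \<Rightarrow> real \<Rightarrow> real) \<Rightarrow> (real \<Rightarrow> real \<Rightarrow> real) \<Rightarrow> bool" where
  "time_deriv \<Lambda> T u v \<longleftrightarrow>
     (\<forall>\<eta>. test_function 0 T \<eta> \<longrightarrow>
        (\<exists>J. has_bochner {0<..<T} (H10 \<Lambda>) (H1_norm \<Lambda>) (\<lambda>t x. deriv \<eta> t * u t x) J \<and>
             has_bochner {0<..<T} (H10 \<Lambda>) (H1_norm \<Lambda>) (\<lambda>t x. - (\<eta> t * v t x)) J))"


section \<open>The Kelvin-Voigt problem\<close>

text \<open>\<open>u\<close> is a weak solution with material properties \<open>E\<close>, \<open>\<nu>\<close> on \<open>{0..\<Lambda>}\<close>, forcing \<open>f\<close> and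
  initial displacement \<open>u0\<close>; \<open>v\<close> is its time derivative.\<close>

definition kv_solution ::
  "real \<Rightarrow> real \<Rightarrow> (real \<Rightarrow> real) \<Rightarrow> (real \<Rightarrow> real) \<Rightarrow> (real \<Rightarrow> real \<Rightarrow> real) \<Rightarrow> (real \<Rightarrow> real) \<Rightarrow>
     (real \<Rightarrow> real \<Rightarrow> real) \<Rightarrow> bool" where
  "kv_solution \<Lambda> T E \<nu> f u0 u \<longleftrightarrow>
     u \<in> C_H10 \<Lambda> T \<and>
     (AE x in lebesgue_on {0..\<Lambda>}. u 0 x = u0 x) \<and>
     (\<exists>v \<in> L2_H10 \<Lambda> T. time_deriv \<Lambda> T u v \<and>
        (AE t in lebesgue_on {0<..<T}. \<forall>\<phi> \<in> H10 \<Lambda>.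
           (LINT x|lebesgue_on {0..\<Lambda>}. \<nu> x * D\<^sub>x \<Lambda> (v t) x * D\<^sub>x \<Lambda> \<phi> x) +
           (LINT x|lebesgue_on {0..\<Lambda>}. E x * D\<^sub>x \<Lambda> (u t) x * D\<^sub>x \<Lambda> \<phi> x) =
           L2_inner \<Lambda> (f t) \<phi>))"


section \<open>Material properties\<close>

definition periodic1 :: "(real \<Rightarrow> real) \<Rightarrow> bool" where
  "periodic1 \<xi> \<longleftrightarrow> (\<forall>x. \<xi> (x + 1) = \<xi> x)"

text \<open>For a 1-periodic function. Continuity and one-sided limits are those of the function on
  the whole real line, so that a jump between neighbouring cells counts as a discontinuity at 0.\<close>

definition piecewise_continuous :: "(real \<Rightarrow> real) \<Rightarrow> bool" where
  "piecewise_continuous \<xi> \<longleftrightarrow>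
     (\<exists>S. finite S \<and> S \<subseteq> {0..<1} \<and> (\<forall>x \<in> {0..<1} - S. isCont \<xi> x) \<and>
          (\<forall>x\<in>S. (\<exists>l. (\<xi> \<longlongrightarrow> l) (at_left x)) \<and> (\<exists>r. (\<xi> \<longlongrightarrow> r) (at_right x))))"

definition ess_sup :: "(real \<Rightarrow> real) \<Rightarrow> ereal" where
  "ess_sup \<xi> = esssup lebesgue (\<lambda>x. ereal (\<xi> x))"

definition ess_inf :: "(real \<Rightarrow> real) \<Rightarrow> ereal" where
  "ess_inf \<xi> = - esssup lebesgue (\<lambda>x. ereal (- \<xi> x))"

text \<open>The intervals are \<open>[a 0, a 1), \<dots>, [a (N-2), a (N-1)), [a (N-1), a N]\<close> with \<open>a 0 = 0\<close>
  and \<open>a N = 1\<close>. Because the last one contains 1, periodicity makes the values on the first and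
  last intervals agree; this is the more restrictive of the possible conventions at the right
  end point.\<close>

definition piecewise_constant :: "(real \<Rightarrow> real) \<Rightarrow> (real \<Rightarrow> real) \<Rightarrow> bool" where
  "piecewise_constant E \<nu> \<longleftrightarrow>
     periodic1 E \<and> periodic1 \<nu> \<and> (\<forall>x. 0 < E x) \<and> (\<forall>x. 0 < \<nu> x) \<and>
     (\<exists>N::nat. \<exists>a::nat \<Rightarrow> real. 1 \<le> N \<and> a 0 = 0 \<and> a N = 1 \<and> (\<forall>i<N. a i < a (Suc i)) \<and>
        (\<forall>i<N. let P = (if Suc i = N then {a i..a (Suc i)} else {a i..<a (Suc i)})
               in (\<exists>c. \<forall>x\<in>P. E x = c) \<and> (\<exists>d. \<forall>x\<in>P. \<nu> x = d)))"

end

theory Submission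
  imports Defs
begin

text \<open>
  The forcing can be eliminated: if \<open>(u, v)\<close> with \<open>v = \<partial>\<^sub>t u\<close> solves the problem with
  coefficients \<open>E, \<nu>\<close>, then \<open>(u', v')\<close> solves the one with coefficients \<open>E', \<nu>'\<close> iff
  \<open>\<nu>' D v' = \<nu> D v + E D u - E' D u'\<close> when tested with all \<open>D \<phi>\<close>, \<open>\<phi> \<in> H\<^sup>1\<^sub>0\<close>. In one
  space dimension \<open>\<nu>' D z = h\<close> (tested in this way) is solved explicitly by an antiderivative of
  \<open>(h - c) / \<nu>'\<close>, where the constant \<open>c\<close> makes the mean vanish, and the solution operator
  \<open>R : L\<^sup>2 \<rightarrow> H\<^sup>1\<^sub>0\<close> is bounded. Hence \<open>v' = R (\<nu> D v + E D u) - R (E' D u')\<close> is an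
  ordinary differential equation in \<open>H\<^sup>1\<^sub>0\<close> with a Lipschitz right-hand side: Picard iteration
  gives existence, and Gronwall's inequality bounds \<open>u' - u\<close> by the time integral of
  \<open>\<parallel>(\<nu> - \<nu>') D v\<parallel> + \<parallel>(E - E') D u\<parallel>\<close>. This tends to zero by dominated convergence when the
  coefficients are replaced by uniformly bounded piecewise constant functions that converge almost
  everywhere; uniform convergence is not available, since a jump at the cell boundary cannot be
  matched.
\<close>

section \<open>Smooth test functions\<close>

text \<open>The coefficient differences multiply only the strains of the given solution, which stay
  fixed along the approximation; this is why pointwise convergence with a common bound is enough.
  The estimate is arranged for this purpose: it inverts the viscosity operator of the perturbed
  problem, whose inverse is bounded in terms of the domain and the common lower bound of the
  coefficients. Derivatives of members of H10 are, up to null sets, exactly the square integrable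
  functions of mean zero. Testing with them determines a stress up to an additive constant, which is
  the origin of \<open>c\<close>. Vectors are functions and are known only up to seminorm zero.
  Identities between vectors are therefore stated by inner products with every \<open>w\<close>,
  which reduces calculus in time to real functions. The Bochner integral serves two purposes: it
  relates the time derivative in the problem to this tested form, and it produces a vector whose
  inner products are prescribed time integrals. Norm estimates come from testing a difference with
  itself.\<close>

definition smooth :: "(real \<Rightarrow> real) \<Rightarrow> bool" where
  "smooth f \<longleftrightarrow> (\<forall>k x. (deriv ^^ k) f differentiable (at x))"

text \<open>By induction every iterated derivative stays in \<open>S\<close>. Each closure property
  below then needs only a set stable under differentiation, never a formula for the k-th
  derivative.\<close>

lemma smooth_coinduct:
  assumes "f \<in> S"
    and step: "\<And>f x. f \<in> S \<Longrightarrow> \<exists>g\<in>S. \<forall>x. (f has_real_derivative g x) (at x)"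
  shows "smooth f"
proof -
  have d: "deriv g \<in> S" "g differentiable (at x)" if g: "g \<in> S" for g x
  proof -
    obtain h where h: "h \<in> S" "\<And>x. (g has_real_derivative h x) (at x)"
      using step[OF g] by blast
    then have "deriv g = h" by (auto intro: DERIV_imp_deriv)
    with h show "deriv g \<in> S" "g differentiable (at x)"
      by (auto simp: real_differentiable_def)
  qed
  have "(deriv ^^ k) f \<in> S" for k
    by (induction k) (use assms(1) d in auto)
  then show ?thesis
    unfolding smooth_def using d by blast
qed

lemma smooth_has_deriv: "smooth f \<Longrightarrow> (f has_real_derivative deriv f x) (at x)"
  unfolding smooth_def DERIV_deriv_iff_real_differentiable by (metis funpow_0)

lemma smooth_deriv: "smooth f \<Longrightarrow> smooth (deriv f)"
  unfolding smooth_def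
proof (intro allI)
  fix k x assume "\<forall>k x. (deriv ^^ k) f differentiable (at x)"
  then have "(deriv ^^ Suc k) f differentiable (at x)" by blast
  then show "(deriv ^^ k) (deriv f) differentiable (at x)"
    by (simp add: funpow_swap1)
qed

lemma smooth_antideriv:
  assumes "smooth f" "\<And>x. (F has_real_derivative f x) (at x)"
  shows "smooth F"
proof (rule smooth_coinduct[where S="insert F {g. smooth g}"])
  fix g assume "g \<in> insert F {g. smooth g}"
  then show "\<exists>h\<in>insert F {g. smooth g}. \<forall>x. (g has_real_derivative h x) (at x)"
    using assms smooth_has_deriv[of g] smooth_deriv[of g] by blast
qed simp

lemma smooth_continuous: "smooth f \<Longrightarrow> continuous_on A f"
  by (meson DERIV_isCont continuous_at_imp_continuous_on smooth_has_deriv)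

lemma smooth_lincomb:
  assumes "smooth f" "smooth g"
  shows "smooth (\<lambda>x. c * f x + d * g x)"
proof (rule smooth_coinduct[where S="{\<lambda>x. c * f x + d * g x |f g. smooth f \<and> smooth g}"])
  fix h assume "h \<in> {\<lambda>x. c * f x + d * g x |f g. smooth f \<and> smooth g}"
  then obtain f g where h: "h = (\<lambda>x. c * f x + d * g x)" "smooth f" "smooth g" by blast
  then have "(h has_real_derivative c * deriv f x + d * deriv g x) (at x)" for x
    unfolding h(1) using h(2,3) by (intro DERIV_add DERIV_cmult smooth_has_deriv)
  moreover have "(\<lambda>x. c * deriv f x + d * deriv g x) \<in> {\<lambda>x. c * f x + d * g x |f g. smooth f \<and> smooth g}"
    using h smooth_deriv by blast
  ultimately show "\<exists>h'\<in>{\<lambda>x. c * f x + d * g x |f g. smooth f \<and> smooth g}.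
      \<forall>x. (h has_real_derivative h' x) (at x)"
    by (intro bexI[of _ "\<lambda>x. c * deriv f x + d * deriv g x"]) auto
qed (use assms in blast)

inductive_set smooth_products :: "(real \<Rightarrow> real) set" where
  prod: "smooth f \<Longrightarrow> smooth g \<Longrightarrow> (\<lambda>x. f x * g x) \<in> smooth_products"
| add: "f \<in> smooth_products \<Longrightarrow> g \<in> smooth_products \<Longrightarrow> (\<lambda>x. f x + g x) \<in> smooth_products"

lemma smooth_mult:
  assumes "smooth f" "smooth g"
  shows "smooth (\<lambda>x. f x * g x)"
proof (rule smooth_coinduct[where S=smooth_products])
  fix h assume "h \<in> smooth_products"
  then show "\<exists>h'\<in>smooth_products. \<forall>x. (h has_real_derivative h' x) (at x)"
  proof induction
    case (prod f g)
    have "((\<lambda>x. f x * g x) has_real_derivative f x * deriv g x + deriv f x * g x) (at x)" for x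
      using prod by (intro DERIV_mult' smooth_has_deriv)
    moreover have "(\<lambda>x. f x * deriv g x + deriv f x * g x) \<in> smooth_products"
      using prod by (intro smooth_products.intros smooth_deriv)
    ultimately show ?case by (intro bexI[of _ "\<lambda>x. f x * deriv g x + deriv f x * g x"]) auto
  next
    case (add f g)
    then obtain f' g' where "f' \<in> smooth_products" "\<forall>x. (f has_real_derivative f' x) (at x)"
      "g' \<in> smooth_products" "\<forall>x. (g has_real_derivative g' x) (at x)" by blast
    then show ?case
      by (intro bexI[of _ "\<lambda>x. f' x + g' x"] smooth_products.add) (auto intro: DERIV_add)
  qed
qed (rule smooth_products.prod[OF assms])

lemma smooth_affine:
  assumes "smooth f" shows "smooth (\<lambda>x. f (a * x + b))"
\<comment> \<open>The chain rule contributes a factor \<open>a\<close> at each differentiation; the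
  free coefficient \<open>c\<close> absorbs it.\<close>
proof (rule smooth_coinduct[where S="{\<lambda>x. c * f (a * x + b) |c f. smooth f}"])
  fix h assume "h \<in> {\<lambda>x. c * f (a * x + b) |c f. smooth f}"
  then obtain c f where h: "h = (\<lambda>x. c * f (a * x + b))" "smooth f" by blast
  have "(h has_real_derivative (c * a) * deriv f (a * x + b)) (at x)" for x
  proof -
    have "((\<lambda>x. a * x + b) has_real_derivative a) (at x)"
      by (auto intro!: derivative_eq_intros)
    from DERIV_cmult[OF DERIV_chain2[OF smooth_has_deriv[OF h(2)] this], of c]
    show ?thesis unfolding h(1) by (simp add: mult_ac)
  qed
  then show "\<exists>h'\<in>{\<lambda>x. c * f (a * x + b) |c f. smooth f}. \<forall>x. (h has_real_derivative h' x) (at x)"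
    using smooth_deriv[OF h(2)]
    by (intro bexI[of _ "\<lambda>x. (c * a) * deriv f (a * x + b)"]) auto
next
  show "(\<lambda>x. f (a * x + b)) \<in> {\<lambda>x. c * f (a * x + b) |c f. smooth f}"
    using assms by (intro CollectI exI[of _ 1] exI[of _ f]) simp
qed

section \<open>Flat functions and bump functions\<close>

definition flat_exp :: "real poly \<Rightarrow> real \<Rightarrow> real" where
  "flat_exp p x = (if 0 < x then poly p (1 / x) * exp (- 1 / x) else 0)"

lemma poly_exp_tendsto_0: "((\<lambda>s. poly p s * exp (- s)) \<longlongrightarrow> (0::real)) at_top"
proof -
  have *: "((\<lambda>s. s ^ k * exp (- s)) \<longlongrightarrow> (0::real)) at_top" for k
    using tendsto_power_div_exp_0[of k] by (simp add: exp_minus divide_inverse)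
  have "((\<lambda>s. \<Sum>i\<le>degree p. coeff p i * (s ^ i * exp (- s))) \<longlongrightarrow> (\<Sum>i\<le>degree p. coeff p i * 0)) at_top"
    by (intro tendsto_intros *)
  then show ?thesis
    by (simp add: poly_altdef sum_distrib_right mult.assoc)
qed

text \<open>With s = 1/x the derivative of p(s) exp(-s) is s^2 (p(s) - p'(s)) exp(-s);
  \<open>[:0, 0, 1:]\<close> is the factor s^2. So the family is stable under differentiation and
  \<open>smooth_coinduct\<close> applies. At 0 the right difference quotient is s p(s) exp(-s) with
  s = 1/h; \<open>pCons 0 p\<close> absorbs the division by h.\<close>

lemma flat_exp_has_deriv:
  "(flat_exp p has_real_derivative flat_exp ([:0, 0, 1:] * (p - pderiv p)) x) (at x)"
proof -
  consider "x > 0" | "x < 0" | "x = 0" by linarith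
  then show ?thesis
  proof cases
    case 1
    have "((\<lambda>y. poly p (1 / y) * exp (- 1 / y)) has_real_derivative
        poly p (1 / x) * (exp (- 1 / x) * (1 / x\<^sup>2)) + poly (pderiv p) (1 / x) * (- 1 / x\<^sup>2) * exp (- 1 / x)) (at x)"
    proof -
      have "((\<lambda>y. poly p (1 / y)) has_real_derivative poly (pderiv p) (1 / x) * (- 1 / x\<^sup>2)) (at x)"
        by (rule DERIV_chain2[OF poly_DERIV])
           (use 1 in \<open>auto intro!: derivative_eq_intros simp: power2_eq_square\<close>)
      moreover have "((\<lambda>y. exp (- 1 / y)) has_real_derivative exp (- 1 / x) * (1 / x\<^sup>2)) (at x)"
        using 1 by (auto intro!: derivative_eq_intros simp: power2_eq_square)
      ultimately show ?thesis
        by (rule DERIV_mult')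
    qed
    also have "poly p (1 / x) * (exp (- 1 / x) * (1 / x\<^sup>2)) + poly (pderiv p) (1 / x) * (- 1 / x\<^sup>2) * exp (- 1 / x) = flat_exp ([:0, 0, 1:] * (p - pderiv p)) x" 
      using 1 by (simp add: flat_exp_def field_simps power2_eq_square)
    finally show ?thesis
      by (rule has_field_derivative_transform_within_open[where S="{0<..}"])
        (use 1 in \<open>auto simp: flat_exp_def\<close>)
  next
    case 2
    have "((\<lambda>_. 0) has_real_derivative 0) (at x)" by simp
    then show ?thesis
      using 2 has_field_derivative_transform_within_open[of "\<lambda>_. 0" 0 x "{..<0}" "flat_exp p"]
      by (simp add: flat_exp_def)
  next
    case 3
    have *: "((\<lambda>h. flat_exp p h / h) \<longlongrightarrow> 0) (at 0)"
    proof (rule filterlim_split_at)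
      have "((\<lambda>h. flat_exp p h / h) \<longlongrightarrow> 0) (at_left 0) \<longleftrightarrow> ((\<lambda>h::real. 0::real) \<longlongrightarrow> 0) (at_left 0)"
        by (intro tendsto_cong) (auto simp: flat_exp_def eventually_at_filter)
      then show "((\<lambda>h. flat_exp p h / h) \<longlongrightarrow> 0) (at_left 0)" by simp
      have "((\<lambda>h. poly (pCons 0 p) (inverse h) * exp (- inverse h)) \<longlongrightarrow> 0) (at_right (0::real))"
        by (rule filterlim_compose[OF poly_exp_tendsto_0 filterlim_inverse_at_top_right])
      moreover have "((\<lambda>h. flat_exp p h / h) \<longlongrightarrow> 0) (at_right 0) \<longleftrightarrow> 
         ((\<lambda>h. poly (pCons 0 p) (inverse h) * exp (- inverse h)) \<longlongrightarrow> 0) (at_right (0::real))"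
        by (intro tendsto_cong) (auto simp: flat_exp_def eventually_at_filter divide_inverse mult_ac)
      ultimately show "((\<lambda>h. flat_exp p h / h) \<longlongrightarrow> 0) (at_right 0)" by simp
    qed
    then show ?thesis unfolding 3 DERIV_def by (simp add: flat_exp_def)
  qed
qed

lemma smooth_flat_exp: "smooth (flat_exp p)"
  by (rule smooth_coinduct[where S="range flat_exp"]) (use flat_exp_has_deriv in blast)+

text \<open>One flat factor for each end point. The shift by 1 keeps the support strictly inside (a,
  b), and the growing slope sends both arguments to infinity at interior points, where exp(-1/y)
  tends to 1. So the bumps converge to the indicator of (a, b) and stay in [0, 1].\<close>

definition bump :: "real \<Rightarrow> real \<Rightarrow> nat \<Rightarrow> real \<Rightarrow> real" where
  "bump a b n x = flat_exp 1 (real (Suc n) * (x - a) - 1) * flat_exp 1 (real (Suc n) * (b - x) - 1)"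

lemma smooth_bump: "smooth (bump a b n)"
proof -
  have "smooth (\<lambda>x. flat_exp 1 (real (Suc n) * x + (- real (Suc n) * a - 1)) *
     flat_exp 1 (- real (Suc n) * x + (real (Suc n) * b - 1)))"
    by (intro smooth_mult smooth_affine smooth_flat_exp)
  then show ?thesis unfolding bump_def[abs_def] by (simp add: algebra_simps)
qed

lemma bump_bounds: "0 \<le> bump a b n x" "bump a b n x \<le> 1"
  by (auto simp: bump_def flat_exp_def intro!: mult_le_one)

lemma flat_exp_1_eq_0_iff: "flat_exp 1 x = 0 \<longleftrightarrow> x \<le> 0"
  by (simp add: flat_exp_def)

lemma bump_eq_0_iff: "bump a b n x = 0 \<longleftrightarrow> x \<le> a + 1 / Suc n \<or> b - 1 / Suc n \<le> x"
proof -
  have *: "real (Suc n) * d - 1 \<le> 0 \<longleftrightarrow> d \<le> 1 / Suc n" for d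
    by (simp add: pos_le_divide_eq mult.commute)
  show ?thesis unfolding bump_def mult_eq_0_iff flat_exp_1_eq_0_iff * by linarith
qed

lemma bump_tendsto: "(\<lambda>n. bump a b n x) \<longlonglongrightarrow> indicator {a<..<b} x"
proof -
  have *: "(\<lambda>n. flat_exp 1 (real (Suc n) * d - 1)) \<longlonglongrightarrow> indicator {0<..} d" for d
  proof (cases "d > 0")
    case True
    have l: "filterlim (\<lambda>n. real (Suc n) * d - 1) at_top sequentially"
      using True by real_asymp
    have "(\<lambda>n. exp (- 1 / (real (Suc n) * d - 1))) \<longlonglongrightarrow> 1"
      using True by real_asymp
    moreover have "\<forall>\<^sub>F n in sequentially. exp (- 1 / (real (Suc n) * d - 1)) = flat_exp 1 (real (Suc n) * d - 1)"
      using filterlim_at_top_dense[THEN iffD1, OF l, rule_format, of 0]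
      by eventually_elim (auto simp: flat_exp_def)
    ultimately show ?thesis using True by (simp add: tendsto_cong)
  next
    case False
    then have "real (Suc n) * d \<le> 0" for n by (simp add: mult_nonneg_nonpos)
    then have "flat_exp 1 (real (Suc n) * d - 1) = 0" for n
      by (simp add: flat_exp_1_eq_0_iff order.trans[OF _ zero_le_one])
    then show ?thesis using False by simp
  qed
  have "(\<lambda>n. bump a b n x) \<longlonglongrightarrow> indicator {0<..} (x - a) * indicator {0<..} (b - x)"
    unfolding bump_def by (intro tendsto_mult *)
  also have "indicator {0<..} (x - a) * indicator {0<..} (b - x) = (indicator {a<..<b} x :: real)"
    by (auto simp: indicator_def)
  finally show ?thesis .
qed

text \<open>A compact subset of the open interval keeps a positive distance from both ends, so the
  closure condition amounts to two numbers \<open>c\<close> and \<open>d\<close>.\<close>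

lemma test_function_alt:
  "test_function a b f \<longleftrightarrow> smooth f \<and> (\<exists>c d. a < c \<and> d < b \<and> (\<forall>x. f x \<noteq> 0 \<longrightarrow> c \<le> x \<and> x \<le> d))"
proof -
  have "closure {x. f x \<noteq> 0} \<subseteq> {a<..<b} \<longleftrightarrow> (\<exists>c d. a < c \<and> d < b \<and> (\<forall>x. f x \<noteq> 0 \<longrightarrow> c \<le> x \<and> x \<le> d))"
    (is "?L \<longleftrightarrow> ?R")
  proof
    assume L: ?L
    let ?K = "closure {x. f x \<noteq> 0}"
    show ?R
    proof (cases "?K = {}")
      case True
      then have "f x = 0" for x using closure_subset by blast
      \<comment> \<open>An empty support puts no condition on \<open>c\<close> and \<open>d\<close>
        beyond the two outer inequalities.\<close>
      then show ?thesis by (intro exI[of _ "a+1"] exI[of _ "b-1"]) auto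
    next
      case False
      have "compact ?K"
        using L bounded_subset[of "{a<..<b}" ?K] by (simp add: compact_eq_bounded_closed)
      with False obtain c d where "c \<in> ?K" "d \<in> ?K" "\<forall>x\<in>?K. c \<le> x \<and> x \<le> d"
        by (meson compact_attains_inf compact_attains_sup)
      then show ?thesis using L closure_subset[of "{x. f x \<noteq> 0}"]
        by (intro exI[of _ c] exI[of _ d]) auto
    qed
  next
    assume ?R
    then obtain c d where cd: "a < c" "d < b" "\<forall>x. f x \<noteq> 0 \<longrightarrow> c \<le> x \<and> x \<le> d" by blast
    then have "closure {x. f x \<noteq> 0} \<subseteq> {c..d}" by (intro closure_minimal) auto
    then show ?L using cd by auto
  qed
  then show ?thesis by (simp add: test_function_def smooth_def)
qed

lemma test_functionI:
  "smooth f \<Longrightarrow> a < c \<Longrightarrow> d < b \<Longrightarrow> (\<And>x. f x \<noteq> 0 \<Longrightarrow> c \<le> x \<and> x \<le> d) \<Longrightarrow> test_function a b f"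
  unfolding test_function_alt by blast

lemma test_bump: "a' \<le> a \<Longrightarrow> b \<le> b' \<Longrightarrow> test_function a' b' (bump a b n)"
proof (rule test_functionI[OF smooth_bump, of _ "a + 1 / Suc n" "b - 1 / Suc n"])
  assume *: "a' \<le> a" "b \<le> b'"
  have "0 < 1 / real (Suc n)" by simp
  with * show "a' < a + 1 / Suc n" "b - 1 / Suc n < b'" by linarith+
  fix x assume "bump a b n x \<noteq> 0"
  then show "a + 1 / Suc n \<le> x \<and> x \<le> b - 1 / Suc n"
    unfolding bump_eq_0_iff by linarith+
qed

lemma test_lincomb:
  assumes "test_function a b f" "test_function a b g"
  shows "test_function a b (\<lambda>x. c * f x + d * g x)"
proof -
  obtain p q where f: "smooth f" "a < p" "q < b" "\<And>x. f x \<noteq> 0 \<Longrightarrow> p \<le> x \<and> x \<le> q"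
    using assms(1) unfolding test_function_alt by blast
  obtain r s where g: "smooth g" "a < r" "s < b" "\<And>x. g x \<noteq> 0 \<Longrightarrow> r \<le> x \<and> x \<le> s"
    using assms(2) unfolding test_function_alt by blast
  show ?thesis
  proof (rule test_functionI[OF smooth_lincomb, of _ _ _ "min p r" "max q s"])
    fix x assume "c * f x + d * g x \<noteq> 0"
    then have "f x \<noteq> 0 \<or> g x \<noteq> 0" by auto
    then show "min p r \<le> x \<and> x \<le> max q s" using f(4)[of x] g(4)[of x] by auto
  qed (use f g in auto)
qed

lemma test_deriv:
  assumes "test_function a b f" shows "test_function a b (deriv f)"
proof -
  obtain p q where f: "smooth f" "a < p" "q < b" "\<And>x. f x \<noteq> 0 \<Longrightarrow> p \<le> x \<and> x \<le> q"
    using assms(1) unfolding test_function_alt by blast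
  have "deriv f x = 0" if "\<not> (p \<le> x \<and> x \<le> q)" for x
  proof -
    have "((\<lambda>_. 0) has_real_derivative 0) (at x)" by simp
    then have "(f has_real_derivative 0) (at x)"
      by (rule has_field_derivative_transform_within_open[where S="- {p..q}"])
         (use that f(4) in auto)
    then show ?thesis by (rule DERIV_imp_deriv)
  qed
  then show ?thesis unfolding test_function_alt using f smooth_deriv by blast
qed

section \<open>Semi-inner-product spaces and \<open>L\<^sup>2\<close>\<close>

text \<open>All laws are restricted to \<open>X\<close>, and \<open>ip a a = 0\<close> does not
  force \<open>a\<close> to vanish, since vectors are functions and not classes. The instances are
  \<open>L2\<close>, \<open>H1\<close> and \<open>H10\<close>, the last two with the inner product
  of H1.\<close>

locale semi_inner =
  fixes X :: "(real \<Rightarrow> real) set" and ip :: "(real \<Rightarrow> real) \<Rightarrow> (real \<Rightarrow> real) \<Rightarrow> real"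
    and N :: "(real \<Rightarrow> real) \<Rightarrow> real"
  assumes zero_mem: "(\<lambda>x. 0) \<in> X"
    and lincomb_mem: "a \<in> X \<Longrightarrow> b \<in> X \<Longrightarrow> (\<lambda>x. c * a x + d * b x) \<in> X"
    and ip_sym: "a \<in> X \<Longrightarrow> b \<in> X \<Longrightarrow> ip a b = ip b a"
    and ip_lincomb: "a \<in> X \<Longrightarrow> b \<in> X \<Longrightarrow> w \<in> X \<Longrightarrow>
      ip (\<lambda>x. c * a x + d * b x) w = c * ip a w + d * ip b w"
    and ip_pos: "a \<in> X \<Longrightarrow> 0 \<le> ip a a"
    and N_eq: "a \<in> X \<Longrightarrow> N a = sqrt (ip a a)"
begin

lemma diff_mem: "a \<in> X \<Longrightarrow> b \<in> X \<Longrightarrow> (\<lambda>x. a x - b x) \<in> X"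
  using lincomb_mem[of a b 1 "-1"] by simp

lemma add_mem: "a \<in> X \<Longrightarrow> b \<in> X \<Longrightarrow> (\<lambda>x. a x + b x) \<in> X"
  using lincomb_mem[of a b 1 1] by simp

lemma scale_mem: "a \<in> X \<Longrightarrow> (\<lambda>x. c * a x) \<in> X"
  using lincomb_mem[of a a c 0] by simp

lemma sum_mem: "(\<And>i. i \<in> I \<Longrightarrow> g i \<in> X) \<Longrightarrow> (\<lambda>x. \<Sum>i\<in>I. c i * g i x) \<in> X"
  by (induction I rule: infinite_finite_induct)
     (use zero_mem add_mem scale_mem in auto)

lemma ip_diff: "a \<in> X \<Longrightarrow> b \<in> X \<Longrightarrow> w \<in> X \<Longrightarrow> ip (\<lambda>x. a x - b x) w = ip a w - ip b w"
  using ip_lincomb[of a b w 1 "-1"] by simp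

lemma ip_add: "a \<in> X \<Longrightarrow> b \<in> X \<Longrightarrow> w \<in> X \<Longrightarrow> ip (\<lambda>x. a x + b x) w = ip a w + ip b w"
  using ip_lincomb[of a b w 1 1] by simp

lemma ip_scale: "a \<in> X \<Longrightarrow> w \<in> X \<Longrightarrow> ip (\<lambda>x. c * a x) w = c * ip a w"
  using ip_lincomb[of a a w c 0] by simp

lemma ip_zero: "w \<in> X \<Longrightarrow> ip (\<lambda>x. 0) w = 0"
  using ip_lincomb[of w w w 0 0] by simp

lemma ip_diff_right: "a \<in> X \<Longrightarrow> b \<in> X \<Longrightarrow> w \<in> X \<Longrightarrow> ip w (\<lambda>x. a x - b x) = ip w a - ip w b"
  using ip_diff[of a b w] ip_sym[OF diff_mem] ip_sym by metis

lemma ip_sum: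
  assumes "w \<in> X" "\<And>i. i \<in> I \<Longrightarrow> g i \<in> X"
  shows "ip (\<lambda>x. \<Sum>i\<in>I. c i * g i x) w = (\<Sum>i\<in>I. c i * ip (g i) w)"
  using assms(2)
proof (induction I rule: infinite_finite_induct)
  case (insert i I)
  then show ?case using ip_add[OF scale_mem sum_mem[of I g c], of "g i" w "c i"] assms(1) ip_scale by auto
qed (use ip_zero assms in auto)

lemma N_nonneg: "a \<in> X \<Longrightarrow> 0 \<le> N a"
  by (simp add: N_eq ip_pos)

lemma N_sq: "a \<in> X \<Longrightarrow> (N a)\<^sup>2 = ip a a"
  by (simp add: N_eq ip_pos)

lemma N_zero: "N (\<lambda>x. 0) = 0"
  using zero_mem ip_zero by (simp add: N_eq)

lemma ip_expand:
  assumes "a \<in> X" "b \<in> X"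
  shows "ip (\<lambda>x. a x + c * b x) (\<lambda>x. a x + c * b x) = ip a a + 2 * c * ip a b + c\<^sup>2 * ip b b"
proof -
  let ?s = "\<lambda>x. a x + c * b x"
  have s: "?s \<in> X" using lincomb_mem[OF assms, of 1 c] by simp
  have e: "ip ?s w = ip a w + c * ip b w" if "w \<in> X" for w
    using ip_lincomb[OF assms that, of 1 c] by simp
  show ?thesis
    using e[OF s] e[OF assms(1)] e[OF assms(2)] ip_sym[OF assms(1) s] ip_sym[OF assms(2) s] ip_sym[OF assms]
    by (simp add: algebra_simps power2_eq_square)
qed

text \<open>The squared norm of a + c b is a nonnegative quadratic polynomial in \<open>c\<close>.
  If its leading coefficient vanishes it is affine, and an affine function bounded below has slope
  zero; otherwise it is evaluated at its minimum c = - ip a b / ip b b.\<close>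

lemma Cauchy_Schwarz:
  assumes "a \<in> X" "b \<in> X"
  shows "\<bar>ip a b\<bar> \<le> N a * N b"
proof -
  have *: "0 \<le> ip a a + 2 * c * ip a b + c\<^sup>2 * ip b b" for c
    using ip_pos[OF lincomb_mem[OF assms, of 1 c]] ip_expand[OF assms, of c] by simp
  have "(ip a b)\<^sup>2 \<le> ip a a * ip b b"
  proof (cases "ip b b = 0")
    case True
    have "ip a b = 0"
    proof (rule ccontr)
      assume nz: "ip a b \<noteq> 0"
      have "0 \<le> ip a a + 2 * (- (ip a a + 1) / (2 * ip a b)) * ip a b"
        using *[of "- (ip a a + 1) / (2 * ip a b)"] True by simp
      also have "\<dots> = -1" using nz by (simp add: field_simps)
      finally show False by simp
    qed
    then show ?thesis using True by simp
  next
    case False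
    with ip_pos[OF assms(2)] have p: "ip b b > 0" by simp
    have "0 \<le> ip a a - (ip a b)\<^sup>2 / ip b b"
      using *[of "- ip a b / ip b b"] p by (simp add: field_simps power2_eq_square)
    then show ?thesis using p by (simp add: field_simps)
  qed
  then have "sqrt ((ip a b)\<^sup>2) \<le> sqrt (ip a a * ip b b)" by (rule real_sqrt_le_mono)
  then show ?thesis using assms by (simp add: N_eq real_sqrt_mult)
qed

lemma N_triangle:
  assumes "a \<in> X" "b \<in> X" shows "N (\<lambda>x. a x + b x) \<le> N a + N b"
proof -
  have m: "(\<lambda>x. a x + b x) \<in> X" using add_mem assms by blast
  have "(N (\<lambda>x. a x + b x))\<^sup>2 = (N a)\<^sup>2 + 2 * ip a b + (N b)\<^sup>2"
    using ip_expand[OF assms, of 1] m assms by (simp add: N_sq)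
  also have "\<dots> \<le> (N a + N b)\<^sup>2"
    using Cauchy_Schwarz[OF assms] by (simp add: power2_eq_square algebra_simps)
  finally show ?thesis
    using N_nonneg assms by (meson add_nonneg_nonneg power2_le_imp_le)
qed

lemma N_scale: "a \<in> X \<Longrightarrow> N (\<lambda>x. c * a x) = \<bar>c\<bar> * N a"
proof -
  assume a: "a \<in> X"
  have m: "(\<lambda>x. c * a x) \<in> X" using scale_mem a by blast
  have "ip (\<lambda>x. c * a x) (\<lambda>x. c * a x) = c\<^sup>2 * ip a a"
    using ip_scale[OF a m] ip_scale[OF a a] ip_sym[OF a m] by (simp add: power2_eq_square)
  then show ?thesis using a m by (simp add: N_eq real_sqrt_mult)
qed

lemma N_minus: "a \<in> X \<Longrightarrow> N (\<lambda>x. - a x) = N a"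
  using N_scale[of a "-1"] by simp

lemma N_commute: "a \<in> X \<Longrightarrow> b \<in> X \<Longrightarrow> N (\<lambda>x. a x - b x) = N (\<lambda>x. b x - a x)"
  using N_minus[OF diff_mem, of a b] by simp

lemma N_diff_triangle:
  "a \<in> X \<Longrightarrow> b \<in> X \<Longrightarrow> c \<in> X \<Longrightarrow> N (\<lambda>x. a x - c x) \<le> N (\<lambda>x. a x - b x) + N (\<lambda>x. b x - c x)"
  using N_triangle[OF diff_mem diff_mem, of a b b c] by simp

lemma N_triangle_diff: "a \<in> X \<Longrightarrow> b \<in> X \<Longrightarrow> N a \<le> N b + N (\<lambda>x. a x - b x)"
  using N_triangle[OF _ diff_mem, of b a b] by simp

lemma N_le_add: "a \<in> X \<Longrightarrow> b \<in> X \<Longrightarrow> N (\<lambda>x. a x - b x) \<le> N a + N b"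
  using N_triangle[of a "\<lambda>x. - b x"] scale_mem[of b "-1"] N_minus[of b] by simp

lemma N_abs_diff: "a \<in> X \<Longrightarrow> b \<in> X \<Longrightarrow> \<bar>N a - N b\<bar> \<le> N (\<lambda>x. a x - b x)"
  using N_triangle_diff[of a b] N_triangle_diff[of b a] N_commute[of a b] by simp

lemma tendsto_ip:
  assumes "\<And>n. a n \<in> X" "l \<in> X" "w \<in> X" "(\<lambda>n. N (\<lambda>x. a n x - l x)) \<longlonglongrightarrow> 0"
  shows "(\<lambda>n. ip (a n) w) \<longlonglongrightarrow> ip l w"
proof (rule LIM_zero_cancel, rule Lim_null_comparison)
  show "\<forall>\<^sub>F n in sequentially. norm (ip (a n) w - ip l w) \<le> N (\<lambda>x. a n x - l x) * N w"
    using Cauchy_Schwarz[OF diff_mem[OF assms(1,2)] assms(3)] ip_diff[OF assms(1,2,3)] by simp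
  show "(\<lambda>n. N (\<lambda>x. a n x - l x) * N w) \<longlonglongrightarrow> 0"
    using tendsto_mult_left_zero[OF assms(4)] .
qed

lemma tendsto_N:
  assumes "\<And>n. a n \<in> X" "l \<in> X" "(\<lambda>n. N (\<lambda>x. a n x - l x)) \<longlonglongrightarrow> 0"
  shows "(\<lambda>n. N (a n)) \<longlonglongrightarrow> N l"
proof (rule LIM_zero_cancel, rule Lim_null_comparison)
  show "\<forall>\<^sub>F n in sequentially. norm (N (a n) - N l) \<le> N (\<lambda>x. a n x - l x)"
    using N_abs_diff[OF assms(1,2)] by simp
qed (rule assms)

lemma closure_lincomb:
  assumes T: "\<And>\<phi> \<psi> c d. \<phi> \<in> T \<Longrightarrow> \<psi> \<in> T \<Longrightarrow> (\<lambda>x. c * \<phi> x + d * \<psi> x) \<in> T" "T \<subseteq> X"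
    and a: "a \<in> X" "\<And>e. 0 < e \<Longrightarrow> \<exists>\<phi>\<in>T. N (\<lambda>x. a x - \<phi> x) < e"
    and b: "b \<in> X" "\<And>e. 0 < e \<Longrightarrow> \<exists>\<phi>\<in>T. N (\<lambda>x. b x - \<phi> x) < e"
    and e: "0 < e"
  shows "\<exists>\<phi>\<in>T. N (\<lambda>x. (c * a x + d * b x) - \<phi> x) < e"
proof -
  \<comment> \<open>The summand 1 keeps the divisor positive and makes the last estimate
    strict.\<close>
  define e' where "e' = e / (\<bar>c\<bar> + \<bar>d\<bar> + 1)"
  have e': "0 < e'" using e by (simp add: e'_def add_pos_nonneg)
  obtain \<phi> where \<phi>: "\<phi> \<in> T" "N (\<lambda>x. a x - \<phi> x) < e'" using a(2)[OF e'] by blast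
  obtain \<psi> where \<psi>: "\<psi> \<in> T" "N (\<lambda>x. b x - \<psi> x) < e'" using b(2)[OF e'] by blast
  have m: "(\<lambda>x. a x - \<phi> x) \<in> X" "(\<lambda>x. b x - \<psi> x) \<in> X"
    using a b diff_mem T(2) \<phi> \<psi> by blast+
  have "N (\<lambda>x. c * (a x - \<phi> x) + d * (b x - \<psi> x)) \<le> \<bar>c\<bar> * N (\<lambda>x. a x - \<phi> x) + \<bar>d\<bar> * N (\<lambda>x. b x - \<psi> x)"
    using N_triangle[OF scale_mem[OF m(1)] scale_mem[OF m(2)], of c d] N_scale m by simp
  also have "\<dots> \<le> \<bar>c\<bar> * e' + \<bar>d\<bar> * e'"
    using \<phi> \<psi> by (intro add_mono mult_left_mono) auto
  also have "\<dots> < (\<bar>c\<bar> + \<bar>d\<bar> + 1) * e'" using e' by (simp add: algebra_simps)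
  also have "\<dots> = e" by (simp add: e'_def add_nonneg_eq_0_iff)
  finally have "N (\<lambda>x. c * a x + d * b x - (c * \<phi> x + d * \<psi> x)) < e"
    by (simp add: algebra_simps)
  then show ?thesis using T(1)[OF \<phi>(1) \<psi>(1), of c d] by (rule bexI)
qed

lemma closure_limit:
  assumes "T \<subseteq> X" "a \<in> X" "\<And>n. h n \<in> X" "\<And>n e. 0 < e \<Longrightarrow> \<exists>\<phi>\<in>T. N (\<lambda>x. h n x - \<phi> x) < e"
    and lim: "(\<lambda>n. N (\<lambda>x. h n x - a x)) \<longlonglongrightarrow> 0" and e: "0 < e"
  shows "\<exists>\<phi>\<in>T. N (\<lambda>x. a x - \<phi> x) < e"
proof -
  obtain n where n: "N (\<lambda>x. h n x - a x) < e / 2"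
    using LIMSEQ_D[OF lim, of "e/2"] e N_nonneg by (metis abs_le_D1 diff_zero half_gt_zero le_less_trans order_refl real_norm_def)
  obtain \<phi> where \<phi>: "\<phi> \<in> T" "N (\<lambda>x. h n x - \<phi> x) < e / 2"
    using assms(4)[of "e/2" n] e by auto
  have "N (\<lambda>x. a x - \<phi> x) < e"
    using N_diff_triangle[OF assms(2,3), of \<phi> n] assms(1) \<phi> N_commute[OF assms(2) assms(3)[of n]] n by auto
  with \<phi> show ?thesis by blast
qed

lemma closure_sequence:
  assumes "T \<subseteq> X" "a \<in> X" "\<And>e. 0 < e \<Longrightarrow> \<exists>\<phi>\<in>T. N (\<lambda>x. a x - \<phi> x) < e"
  obtains \<phi> where "\<And>n::nat. \<phi> n \<in> T" "(\<lambda>n. N (\<lambda>x. \<phi> n x - a x)) \<longlonglongrightarrow> 0"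
proof -
  have "\<exists>\<phi>\<in>T. N (\<lambda>x. a x - \<phi> x) < inverse (Suc n)" for n
    by (rule assms(3)) simp
  then obtain \<phi> where \<phi>: "\<And>n. \<phi> n \<in> T" "\<And>n. N (\<lambda>x. a x - \<phi> n x) < inverse (Suc n)"
    by metis
  have "(\<lambda>n. N (\<lambda>x. \<phi> n x - a x)) \<longlonglongrightarrow> 0"
  proof (rule Lim_null_comparison[OF _ LIMSEQ_inverse_real_of_nat])
    have "norm (N (\<lambda>x. \<phi> n x - a x)) \<le> inverse (real (Suc n))" for n
      using \<phi>(2)[of n] N_commute[OF assms(2), of "\<phi> n"] N_nonneg[OF diff_mem, of "\<phi> n" a] subsetD[OF assms(1) \<phi>(1)[of n]] assms(2) by simp
    then show "\<forall>\<^sub>F n in sequentially. norm (N (\<lambda>x. \<phi> n x - a x)) \<le> inverse (real (Suc n))" by simp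
  qed
  with \<phi>(1) that show ?thesis by blast
qed

lemma tendsto_ip_right:
  assumes "\<And>n. a n \<in> X" "l \<in> X" "w \<in> X" "(\<lambda>n. N (\<lambda>x. a n x - l x)) \<longlonglongrightarrow> 0"
  shows "(\<lambda>n. ip w (a n)) \<longlonglongrightarrow> ip w l"
  using tendsto_ip[OF assms] ip_sym[OF assms(3)] assms(1,2) by simp

end

section \<open>The space L2 of an interval\<close>

abbreviation (input) dom_measure :: "real \<Rightarrow> real measure" where
  "dom_measure \<Lambda> \<equiv> lebesgue_on {0..\<Lambda>}"

lemma finite_dom_measure: "finite_measure (dom_measure \<Lambda>)"
  by (rule finite_measure_lebesgue_on) simp

lemma L2D: "g \<in> L2 \<Lambda> \<Longrightarrow> g \<in> borel_measurable (dom_measure \<Lambda>)"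
  "g \<in> L2 \<Lambda> \<Longrightarrow> integrable (dom_measure \<Lambda>) (\<lambda>x. (g x)\<^sup>2)"
  by (auto simp: L2_def)

lemma L2_mult_integrable:
  assumes "g \<in> L2 \<Lambda>" "h \<in> L2 \<Lambda>"
  shows "integrable (dom_measure \<Lambda>) (\<lambda>x. g x * h x)"
proof (rule Bochner_Integration.integrable_bound)
  note [measurable] = L2D(1)[OF assms(1)] L2D(1)[OF assms(2)]
  show "integrable (dom_measure \<Lambda>) (\<lambda>x. (g x)\<^sup>2 + (h x)\<^sup>2)"
    using L2D(2) assms by (intro Bochner_Integration.integrable_add)
  show "(\<lambda>x. g x * h x) \<in> borel_measurable (dom_measure \<Lambda>)" by measurable
  have "\<bar>g x * h x\<bar> \<le> (g x)\<^sup>2 + (h x)\<^sup>2" for x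
  proof -
    have "0 \<le> (g x + h x)\<^sup>2" "0 \<le> (g x - h x)\<^sup>2" by simp_all
    then have "2 * \<bar>g x * h x\<bar> \<le> (g x)\<^sup>2 + (h x)\<^sup>2"
      by (simp add: power2_eq_square algebra_simps abs_if)
    then show ?thesis by simp
  qed
  then show "AE x in dom_measure \<Lambda>. norm (g x * h x) \<le> norm ((g x)\<^sup>2 + (h x)\<^sup>2)" by simp
qed

lemma L2_lincomb:
  assumes "a \<in> L2 \<Lambda>" "b \<in> L2 \<Lambda>" shows "(\<lambda>x. c * a x + d * b x) \<in> L2 \<Lambda>"
proof -
  note [measurable] = L2D(1)[OF assms(1)] L2D(1)[OF assms(2)]
  have "integrable (dom_measure \<Lambda>) (\<lambda>x. c\<^sup>2 * (a x)\<^sup>2 + d\<^sup>2 * (b x)\<^sup>2 + 2 * c * d * (a x * b x))"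
    using L2D(2) assms L2_mult_integrable
    by (intro Bochner_Integration.integrable_add integrable_mult_right) auto
  also have "(\<lambda>x. c\<^sup>2 * (a x)\<^sup>2 + d\<^sup>2 * (b x)\<^sup>2 + 2 * c * d * (a x * b x)) = (\<lambda>x. (c * a x + d * b x)\<^sup>2)"
    by (auto simp: power2_eq_square algebra_simps)
  finally show ?thesis unfolding L2_def by simp
qed

text \<open>The length remains a parameter because the same space serves twice: in space with
  \<Lambda>, and for scalar functions of time with \<open>T\<close>.\<close>

interpretation L2: semi_inner "L2 \<Lambda>" "L2_inner \<Lambda>" "L2_norm \<Lambda>" for \<Lambda>
proof
  fix a b w c d
  show "(\<lambda>x. 0) \<in> L2 \<Lambda>" by (simp add: L2_def)
  show "L2_inner \<Lambda> a b = L2_inner \<Lambda> b a" by (simp add: L2_inner_def mult.commute)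
  show "0 \<le> L2_inner \<Lambda> a a" by (simp add: L2_inner_def)
  show "L2_norm \<Lambda> a = sqrt (L2_inner \<Lambda> a a)" by (simp add: L2_norm_def)
  assume a: "a \<in> L2 \<Lambda>" and b: "b \<in> L2 \<Lambda>"
  then show "(\<lambda>x. c * a x + d * b x) \<in> L2 \<Lambda>" by (rule L2_lincomb)
  assume w: "w \<in> L2 \<Lambda>"
  have "L2_inner \<Lambda> (\<lambda>x. c * a x + d * b x) w = 
    (LINT x|dom_measure \<Lambda>. c * (a x * w x) + d * (b x * w x))"
    unfolding L2_inner_def by (simp add: algebra_simps)
  then show "L2_inner \<Lambda> (\<lambda>x. c * a x + d * b x) w = c * L2_inner \<Lambda> a w + d * L2_inner \<Lambda> b w"
    using L2_mult_integrable[OF a w] L2_mult_integrable[OF b w] by (simp add: L2_inner_def)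
qed

lemma L2_bounded:
  assumes "g \<in> borel_measurable (dom_measure \<Lambda>)" "AE x in dom_measure \<Lambda>. \<bar>g x\<bar> \<le> C"
  shows "g \<in> L2 \<Lambda>"
proof -
  interpret finite_measure "dom_measure \<Lambda>" by (rule finite_dom_measure)
  note [measurable] = assms(1)
  have "integrable (dom_measure \<Lambda>) (\<lambda>x. (g x)\<^sup>2)"
    by (rule integrable_const_bound[where B="C\<^sup>2"])
       (use assms(2) in \<open>auto simp: abs_le_square_iff[symmetric] elim!: eventually_mono\<close>)
  then show ?thesis by (simp add: L2_def)
qed

lemma L2_const: "(\<lambda>x. c) \<in> L2 \<Lambda>"
  by (rule L2_bounded[where C="\<bar>c\<bar>"]) auto

lemma L2_integrable: "g \<in> L2 \<Lambda> \<Longrightarrow> integrable (dom_measure \<Lambda>) g"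
  using L2_mult_integrable[OF _ L2_const[of 1]] by fastforce

lemma L2_continuous: "continuous_on {0..\<Lambda>} g \<Longrightarrow> g \<in> L2 \<Lambda>"
  using continuous_imp_integrable_real[of 0 \<Lambda> "\<lambda>x. (g x)\<^sup>2"]
    continuous_imp_measurable_on_sets_lebesgue[of "{0..\<Lambda>}" g]
  by (auto simp: L2_def intro!: continuous_intros)

lemma L2_norm_sq: "(L2_norm \<Lambda> g)\<^sup>2 = (LINT x|dom_measure \<Lambda>. (g x)\<^sup>2)"
  unfolding L2_norm_def L2_inner_def by (simp add: power2_eq_square)

lemma L2_norm_nonneg [simp]: "0 \<le> L2_norm \<Lambda> g"
  unfolding L2_norm_def L2_inner_def by simp

lemma L2_norm_const:
  assumes "0 \<le> \<Lambda>" shows "L2_norm \<Lambda> (\<lambda>x. c) = \<bar>c\<bar> * sqrt \<Lambda>"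
proof -
  have "measure (dom_measure \<Lambda>) (space (dom_measure \<Lambda>)) = \<Lambda>"
    using assms by (simp add: measure_restrict_space)
  then show ?thesis
    unfolding L2_norm_def L2_inner_def by (simp add: real_sqrt_mult)
qed

lemma L2_mono:
  assumes "h \<in> L2 \<Lambda>" "g \<in> borel_measurable (dom_measure \<Lambda>)" "AE x in dom_measure \<Lambda>. \<bar>g x\<bar> \<le> \<bar>h x\<bar>"
  shows "g \<in> L2 \<Lambda>" "L2_norm \<Lambda> g \<le> L2_norm \<Lambda> h"
proof -
  note [measurable] = assms(2)
  have ae: "AE x in dom_measure \<Lambda>. (g x)\<^sup>2 \<le> (h x)\<^sup>2"
    using assms(3) by (simp add: abs_le_square_iff)
  have "integrable (dom_measure \<Lambda>) (\<lambda>x. (g x)\<^sup>2)"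
    by (rule Bochner_Integration.integrable_bound[OF L2D(2)[OF assms(1)]]) (use ae in auto)
  then show g: "g \<in> L2 \<Lambda>" by (simp add: L2_def)
  have "(L2_norm \<Lambda> g)\<^sup>2 \<le> (L2_norm \<Lambda> h)\<^sup>2"
    unfolding L2_norm_sq by (intro integral_mono_AE L2D(2) g assms(1) ae)
  then show "L2_norm \<Lambda> g \<le> L2_norm \<Lambda> h"
    by (rule power2_le_imp_le) simp
qed

lemma L2_mult_bounded:
  assumes "h \<in> L2 \<Lambda>" "a \<in> borel_measurable (dom_measure \<Lambda>)" "AE x in dom_measure \<Lambda>. \<bar>a x\<bar> \<le> C" "0 \<le> C"
  shows "(\<lambda>x. a x * h x) \<in> L2 \<Lambda>" "L2_norm \<Lambda> (\<lambda>x. a x * h x) \<le> C * L2_norm \<Lambda> h"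
proof -
  note [measurable] = assms(2) L2D(1)[OF assms(1)]
  have *: "AE x in dom_measure \<Lambda>. \<bar>a x * h x\<bar> \<le> \<bar>C * h x\<bar>"
    using assms(3) by eventually_elim (use assms(4) in \<open>simp add: abs_mult mult_right_mono\<close>)
  show "(\<lambda>x. a x * h x) \<in> L2 \<Lambda>"
    by (rule L2_mono[OF L2.scale_mem[OF assms(1), of C] _ *]) measurable
  show "L2_norm \<Lambda> (\<lambda>x. a x * h x) \<le> C * L2_norm \<Lambda> h"
    using L2_mono(2)[OF L2.scale_mem[OF assms(1), of C] _ *] L2.N_scale[OF assms(1), of C] assms(4)
    by simp
qed

lemma L2_norm_zero_AE:
  assumes "g \<in> L2 \<Lambda>" "L2_norm \<Lambda> g = 0" shows "AE x in dom_measure \<Lambda>. g x = 0"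
proof -
  have "(LINT x|dom_measure \<Lambda>. (g x)\<^sup>2) = 0" using assms(2) L2_norm_sq[of \<Lambda> g] by simp
  then show ?thesis
    using integral_nonneg_eq_0_iff_AE[OF L2D(2)[OF assms(1)]] by simp
qed

lemma L2_cong_AE:
  assumes "AE x in dom_measure \<Lambda>. g x = h x" "g \<in> borel_measurable (dom_measure \<Lambda>)" "h \<in> borel_measurable (dom_measure \<Lambda>)"
  shows "L2_norm \<Lambda> g = L2_norm \<Lambda> h" "w \<in> borel_measurable (dom_measure \<Lambda>) \<Longrightarrow> L2_inner \<Lambda> g w = L2_inner \<Lambda> h w"
  unfolding L2_norm_def L2_inner_def using assms
  by (auto intro!: integral_cong_AE arg_cong[where f=sqrt])

section \<open>Limit theorems and completeness in L2\<close>

lemma L2_dominated: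
  assumes w: "w \<in> L2 \<Lambda>" and g: "\<And>n. g n \<in> borel_measurable (dom_measure \<Lambda>)" and l: "l \<in> borel_measurable (dom_measure \<Lambda>)"
    and lim: "AE x in dom_measure \<Lambda>. (\<lambda>n. g n x) \<longlonglongrightarrow> l x"
    and bd: "\<And>n. AE x in dom_measure \<Lambda>. \<bar>g n x\<bar> \<le> w x"
  shows "\<And>n. g n \<in> L2 \<Lambda>" "l \<in> L2 \<Lambda>" "(\<lambda>n. L2_norm \<Lambda> (\<lambda>x. g n x - l x)) \<longlonglongrightarrow> 0"
proof -
  note [measurable] = g l L2D(1)[OF w]
  have bd': "AE x in dom_measure \<Lambda>. \<forall>n. \<bar>g n x\<bar> \<le> w x"
    using bd by (simp add: AE_all_countable)
  with lim have lw: "AE x in dom_measure \<Lambda>. \<bar>l x\<bar> \<le> w x"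
  proof eventually_elim
    case (elim x)
    then show ?case using LIMSEQ_le_const2[OF tendsto_rabs[OF elim(1)], of "w x"] by blast
  qed
  show "g n \<in> L2 \<Lambda>" for n
    using bd[of n] by (intro L2_mono(1)[OF w g]) (auto elim: eventually_mono)
  show "l \<in> L2 \<Lambda>"
    using lw by (intro L2_mono(1)[OF w l]) (auto elim: eventually_mono)
  have "(\<lambda>n. LINT x|dom_measure \<Lambda>. (g n x - l x)\<^sup>2) \<longlonglongrightarrow> (LINT x|dom_measure \<Lambda>. 0)"
  proof (rule integral_dominated_convergence[where w="\<lambda>x. (2 * w x)\<^sup>2"])
    show "integrable (dom_measure \<Lambda>) (\<lambda>x. (2 * w x)\<^sup>2)"
      using L2D(2)[OF L2.scale_mem[OF w, of 2]] .
    show "AE x in dom_measure \<Lambda>. (\<lambda>n. (g n x - l x)\<^sup>2) \<longlonglongrightarrow> 0"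
      using lim
    proof eventually_elim
      case (elim x)
      have "(\<lambda>n. (g n x - l x)\<^sup>2) \<longlonglongrightarrow> (l x - l x)\<^sup>2" by (intro tendsto_intros elim)
      then show ?case by simp
    qed
    fix n
    show "AE x in dom_measure \<Lambda>. norm ((g n x - l x)\<^sup>2) \<le> (2 * w x)\<^sup>2"
      using bd' lw
    proof eventually_elim
      case (elim x)
      from elim(1) have "\<bar>g n x\<bar> \<le> w x" by blast
      with elim(2) have "\<bar>g n x - l x\<bar> \<le> \<bar>2 * w x\<bar>" by linarith
      then show ?case unfolding abs_le_square_iff by simp
    qed
  qed measurable
  then have "(\<lambda>n. (L2_norm \<Lambda> (\<lambda>x. g n x - l x))\<^sup>2) \<longlonglongrightarrow> 0"
    by (simp add: L2_norm_sq)
  from tendsto_real_sqrt[OF this] show "(\<lambda>n. L2_norm \<Lambda> (\<lambda>x. g n x - l x)) \<longlonglongrightarrow> 0"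
    by simp
qed

text \<open>Nonnegative integrals come first because square integrability of the limit is part of
  the conclusion; Fatou bounds the integral of its square before it is known to be finite.\<close>

lemma L2_fatou:
  assumes g: "\<And>n. g n \<in> borel_measurable (dom_measure \<Lambda>)" and l: "l \<in> borel_measurable (dom_measure \<Lambda>)"
    and lim: "AE x in dom_measure \<Lambda>. (\<lambda>n. g n x) \<longlonglongrightarrow> l x"
    and bd: "\<And>n. g n \<in> L2 \<Lambda> \<and> L2_norm \<Lambda> (g n) \<le> C"
  shows "l \<in> L2 \<Lambda>" "L2_norm \<Lambda> l \<le> C"
proof -
  note [measurable] = g l
  have C: "0 \<le> C" using bd[of 0] L2_norm_nonneg order.trans by blast
  have e: "(\<integral>\<^sup>+x. ennreal ((h x)\<^sup>2) \<partial>dom_measure \<Lambda>) = ennreal ((L2_norm \<Lambda> h)\<^sup>2)" if "h \<in> L2 \<Lambda>" for h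
    unfolding L2_norm_sq by (rule nn_integral_eq_integral[OF L2D(2)[OF that]]) simp
  have "(\<integral>\<^sup>+x. ennreal ((l x)\<^sup>2) \<partial>dom_measure \<Lambda>) = (\<integral>\<^sup>+x. liminf (\<lambda>n. ennreal ((g n x)\<^sup>2)) \<partial>dom_measure \<Lambda>)"
  proof (rule nn_integral_cong_AE)
    show "AE x in dom_measure \<Lambda>. ennreal ((l x)\<^sup>2) = liminf (\<lambda>n. ennreal ((g n x)\<^sup>2))"
      using lim
    proof eventually_elim
      case (elim x)
      have "(\<lambda>n. ennreal ((g n x)\<^sup>2)) \<longlonglongrightarrow> ennreal ((l x)\<^sup>2)"
        by (intro tendsto_ennrealI tendsto_intros elim)
      from lim_imp_Liminf[OF _ this] show ?case by simp
    qed
  qed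
  also have "\<dots> \<le> liminf (\<lambda>n. \<integral>\<^sup>+x. ennreal ((g n x)\<^sup>2) \<partial>dom_measure \<Lambda>)"
    by (rule nn_integral_liminf) measurable
  also have "\<dots> \<le> ennreal (C\<^sup>2)"
  proof -
    have "(\<integral>\<^sup>+x. ennreal ((g n x)\<^sup>2) \<partial>dom_measure \<Lambda>) \<le> ennreal (C\<^sup>2)" for n
      using bd[of n] e[of "g n"] by (simp add: power_mono ennreal_leI)
    then show ?thesis
      by (metis (mono_tags, lifting) Liminf_le_Limsup Limsup_bounded always_eventually order.trans trivial_limit_sequentially)
  qed
  finally have le: "(\<integral>\<^sup>+x. ennreal ((l x)\<^sup>2) \<partial>dom_measure \<Lambda>) \<le> ennreal (C\<^sup>2)" .
  have "integrable (dom_measure \<Lambda>) (\<lambda>x. (l x)\<^sup>2)"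
    by (rule integrableI_bounded) (use le in \<open>auto simp: less_top[symmetric] top_unique\<close>)
  then show l: "l \<in> L2 \<Lambda>" by (simp add: L2_def)
  from le e[OF l] have "(L2_norm \<Lambda> l)\<^sup>2 \<le> C\<^sup>2" by simp
  then show "L2_norm \<Lambda> l \<le> C" using C by (rule power2_le_imp_le)
qed

text \<open>By Cauchy-Schwarz against the constant 1 on a domain of finite measure, the increments
  have summable integrals. Their sum is then finite almost everywhere, and the telescoping series
  converges absolutely there.\<close>

lemma L2_fast_Cauchy_AE:
  assumes g: "\<And>n. g n \<in> L2 \<Lambda>" and bd: "\<And>n. L2_norm \<Lambda> (\<lambda>x. g (Suc n) x - g n x) \<le> (1/2) ^ n"
  shows "AE x in dom_measure \<Lambda>. convergent (\<lambda>n. g n x)"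
proof -
  define h where "h n = (\<lambda>x. \<bar>g (Suc n) x - g n x\<bar>)" for n
  note [measurable] = L2D(1)[OF g]
  have dL: "(\<lambda>x. g (Suc n) x - g n x) \<in> L2 \<Lambda>" for n by (rule L2.diff_mem[OF g g])
  have hL: "h n \<in> L2 \<Lambda>" and hn: "L2_norm \<Lambda> (h n) \<le> (1/2) ^ n" for n
  proof -
    show "h n \<in> L2 \<Lambda>" unfolding h_def by (rule L2_mono(1)[OF dL[of n]]) auto
    have "L2_norm \<Lambda> (h n) \<le> L2_norm \<Lambda> (\<lambda>x. g (Suc n) x - g n x)"
      unfolding h_def by (rule L2_mono(2)[OF dL[of n]]) auto
    also have "\<dots> \<le> (1/2) ^ n" by (rule bd)
    finally show "L2_norm \<Lambda> (h n) \<le> (1/2) ^ n" .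
  qed
  let ?c = "L2_norm \<Lambda> (\<lambda>x. 1)"
  have int: "(\<integral>\<^sup>+x. ennreal (h n x) \<partial>dom_measure \<Lambda>) \<le> ennreal ((1/2) ^ n * ?c)" for n
  proof -
    have "(\<integral>\<^sup>+x. ennreal (h n x) \<partial>dom_measure \<Lambda>) = ennreal (LINT x|dom_measure \<Lambda>. h n x)"
      by (rule nn_integral_eq_integral[OF L2_integrable[OF hL]]) (simp add: h_def)
    also have "(LINT x|dom_measure \<Lambda>. h n x) = L2_inner \<Lambda> (h n) (\<lambda>x. 1)" by (simp add: L2_inner_def)
    also have "\<dots> \<le> L2_norm \<Lambda> (h n) * ?c" using L2.Cauchy_Schwarz[OF hL L2_const] abs_le_D1 by blast
    also have "\<dots> \<le> (1/2) ^ n * ?c" by (intro mult_right_mono hn) simp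
    finally show ?thesis by (simp add: ennreal_leI)
  qed
  have "(\<integral>\<^sup>+x. (\<Sum>n. ennreal (h n x)) \<partial>dom_measure \<Lambda>) = (\<Sum>n. \<integral>\<^sup>+x. ennreal (h n x) \<partial>dom_measure \<Lambda>)"
    by (rule nn_integral_suminf) (simp add: h_def)
  also have "\<dots> \<le> (\<Sum>n. ennreal ((1/2) ^ n * ?c))"
    by (intro suminf_le int) auto
  also have "\<dots> = ennreal (\<Sum>n. (1/2) ^ n * ?c)"
    by (intro suminf_ennreal2 summable_mult2 summable_geometric) auto
  finally have fin: "(\<integral>\<^sup>+x. (\<Sum>n. ennreal (h n x)) \<partial>dom_measure \<Lambda>) \<noteq> \<infinity>"
    by (auto simp: top_unique)
  have "AE x in dom_measure \<Lambda>. (\<Sum>n. ennreal (h n x)) \<noteq> \<infinity>"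
    by (rule nn_integral_PInf_AE[OF _ fin]) (simp add: h_def)
  then show ?thesis
  proof eventually_elim
    case (elim x)
    then have "summable (\<lambda>n. h n x)"
      by (intro summable_suminf_not_top) (auto simp: h_def)
    then have "summable (\<lambda>n. g (Suc n) x - g n x)"
      unfolding h_def by (rule summable_rabs_cancel)
    then have "convergent (\<lambda>n. \<Sum>i<n. g (Suc i) x - g i x)"
      by (simp add: summable_iff_convergent)
    then have "convergent (\<lambda>n. g n x - g 0 x)"
      by (subst (asm) sum_lessThan_telescope)
    then have "convergent (\<lambda>n. (g n x - g 0 x) + g 0 x)"
      by (rule convergent_add[OF _ convergent_const])
    then show ?case by simp
  qed
qed

text \<open>Riesz-Fischer: a subsequence with geometrically decreasing increments converges almost
  everywhere, and Fatou applied in the second index turns the Cauchy estimate into convergence of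
  the whole sequence to that limit.\<close>

lemma L2_complete:
  assumes g: "\<And>n. g n \<in> L2 \<Lambda>"
    and C: "\<And>e. 0 < e \<Longrightarrow> \<exists>M. \<forall>m\<ge>M. \<forall>n\<ge>M. L2_norm \<Lambda> (\<lambda>x. g m x - g n x) < e"
  shows "\<exists>l\<in>L2 \<Lambda>. (\<lambda>n. L2_norm \<Lambda> (\<lambda>x. g n x - l x)) \<longlonglongrightarrow> 0"
proof -
  note [measurable] = L2D(1)[OF g]
  have "\<forall>k. \<exists>M. \<forall>m\<ge>M. \<forall>n\<ge>M. L2_norm \<Lambda> (\<lambda>x. g m x - g n x) < (1/2) ^ k"
    by (intro allI C) simp
  then obtain r where r: "\<And>k m n. m \<ge> r k \<Longrightarrow> n \<ge> r k \<Longrightarrow> L2_norm \<Lambda> (\<lambda>x. g m x - g n x) < (1/2) ^ k"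
    by metis
  \<comment> \<open>Summation makes \<open>R\<close> monotone with \<open>r k\<close> below
    \<open>R k\<close>, as the estimate for consecutive indices requires; the summand
    \<open>k\<close> forces \<open>R\<close> to infinity.\<close>
  define R where "R k = (\<Sum>i\<le>k. r i) + k" for k
  have Rr: "r k \<le> R k" "R k \<le> R (Suc k)" "k \<le> R k" for k
    by (auto simp: R_def intro: trans_le_add1 member_le_sum)
  have conv: "AE x in dom_measure \<Lambda>. convergent (\<lambda>n. g (R n) x)"
  proof (rule L2_fast_Cauchy_AE)
    show "L2_norm \<Lambda> (\<lambda>x. g (R (Suc n)) x - g (R n) x) \<le> (1/2) ^ n" for n
      using r[of n "R (Suc n)" "R n"] Rr[of n] by fastforce
  qed (rule g)
  define l where "l x = lim (\<lambda>n. g (R n) x)" for x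
  have [measurable]: "l \<in> borel_measurable (dom_measure \<Lambda>)" unfolding l_def by measurable
  have lim: "AE x in dom_measure \<Lambda>. (\<lambda>n. g (R n) x) \<longlonglongrightarrow> l x"
    using conv by eventually_elim (simp add: l_def convergent_LIMSEQ_iff)
  have key: "(\<lambda>x. g m x - l x) \<in> L2 \<Lambda> \<and> L2_norm \<Lambda> (\<lambda>x. g m x - l x) \<le> e"
    if M: "\<forall>m\<ge>M. \<forall>n\<ge>M. L2_norm \<Lambda> (\<lambda>x. g m x - g n x) < e" and m: "m \<ge> M" for m M e
  proof -
    have "AE x in dom_measure \<Lambda>. (\<lambda>n. g m x - g (R (n + M)) x) \<longlonglongrightarrow> g m x - l x"
      using lim
    proof eventually_elim
      case (elim x)
      show ?case by (intro tendsto_intros LIMSEQ_ignore_initial_segment[OF elim])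
    qed
    moreover have "(\<lambda>x. g m x - g (R (n + M)) x) \<in> L2 \<Lambda> \<and> L2_norm \<Lambda> (\<lambda>x. g m x - g (R (n + M)) x) \<le> e" for n
    proof -
      have "R (n + M) \<ge> M" using Rr(3)[of "n + M"] by simp
      with M m show ?thesis using L2.diff_mem[OF g g] less_imp_le by blast
    qed
    ultimately show ?thesis
      using L2_fatou[of "\<lambda>n x. g m x - g (R (n + M)) x" \<Lambda> "\<lambda>x. g m x - l x" e] by simp
  qed
  obtain M where "\<forall>m\<ge>M. \<forall>n\<ge>M. L2_norm \<Lambda> (\<lambda>x. g m x - g n x) < 1" using C[of 1] by auto
  \<comment> \<open>Fatou only places g M - l in L2; subtracting this from g M recovers
    \<open>l\<close>.\<close>
  from L2.diff_mem[OF g conjunct1[OF key[OF this, of M]], of M] have l: "l \<in> L2 \<Lambda>" by simp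
  show ?thesis
  proof (intro bexI[OF _ l] LIMSEQ_I)
    fix e :: real assume e: "0 < e"
    then obtain M where M: "\<forall>m\<ge>M. \<forall>n\<ge>M. L2_norm \<Lambda> (\<lambda>x. g m x - g n x) < e / 2"
      using C[of "e/2"] by auto
    have "norm (L2_norm \<Lambda> (\<lambda>x. g n x - l x) - 0) < e" if "n \<ge> M" for n
      using key[OF M that] e by auto
    then show "\<exists>M. \<forall>n\<ge>M. norm (L2_norm \<Lambda> (\<lambda>x. g n x - l x) - 0) < e" by blast
  qed
qed

section \<open>Density of test functions in L2\<close>

definition test_approx :: "real \<Rightarrow> (real \<Rightarrow> real) \<Rightarrow> bool" where
  "test_approx \<Lambda> g \<longleftrightarrow> g \<in> L2 \<Lambda> \<and> (\<forall>e>0. \<exists>\<phi>\<in>Collect (test_function 0 \<Lambda>). L2_norm \<Lambda> (\<lambda>x. g x - \<phi> x) < e)"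

lemma test_zero: "test_function a b (\<lambda>x. 0)"
  using test_lincomb[OF test_bump[OF order_refl order_refl] test_bump[OF order_refl order_refl], of a b 0 0 0 0] by simp

lemma test_smooth: "test_function a b \<phi> \<Longrightarrow> smooth \<phi>"
  by (simp add: test_function_alt)

lemma test_L2: "test_function a b \<phi> \<Longrightarrow> \<phi> \<in> L2 \<Lambda>"
  by (intro L2_continuous smooth_continuous test_smooth)

lemma tests_subset_L2: "Collect (test_function a b) \<subseteq> L2 \<Lambda>"
  using test_L2 by blast

lemma test_approx_limit:
  assumes "g \<in> L2 \<Lambda>" "\<And>n. test_approx \<Lambda> (h n)" "(\<lambda>n. L2_norm \<Lambda> (\<lambda>x. h n x - g x)) \<longlonglongrightarrow> 0"
  shows "test_approx \<Lambda> g"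
  unfolding test_approx_def
proof (intro conjI assms(1) allI impI)
  fix e :: real assume e: "0 < e"
  have "h n \<in> L2 \<Lambda>" for n using assms(2) by (simp add: test_approx_def)
  from L2.closure_limit[OF tests_subset_L2 assms(1) this _ assms(3) e] assms(2)
  show "\<exists>\<phi>\<in>Collect (test_function 0 \<Lambda>). L2_norm \<Lambda> (\<lambda>x. g x - \<phi> x) < e"
    by (simp add: test_approx_def)
qed

lemma test_approx_test: "test_function 0 \<Lambda> \<phi> \<Longrightarrow> test_approx \<Lambda> \<phi>"
  unfolding test_approx_def by (auto simp: test_L2 L2.N_zero intro!: bexI[of _ \<phi>])

lemma test_approx_lincomb:
  assumes "test_approx \<Lambda> g" "test_approx \<Lambda> h"
  shows "test_approx \<Lambda> (\<lambda>x. c * g x + d * h x)"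
  unfolding test_approx_def
proof (intro conjI allI impI)
  show "(\<lambda>x. c * g x + d * h x) \<in> L2 \<Lambda>"
    using assms by (intro L2_lincomb) (auto simp: test_approx_def)
  fix e :: real assume "0 < e"
  with assms show "\<exists>\<phi>\<in>Collect (test_function 0 \<Lambda>). L2_norm \<Lambda> (\<lambda>x. (c * g x + d * h x) - \<phi> x) < e"
    by (intro L2.closure_lincomb[OF _ tests_subset_L2]) (auto simp: test_approx_def intro: test_lincomb)
qed

lemma test_approx_sum:
  assumes "\<And>i. i \<in> I \<Longrightarrow> test_approx \<Lambda> (g i)"
  shows "test_approx \<Lambda> (\<lambda>x. \<Sum>i\<in>I. c i * g i x)"
  using assms
proof (induction I rule: infinite_finite_induct)
  case (insert i I)
  then have "test_approx \<Lambda> (\<lambda>x. c i * g i x + 1 * (\<Sum>i\<in>I. c i * g i x))"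
    by (intro test_approx_lincomb) auto
  then show ?case using insert by simp
qed (simp_all add: test_approx_test test_zero)

lemma test_approx_dominated:
  assumes "\<And>n. test_approx \<Lambda> (g n)" "l \<in> borel_measurable (dom_measure \<Lambda>)" "w \<in> L2 \<Lambda>"
    "AE x in dom_measure \<Lambda>. (\<lambda>n. g n x) \<longlonglongrightarrow> l x" "\<And>n. AE x in dom_measure \<Lambda>. \<bar>g n x\<bar> \<le> w x"
  shows "test_approx \<Lambda> l"
proof -
  have m: "g n \<in> borel_measurable (dom_measure \<Lambda>)" for n using assms(1)[of n] L2D by (simp add: test_approx_def)
  note d = L2_dominated[OF assms(3) m assms(2,4,5)]
  show ?thesis by (rule test_approx_limit[OF d(2) assms(1) d(3)])
qed

lemma borel_dom_measure: "g \<in> borel_measurable borel \<Longrightarrow> g \<in> borel_measurable (dom_measure \<Lambda>)"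
  by (simp add: measurable_completion measurable_restrict_space1)

lemma AE_dom_measure_endpoints: "AE x in dom_measure \<Lambda>. 0 < x \<and> x < \<Lambda>"
proof (rule AE_I')
  show "{0, \<Lambda>} \<inter> {0..\<Lambda>} \<in> null_sets (dom_measure \<Lambda>)"
    by (subst null_sets_restrict_space) (auto intro!: null_sets_completionI finite_imp_null_set_lborel)
qed auto

text \<open>Dynkin argument: the open intervals are stable under intersection and generate the Borel
  sets, their indicators are limits of bumps, and the sets with approximable indicator are closed
  under complements and countable disjoint unions.\<close>

lemma test_approx_indicator:
  assumes "A \<in> sets borel" shows "test_approx \<Lambda> (indicator A)"
proof -
  have borel: "sets borel = sigma_sets UNIV (range (\<lambda>(a, b). {a <..< b :: real}))"
    unfolding borel_eq_box by (simp add: split_def)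
  then have A: "A \<in> sigma_sets UNIV (range (\<lambda>(a, b). {a <..< b :: real}))"
    using assms by simp
  have 1: "(\<lambda>x. 1) \<in> L2 \<Lambda>" by (rule L2_const)
  have stable: "Int_stable (range (\<lambda>(a, b). {a <..< b :: real}))"
    by (auto simp: Int_stable_def)
  have sub: "range (\<lambda>(a, b). {a <..< b :: real}) \<subseteq> Pow UNIV" by simp
  have ioo: "test_approx \<Lambda> (indicator {a<..<b})" for a b
  proof (rule test_approx_dominated[OF _ _ 1])
    \<comment> \<open>The interval is clipped to the domain because test functions must vanish near
      0 and \<Lambda>; the two end points are a null set.\<close>
    show "test_approx \<Lambda> (bump (max a 0) (min b \<Lambda>) n)" for n
      by (intro test_approx_test test_bump) auto
    show "AE x in dom_measure \<Lambda>. (\<lambda>n. bump (max a 0) (min b \<Lambda>) n x) \<longlonglongrightarrow> indicator {a<..<b} x"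
      using AE_dom_measure_endpoints[of \<Lambda>]
    proof eventually_elim
      case (elim x)
      then show ?case
        using bump_tendsto[of "max a 0" "min b \<Lambda>" x] by (simp add: indicator_def)
    qed
    show "AE x in dom_measure \<Lambda>. \<bar>bump (max a 0) (min b \<Lambda>) n x\<bar> \<le> 1" for n
      using bump_bounds by simp
  qed (auto intro: borel_dom_measure)
  have one: "test_approx \<Lambda> (indicator UNIV)"
  proof (rule test_approx_dominated[OF _ _ 1])
    show "test_approx \<Lambda> (indicator {0<..<\<Lambda>})" for n :: nat by (rule ioo)
    show "AE x in dom_measure \<Lambda>. (\<lambda>n. indicator {0<..<\<Lambda>} x) \<longlonglongrightarrow> indicator UNIV x"
      using AE_dom_measure_endpoints[of \<Lambda>] by eventually_elim auto
  qed auto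
  show ?thesis
    using stable sub A
  proof (induction rule: sigma_sets_induct_disjoint)
    case (basic A) then show ?case using ioo by auto
  next
    case empty
    show ?case using test_approx_test[OF test_zero] by (simp add: indicator_def)
  next
    case (compl A)
    have "test_approx \<Lambda> (\<lambda>x. 1 * indicator UNIV x + (-1) * indicator A x)"
      by (rule test_approx_lincomb[OF one compl(2)])
    also have "(\<lambda>x. 1 * indicator UNIV x + (-1) * indicator A x) = (indicator (UNIV - A) :: real \<Rightarrow> real)"
      by (auto simp: indicator_def)
    finally show ?case .
  next
    case (union A)
    have sets: "A i \<in> sets borel" for i
      using union(2) by (auto simp: borel)
    have e: "indicator (\<Union>i<n. A i) = (\<lambda>x. \<Sum>i<n. 1 * (indicator (A i) x :: real))" for n
    proof (induction n)
      case (Suc n)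
      have "A n \<inter> A i = {}" if "i < n" for i
        using union(1) that unfolding disjoint_family_on_def by (metis UNIV_I less_irrefl)
      then have "A n \<inter> (\<Union>i<n. A i) = {}" by blast
      then have "indicator (A n \<union> (\<Union>i<n. A i)) x = indicator (A n) x + (indicator (\<Union>i<n. A i) x :: real)" for x
        by (auto simp: indicator_def)
      then have "indicator (\<Union>i<Suc n. A i) x = indicator (A n) x + (indicator (\<Union>i<n. A i) x :: real)" for x
        by (simp add: lessThan_Suc)
      with Suc show ?case by (simp add: fun_eq_iff add.commute)
    qed auto
    show ?case
    proof (rule test_approx_dominated[OF _ _ 1])
      show "test_approx \<Lambda> (indicator (\<Union>i<n. A i))" for n
        unfolding e by (intro test_approx_sum union)
      show "AE x in dom_measure \<Lambda>. (\<lambda>n. indicator (\<Union>i<n. A i) x) \<longlonglongrightarrow> indicator (\<Union> (range A)) x"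
        by (intro AE_I2 LIMSEQ_indicator_UN)
      show "indicat_real (\<Union> (range A)) \<in> borel_measurable (dom_measure \<Lambda>)"
        by (rule borel_dom_measure) (use sets in auto)
    qed (auto simp: indicator_def)
  qed
qed

text \<open>A Borel representative is taken first, as the indicator lemma covers Borel sets. Simple
  functions with modulus at most twice that of the representative then give dominated
  convergence.\<close>

lemma test_dense:
  assumes "g \<in> L2 \<Lambda>" shows "test_approx \<Lambda> g"
proof -
  have "(\<lambda>x. indicator {0..\<Lambda>} x *\<^sub>R g x) \<in> borel_measurable lebesgue"
    using L2D(1)[OF assms] by (subst (asm) borel_measurable_restrict_space_iff) auto
  then obtain g' where g': "g' \<in> borel_measurable lborel" "AE x in lborel. indicator {0..\<Lambda>} x *\<^sub>R g x = g' x"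
    using completion_ex_borel_measurable_real by blast
  have ae: "AE x in dom_measure \<Lambda>. g x = g' x"
  proof -
    have "AE x in lebesgue. indicator {0..\<Lambda>} x *\<^sub>R g x = g' x"
      using g'(2) by (rule AE_completion)
    then show ?thesis
      by (subst AE_restrict_space_iff) (auto elim!: eventually_mono)
  qed
  obtain s where s: "\<And>i. simple_function borel (s i)" "\<And>x. (\<lambda>i. s i x) \<longlonglongrightarrow> g' x"
     "\<And>i x. dist (s i x) 0 \<le> 2 * dist (g' x) 0"
    using borel_measurable_implies_sequence_metric[of g' borel 0] g'(1) by auto
  have "test_approx \<Lambda> (s i)" for i
  proof -
    have "test_approx \<Lambda> (\<lambda>x. \<Sum>y\<in>range (s i). y * indicator (s i -` {y}) x)"
    proof (intro test_approx_sum test_approx_indicator)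
      fix y show "s i -` {y} \<in> sets borel"
        using simple_functionD(2)[OF s(1), of i "{y}"] by simp
    qed
    also have "(\<lambda>x. \<Sum>y\<in>range (s i). y * indicator (s i -` {y}) x) = s i"
    proof
      fix x
      have "s i x = (\<Sum>y\<in>s i ` space borel. indicator (s i -` {y} \<inter> space borel) x *\<^sub>R y)"
        by (rule simple_function_indicator_representation_banach[OF s(1)]) simp
      then show "(\<Sum>y\<in>range (s i). y * indicator (s i -` {y}) x) = s i x"
        by (simp only: space_borel Int_UNIV_right real_scaleR_def mult.commute)
    qed
    finally show ?thesis .
  qed
  then show ?thesis
  proof (rule test_approx_dominated)
    show "g \<in> borel_measurable (dom_measure \<Lambda>)" by (rule L2D(1)[OF assms])
    show "(\<lambda>x. \<bar>2 * g x\<bar>) \<in> L2 \<Lambda>"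
      by (rule L2_mono(1)[OF L2.scale_mem[OF assms, of 2]]) (use L2D(1)[OF assms] in auto)
    show "AE x in dom_measure \<Lambda>. (\<lambda>n. s n x) \<longlonglongrightarrow> g x"
      using ae by eventually_elim (use s(2) in auto)
    show "AE x in dom_measure \<Lambda>. \<bar>s n x\<bar> \<le> \<bar>2 * g x\<bar>" for n
      using ae by eventually_elim (use s(3) in \<open>auto simp: dist_real_def abs_mult\<close>)
  qed
qed

lemma test_dense_sequence:
  assumes "g \<in> L2 \<Lambda>"
  obtains \<phi> where "\<And>n. test_function 0 \<Lambda> (\<phi> n)" "(\<lambda>n. L2_norm \<Lambda> (\<lambda>x. \<phi> n x - g x)) \<longlonglongrightarrow> 0"
proof (rule L2.closure_sequence[OF tests_subset_L2 assms])
  show "\<exists>\<phi>\<in>Collect (test_function 0 \<Lambda>). L2_norm \<Lambda> (\<lambda>x. g x - \<phi> x) < e" if "0 < e" for e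
    using test_dense[OF assms] that by (simp add: test_approx_def)
qed (use that in auto)

section \<open>Weak derivatives and \<open>H\<^sup>1\<^sub>0\<close>\<close>

text \<open>The integral of \<open>g\<close> from 0 to \<open>x\<close>, for \<open>x\<close> in the
  domain. Written as an inner product with an indicator, it inherits linearity and the
  Cauchy-Schwarz bound from \<open>semi_inner\<close>.\<close>

definition prim :: "real \<Rightarrow> (real \<Rightarrow> real) \<Rightarrow> real \<Rightarrow> real" where
  "prim \<Lambda> g x = L2_inner \<Lambda> g (indicator {..x})"

lemma indicator_L2: "A \<in> sets borel \<Longrightarrow> indicator A \<in> L2 \<Lambda>"
  by (rule L2_bounded[OF borel_dom_measure, where C=1]) (auto simp: indicator_def)

lemma prim_diff: "a \<in> L2 \<Lambda> \<Longrightarrow> b \<in> L2 \<Lambda> \<Longrightarrow> prim \<Lambda> (\<lambda>x. a x - b x) t = prim \<Lambda> a t - prim \<Lambda> b t"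
  unfolding prim_def by (rule L2.ip_diff) (auto intro: indicator_L2)

lemma prim_lincomb: "a \<in> L2 \<Lambda> \<Longrightarrow> b \<in> L2 \<Lambda> \<Longrightarrow>
    prim \<Lambda> (\<lambda>x. c * a x + d * b x) t = c * prim \<Lambda> a t + d * prim \<Lambda> b t"
  unfolding prim_def by (rule L2.ip_lincomb) (auto intro: indicator_L2)

lemma prim_bound:
  assumes "0 \<le> \<Lambda>" "g \<in> L2 \<Lambda>" shows "\<bar>prim \<Lambda> g x\<bar> \<le> sqrt \<Lambda> * L2_norm \<Lambda> g"
proof -
  have "L2_norm \<Lambda> (indicator {..x}) \<le> L2_norm \<Lambda> (\<lambda>x. 1)"
    by (rule L2_mono(2)[OF L2_const L2D(1)[OF indicator_L2]]) (auto simp: indicator_def)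
  then have "L2_norm \<Lambda> g * L2_norm \<Lambda> (indicator {..x}) \<le> L2_norm \<Lambda> g * sqrt \<Lambda>"
    using L2_norm_const[OF assms(1), of 1] by (intro mult_left_mono) auto
  then show ?thesis
    using L2.Cauchy_Schwarz[OF assms(2) indicator_L2[of "{..x}"]] by (simp add: prim_def mult.commute)
qed

text \<open>Cauchy-Schwarz against the indicator of (x, y]. Primitives are thus Hoelder continuous
  with exponent 1/2, which later also yields continuity in time.\<close>

lemma prim_diff_bound:
  assumes g: "g \<in> L2 \<Lambda>" and xy: "x \<le> y"
  shows "\<bar>prim \<Lambda> g y - prim \<Lambda> g x\<bar> \<le> sqrt (y - x) * L2_norm \<Lambda> g"
proof -
  have i: "indicator {..y} \<in> L2 \<Lambda>" "indicator {..x} \<in> L2 \<Lambda>" "indicator {x<..y} \<in> L2 \<Lambda>"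
    by (auto intro: indicator_L2)
  have e: "(\<lambda>t. indicator {..y} t - indicator {..x} t) = (indicator {x<..y} :: real \<Rightarrow> real)"
    using xy by (auto simp: indicator_def)
  have e': "prim \<Lambda> g y - prim \<Lambda> g x = L2_inner \<Lambda> g (indicator {x<..y})"
    using L2.ip_diff_right[OF i(1,2) g] by (simp add: prim_def e)
  have "L2_norm \<Lambda> (indicator {x<..y}) \<le> sqrt (y - x)"
  proof -
    have "(L2_norm \<Lambda> (indicator {x<..y}))\<^sup>2 = (LINT t|dom_measure \<Lambda>. indicator ({x<..y} \<inter> {0..\<Lambda>}) t)"
      unfolding L2_norm_sq by (intro Bochner_Integration.integral_cong) (auto simp: indicator_def)
    also have "\<dots> = measure (dom_measure \<Lambda>) ({x<..y} \<inter> {0..\<Lambda>})"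
      by (simp add: Int_assoc)
    also have "\<dots> = measure lebesgue ({x<..y} \<inter> {0..\<Lambda>})"
      by (rule measure_restrict_space) auto
    also have "\<dots> \<le> measure lebesgue {x<..y}"
      using xy by (intro measure_mono_fmeasurable) (auto simp: fmeasurable_def)
    also have "\<dots> = y - x" using xy by simp
    finally show ?thesis by (simp add: real_le_rsqrt)
  qed
  from order_trans[OF L2.Cauchy_Schwarz[OF g i(3)] mult_left_mono[OF this L2_norm_nonneg]]
  show ?thesis unfolding e' by (simp add: mult.commute)
qed

lemma prim_continuous:
  assumes "g \<in> L2 \<Lambda>" shows "continuous_on S (prim \<Lambda> g)"
proof -
  have "isCont (prim \<Lambda> g) x" for x
    unfolding isCont_def
  proof (rule LIM_zero_cancel, rule Lim_null_comparison)
    have "norm (prim \<Lambda> g y - prim \<Lambda> g x) \<le> sqrt \<bar>y - x\<bar> * L2_norm \<Lambda> g" for y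
      using prim_diff_bound[OF assms, of x y] prim_diff_bound[OF assms, of y x]
      by (cases "x \<le> y") (auto simp: abs_minus_commute)
    then show "\<forall>\<^sub>F y in at x. norm (prim \<Lambda> g y - prim \<Lambda> g x) \<le> sqrt \<bar>y - x\<bar> * L2_norm \<Lambda> g" by simp
    have "((\<lambda>y. sqrt \<bar>y - x\<bar> * L2_norm \<Lambda> g) \<longlongrightarrow> sqrt \<bar>x - x\<bar> * L2_norm \<Lambda> g) (at x)"
      by (intro tendsto_intros)
    then show "((\<lambda>y. sqrt \<bar>y - x\<bar> * L2_norm \<Lambda> g) \<longlongrightarrow> 0) (at x)" by simp
  qed
  then show ?thesis by (rule continuous_at_imp_continuous_on[OF ballI])
qed

lemma prim_L2: "g \<in> L2 \<Lambda> \<Longrightarrow> prim \<Lambda> g \<in> L2 \<Lambda>"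
  by (rule L2_continuous, rule prim_continuous)

lemma prim_norm:
  assumes "0 \<le> \<Lambda>" "g \<in> L2 \<Lambda>" shows "L2_norm \<Lambda> (prim \<Lambda> g) \<le> \<Lambda> * L2_norm \<Lambda> g"
proof -
  have "L2_norm \<Lambda> (prim \<Lambda> g) \<le> L2_norm \<Lambda> (\<lambda>x. sqrt \<Lambda> * L2_norm \<Lambda> g)"
    by (rule L2_mono(2)[OF L2_const L2D(1)[OF prim_L2]]) (use prim_bound[OF assms] assms in auto)
  then show ?thesis using assms by (simp add: L2_norm_const mult.commute mult.assoc[symmetric])
qed

lemma prim_end: "prim \<Lambda> g \<Lambda> = L2_inner \<Lambda> g (\<lambda>x. 1)"
  unfolding prim_def L2_inner_def by (intro Bochner_Integration.integral_cong) auto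

lemma prim_FTC:
  assumes F: "\<And>x. (F has_real_derivative g x) (at x)" and g: "continuous_on UNIV g" and x: "0 \<le> x" "x \<le> \<Lambda>"
  shows "prim \<Lambda> g x = F x - F 0"
proof -
  have "prim \<Lambda> g x = (LINT y|lebesgue. indicator {0..\<Lambda>} y *\<^sub>R (g y * indicator {..x} y))"
    unfolding prim_def L2_inner_def by (rule integral_restrict_space) auto
  also have "\<dots> = (LINT y|lebesgue. indicator {0..x} y *\<^sub>R g y)"
    using x by (intro Bochner_Integration.integral_cong) (auto simp: indicator_def)
  also have "\<dots> = (LINT y|lebesgue_on {0..x}. g y)"
    by (rule integral_restrict_space[symmetric]) auto
  also have "\<dots> = integral {0..x} g"
    using g by (intro lebesgue_integral_eq_integral continuous_imp_integrable_real) (auto intro: continuous_on_subset)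
  also have "\<dots> = F x - F 0"
    by (intro integral_unique fundamental_theorem_of_calculus x)
       (use F in \<open>auto simp: has_real_derivative_iff_has_vector_derivative[symmetric] intro: DERIV_subset\<close>)
  finally show ?thesis .
qed

lemma smooth_antideriv_ex:
  assumes "smooth \<psi>" obtains F where "smooth F" "F 0 = 0" "\<And>x. (F has_real_derivative \<psi> x) (at x)"
proof -
  have "\<exists>F. \<forall>x::real. (-\<infinity>::ereal) < x \<longrightarrow> x < \<infinity> \<longrightarrow> (F has_vector_derivative \<psi> x) (at x)"
    by (rule einterval_antiderivative) (use DERIV_isCont[OF smooth_has_deriv[OF assms]] in auto)
  then obtain F where F: "\<And>x. (F has_real_derivative \<psi> x) (at x)"
    by (auto simp: has_real_derivative_iff_has_vector_derivative)
  have "((\<lambda>x. F x - F 0) has_real_derivative \<psi> x) (at x)" for x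
    using DERIV_diff[OF F[of x] DERIV_const[of "F 0"]] by simp
  with that[of "\<lambda>x. F x - F 0"] smooth_antideriv[OF assms] show ?thesis by simp
qed

lemma integration_by_parts:
  assumes "smooth c" "test_function 0 \<Lambda> \<phi>" "0 < \<Lambda>"
  shows "L2_inner \<Lambda> c (deriv \<phi>) = - L2_inner \<Lambda> (deriv c) \<phi>"
proof -
  have s: "smooth \<phi>" using assms test_smooth by blast
  have z: "\<phi> 0 = 0" "\<phi> \<Lambda> = 0" using assms(2) unfolding test_function_alt by force+
  let ?g = "\<lambda>x. c x * deriv \<phi> x + deriv c x * \<phi> x"
  have "((\<lambda>x. c x * \<phi> x) has_real_derivative ?g x) (at x)" for x
    by (intro DERIV_mult' smooth_has_deriv s assms)
  moreover have "continuous_on UNIV ?g"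
    by (intro continuous_intros smooth_continuous smooth_deriv s assms)
  ultimately have "prim \<Lambda> ?g \<Lambda> = 0" using prim_FTC[of "\<lambda>x. c x * \<phi> x" ?g \<Lambda> \<Lambda>] z assms(3) by simp
  then have "(LINT x|dom_measure \<Lambda>. c x * deriv \<phi> x + deriv c x * \<phi> x) = 0"
    by (simp add: prim_end L2_inner_def)
  moreover have "integrable (dom_measure \<Lambda>) (\<lambda>x. c x * deriv \<phi> x)" "integrable (dom_measure \<Lambda>) (\<lambda>x. deriv c x * \<phi> x)"
    by (intro L2_mult_integrable L2_continuous smooth_continuous smooth_deriv s assms)+
  ultimately show ?thesis by (simp add: L2_inner_def)
qed

lemma weak_deriv_smooth: "smooth c \<Longrightarrow> 0 < \<Lambda> \<Longrightarrow> weak_deriv \<Lambda> c (deriv c)"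
  using integration_by_parts by (simp add: weak_deriv_def)

lemma weak_deriv_limit:
  assumes "\<And>n. a n \<in> L2 \<Lambda>" "\<And>n. b n \<in> L2 \<Lambda>" "v \<in> L2 \<Lambda>" "g \<in> L2 \<Lambda>" "\<And>n. weak_deriv \<Lambda> (a n) (b n)"
    "(\<lambda>n. L2_norm \<Lambda> (\<lambda>x. a n x - v x)) \<longlonglongrightarrow> 0" "(\<lambda>n. L2_norm \<Lambda> (\<lambda>x. b n x - g x)) \<longlonglongrightarrow> 0"
  shows "weak_deriv \<Lambda> v g"
  unfolding weak_deriv_def
proof (intro allI impI)
  fix \<phi> assume \<phi>: "test_function 0 \<Lambda> \<phi>"
  have "(\<lambda>n. L2_inner \<Lambda> (a n) (deriv \<phi>)) \<longlonglongrightarrow> L2_inner \<Lambda> v (deriv \<phi>)"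
    by (rule L2.tendsto_ip[OF assms(1,3) test_L2[OF test_deriv[OF \<phi>]] assms(6)])
  moreover have "(\<lambda>n. - L2_inner \<Lambda> (b n) \<phi>) \<longlonglongrightarrow> - L2_inner \<Lambda> g \<phi>"
    by (intro tendsto_minus L2.tendsto_ip[OF assms(2,4) test_L2[OF \<phi>] assms(7)])
  ultimately show "L2_inner \<Lambda> v (deriv \<phi>) = - L2_inner \<Lambda> g \<phi>"
    using assms(5) \<phi> unfolding weak_deriv_def by (simp add: LIMSEQ_unique)
qed

lemma weak_deriv_lincomb:
  assumes "v \<in> L2 \<Lambda>" "w \<in> L2 \<Lambda>" "v' \<in> L2 \<Lambda>" "w' \<in> L2 \<Lambda>" "weak_deriv \<Lambda> v v'" "weak_deriv \<Lambda> w w'"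
  shows "weak_deriv \<Lambda> (\<lambda>x. c * v x + d * w x) (\<lambda>x. c * v' x + d * w' x)"
  unfolding weak_deriv_def
proof (intro allI impI)
  fix \<phi> assume \<phi>: "test_function 0 \<Lambda> \<phi>"
  show "L2_inner \<Lambda> (\<lambda>x. c * v x + d * w x) (deriv \<phi>) = - L2_inner \<Lambda> (\<lambda>x. c * v' x + d * w' x) \<phi>"
    using L2.ip_lincomb[OF assms(1,2) test_L2[OF test_deriv[OF \<phi>]], of c d]
      L2.ip_lincomb[OF assms(3,4) test_L2[OF \<phi>], of c d] assms(5,6) \<phi>
    by (simp add: weak_deriv_def)
qed

lemma L2_inner_const_eq: "L2_inner \<Lambda> (\<lambda>x. c) g = c * L2_inner \<Lambda> g (\<lambda>x. 1)"
  unfolding L2_inner_def by simp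

lemma test_deriv_mean: "test_function 0 \<Lambda> \<phi> \<Longrightarrow> 0 < \<Lambda> \<Longrightarrow> L2_inner \<Lambda> (deriv \<phi>) (\<lambda>x. 1) = 0"
  using integration_by_parts[of "\<lambda>x. 1" \<Lambda> \<phi>] smooth_coinduct[of "\<lambda>x. 1" "{\<lambda>x. 1, \<lambda>x. 0}"]
  by (fastforce simp: L2_inner_def)

text \<open>For a test function this is integration by parts. The general case follows by density,
  because \<open>prim\<close> is bounded on L2 and the weak derivative is a closed relation.\<close>

lemma weak_deriv_prim:
  assumes "0 < \<Lambda>" "g \<in> L2 \<Lambda>"
  shows "weak_deriv \<Lambda> (prim \<Lambda> g) g"
proof -
  obtain \<psi> where \<psi>: "\<And>n. test_function 0 \<Lambda> (\<psi> n)" "(\<lambda>n. L2_norm \<Lambda> (\<lambda>x. \<psi> n x - g x)) \<longlonglongrightarrow> 0"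
    using test_dense_sequence[OF assms(2)] by blast
  have "\<forall>n. \<exists>F. smooth F \<and> F 0 = 0 \<and> (\<forall>x. (F has_real_derivative \<psi> n x) (at x))"
    using smooth_antideriv_ex[OF test_smooth[OF \<psi>(1)]] by metis
  then obtain F where F: "\<And>n. smooth (F n)" "\<And>n. F n 0 = 0" "\<And>n x. (F n has_real_derivative \<psi> n x) (at x)"
    by metis
  have dF: "deriv (F n) = \<psi> n" for n using F(3) by (auto intro: DERIV_imp_deriv)
  have FL: "F n \<in> L2 \<Lambda>" for n by (intro L2_continuous smooth_continuous F)
  have dL: "(\<lambda>x. \<psi> n x - g x) \<in> L2 \<Lambda>" for n by (intro L2.diff_mem test_L2[OF \<psi>(1)] assms)
  have le: "L2_norm \<Lambda> (\<lambda>x. F n x - prim \<Lambda> g x) \<le> \<Lambda> * L2_norm \<Lambda> (\<lambda>x. \<psi> n x - g x)" for n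
  proof -
    have "F n x = prim \<Lambda> (\<psi> n) x" if "x \<in> {0..\<Lambda>}" for x
      using prim_FTC[OF F(3) smooth_continuous[OF test_smooth[OF \<psi>(1)]], of x \<Lambda> n] F(2) that by simp
    then have "L2_norm \<Lambda> (\<lambda>x. F n x - prim \<Lambda> g x) = L2_norm \<Lambda> (prim \<Lambda> (\<lambda>x. \<psi> n x - g x))"
      using prim_diff[OF test_L2[OF \<psi>(1)] assms(2)]
      by (intro L2_cong_AE(1) L2D(1) L2.diff_mem FL prim_L2 assms dL AE_I2) auto
    then show ?thesis using prim_norm[OF _ dL, of n] assms(1) by simp
  qed
  show ?thesis
  proof (rule weak_deriv_limit[OF FL test_L2[OF \<psi>(1)] prim_L2[OF assms(2)] assms(2) _ _ \<psi>(2)])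
    show "weak_deriv \<Lambda> (F n) (\<psi> n)" for n
      using weak_deriv_smooth[OF F(1) assms(1), of n] dF by simp
    show "(\<lambda>n. L2_norm \<Lambda> (\<lambda>x. F n x - prim \<Lambda> g x)) \<longlonglongrightarrow> 0"
      by (rule Lim_null_comparison[OF _ tendsto_mult_right_zero[OF \<psi>(2), of \<Lambda>]]) (use le in simp)
  qed
qed

lemma constant_if_deriv_0:
  fixes F :: "real \<Rightarrow> real"
  assumes "x \<le> y" "\<And>z. x \<le> z \<Longrightarrow> z \<le> y \<Longrightarrow> (F has_real_derivative 0) (at z)"
  shows "F x = F y"
  using MVT2[of x y F "\<lambda>_. 0"] assms by (cases "x = y") auto

text \<open>Off the support of \<psi> the antiderivative \<open>F\<close> is constant on either
  side. Its value is 0 on the left by normalization and 0 on the right because \<psi> has mean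
  zero.\<close>

lemma test_antideriv:
  assumes "test_function 0 \<Lambda> \<psi>" "L2_inner \<Lambda> \<psi> (\<lambda>x. 1) = 0" "0 < \<Lambda>"
  obtains \<phi> where "test_function 0 \<Lambda> \<phi>" "deriv \<phi> = \<psi>"
proof -
  obtain F where F: "smooth F" "F 0 = 0" "\<And>x. (F has_real_derivative \<psi> x) (at x)"
    using smooth_antideriv_ex[OF test_smooth[OF assms(1)]] by blast
  have "F \<Lambda> = 0"
    using prim_FTC[OF F(3) smooth_continuous[OF test_smooth[OF assms(1)]], of \<Lambda> \<Lambda>] F(2) assms(2,3) by (simp add: prim_end)
  obtain c d where cd: "0 < c" "d < \<Lambda>" "\<And>x. \<psi> x \<noteq> 0 \<Longrightarrow> c \<le> x \<and> x \<le> d"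
    using assms(1) unfolding test_function_alt by blast
  have z: "(F has_real_derivative 0) (at x)" if "x < c \<or> d < x" for x
    using F(3)[of x] cd(3)[of x] that by (cases "\<psi> x = 0") auto
  have "F x = 0" if "x < c" for x
  proof (cases "x \<le> 0")
    case True
    then show ?thesis using constant_if_deriv_0[of x 0 F] z cd F(2) by force
  next
    case False
    then show ?thesis using constant_if_deriv_0[of 0 x F] z cd F(2) that by force
  qed
  moreover have "F x = 0" if "d < x" for x
  proof (cases "x \<le> \<Lambda>")
    case True
    then show ?thesis using constant_if_deriv_0[of x \<Lambda> F] z cd \<open>F \<Lambda> = 0\<close> that by force
  next
    case False
    then show ?thesis using constant_if_deriv_0[of \<Lambda> x F] z cd \<open>F \<Lambda> = 0\<close> by force
  qed
  ultimately have "test_function 0 \<Lambda> F"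
    using F(1) cd by (intro test_functionI[of _ _ c d]) (auto simp: not_less[symmetric])
  moreover have "deriv F = \<psi>" using F(3) by (auto intro: DERIV_imp_deriv)
  ultimately show ?thesis by (rule that)
qed

text \<open>Derivatives of test functions have mean zero, so approximants of \<open>g\<close> are
  corrected by multiples of one fixed test function of nonzero mean before
  \<open>test_antideriv\<close> is applied.\<close>

lemma mean_zero_dense:
  assumes g: "g \<in> L2 \<Lambda>" "L2_inner \<Lambda> g (\<lambda>x. 1) = 0" and \<Lambda>: "0 < \<Lambda>"
  obtains \<phi> where "\<And>n::nat. test_function 0 \<Lambda> (\<phi> n)" "(\<lambda>n. L2_norm \<Lambda> (\<lambda>x. deriv (\<phi> n) x - g x)) \<longlonglongrightarrow> 0"
proof -
  have one: "(\<lambda>x. 1) \<in> L2 \<Lambda>" by (rule L2_const)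
  obtain \<psi> where \<psi>: "\<And>n. test_function 0 \<Lambda> (\<psi> n)" "(\<lambda>n. L2_norm \<Lambda> (\<lambda>x. \<psi> n x - g x)) \<longlonglongrightarrow> 0"
    using test_dense_sequence[OF g(1)] by blast
  \<comment> \<open>Test functions that approximate the constant 1 have means tending to \<Lambda>,
    which is positive.\<close>
  obtain \<theta> where \<theta>: "test_function 0 \<Lambda> \<theta>" "L2_inner \<Lambda> \<theta> (\<lambda>x. 1) \<noteq> 0"
  proof -
    obtain \<eta> where \<eta>: "\<And>n. test_function 0 \<Lambda> (\<eta> n)" "(\<lambda>n. L2_norm \<Lambda> (\<lambda>x. \<eta> n x - 1)) \<longlonglongrightarrow> 0"
      using test_dense_sequence[OF one] by blast
    have "(\<lambda>n. L2_inner \<Lambda> (\<eta> n) (\<lambda>x. 1)) \<longlonglongrightarrow> L2_inner \<Lambda> (\<lambda>x. 1) (\<lambda>x. 1)"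
      by (rule L2.tendsto_ip[OF test_L2[OF \<eta>(1)] one one \<eta>(2)])
    moreover have "L2_inner \<Lambda> (\<lambda>x. 1) (\<lambda>x. 1) = \<Lambda>"
      using L2.N_sq[OF one] L2_norm_const[of \<Lambda> 1] \<Lambda> by simp
    ultimately have "\<forall>\<^sub>F n in sequentially. 0 < L2_inner \<Lambda> (\<eta> n) (\<lambda>x. 1)"
      using order_tendstoD(1) \<Lambda> by metis
    then obtain n where "0 < L2_inner \<Lambda> (\<eta> n) (\<lambda>x. 1)"
      by (auto simp: eventually_sequentially)
    with that[OF \<eta>(1)[of n]] show ?thesis by simp
  qed
  \<comment> \<open>The multiple of \<theta> that removes the mean of \<open>\<psi> n\<close>. It
    tends to 0 because these means tend to the mean of \<open>g\<close>.\<close>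
  define m where "m n = L2_inner \<Lambda> (\<psi> n) (\<lambda>x. 1) / L2_inner \<Lambda> \<theta> (\<lambda>x. 1)" for n
  have \<theta>L: "\<theta> \<in> L2 \<Lambda>" by (rule test_L2[OF \<theta>(1)])
  have \<psi>L: "\<psi> n \<in> L2 \<Lambda>" for n by (rule test_L2[OF \<psi>(1)])
  have "(\<lambda>n. L2_inner \<Lambda> (\<psi> n) (\<lambda>x. 1)) \<longlonglongrightarrow> L2_inner \<Lambda> g (\<lambda>x. 1)"
    by (rule L2.tendsto_ip[OF \<psi>L g(1) one \<psi>(2)])
  then have m0: "m \<longlonglongrightarrow> 0"
    unfolding m_def using g(2) by (intro tendsto_eq_intros) (use \<theta> in auto)
  have "\<exists>\<phi>. test_function 0 \<Lambda> \<phi> \<and> deriv \<phi> = (\<lambda>x. 1 * \<psi> n x + (- m n) * \<theta> x)" for n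
  proof -
    have "L2_inner \<Lambda> (\<lambda>x. 1 * \<psi> n x + (- m n) * \<theta> x) (\<lambda>x. 1) = 0"
      unfolding L2.ip_lincomb[OF \<psi>L \<theta>L one] by (use \<theta> in \<open>simp add: m_def\<close>)
    from test_antideriv[OF test_lincomb[OF \<psi>(1) \<theta>(1)] this \<Lambda>] show ?thesis by metis
  qed
  then obtain \<phi> where \<phi>: "\<And>n. test_function 0 \<Lambda> (\<phi> n)" "\<And>n. deriv (\<phi> n) = (\<lambda>x. 1 * \<psi> n x + (- m n) * \<theta> x)"
    by metis
  have "(\<lambda>n. L2_norm \<Lambda> (\<lambda>x. deriv (\<phi> n) x - g x)) \<longlonglongrightarrow> 0"
  proof (rule Lim_null_comparison)
    have "L2_norm \<Lambda> (\<lambda>x. deriv (\<phi> n) x - g x) \<le> L2_norm \<Lambda> (\<lambda>x. \<psi> n x - g x) + \<bar>m n\<bar> * L2_norm \<Lambda> \<theta>" for n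
    proof -
      have "(\<lambda>x. deriv (\<phi> n) x - g x) = (\<lambda>x. (\<psi> n x - g x) + (- m n) * \<theta> x)"
        by (simp add: \<phi>(2) algebra_simps)
      then show ?thesis
        using L2.N_triangle[OF L2.diff_mem[OF \<psi>L g(1)] L2.scale_mem[OF \<theta>L], of n "- m n"] L2.N_scale[OF \<theta>L, of "- m n"]
        by simp
    qed
    then show "\<forall>\<^sub>F n in sequentially. norm (L2_norm \<Lambda> (\<lambda>x. deriv (\<phi> n) x - g x)) \<le>
       L2_norm \<Lambda> (\<lambda>x. \<psi> n x - g x) + \<bar>m n\<bar> * L2_norm \<Lambda> \<theta>" by simp
    show "(\<lambda>n. L2_norm \<Lambda> (\<lambda>x. \<psi> n x - g x) + \<bar>m n\<bar> * L2_norm \<Lambda> \<theta>) \<longlonglongrightarrow> 0"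
      using tendsto_add[OF \<psi>(2) tendsto_mult_left_zero[OF tendsto_rabs_zero[OF m0]]] by simp
  qed
  with \<phi>(1) that show ?thesis by blast
qed

text \<open>The difference is orthogonal to all test functions, hence by density to itself.\<close>

lemma weak_deriv_unique:
  assumes "g \<in> L2 \<Lambda>" "h \<in> L2 \<Lambda>" "weak_deriv \<Lambda> v g" "weak_deriv \<Lambda> v h"
  shows "AE x in dom_measure \<Lambda>. g x = h x"
proof -
  let ?d = "\<lambda>x. g x - h x"
  have d: "?d \<in> L2 \<Lambda>" by (rule L2.diff_mem[OF assms(1,2)])
  obtain \<phi> where \<phi>: "\<And>n. test_function 0 \<Lambda> (\<phi> n)" "(\<lambda>n. L2_norm \<Lambda> (\<lambda>x. \<phi> n x - ?d x)) \<longlonglongrightarrow> 0"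
    using test_dense_sequence[OF d] by blast
  have "(\<lambda>n. L2_inner \<Lambda> ?d (\<phi> n)) \<longlonglongrightarrow> L2_inner \<Lambda> ?d ?d"
    by (rule L2.tendsto_ip_right[OF test_L2[OF \<phi>(1)] d d \<phi>(2)])
  moreover have "L2_inner \<Lambda> ?d (\<phi> n) = 0" for n
    using L2.ip_diff[OF assms(1,2) test_L2[OF \<phi>(1)], of n] assms(3,4) \<phi>(1)[of n] by (simp add: weak_deriv_def)
  ultimately have "L2_inner \<Lambda> ?d ?d = 0" by (simp add: LIMSEQ_const_iff)
  then have "AE x in dom_measure \<Lambda>. ?d x = 0" by (intro L2_norm_zero_AE[OF d]) (simp add: L2_norm_def)
  then show ?thesis by simp
qed

text \<open>Du Bois-Reymond: the difference of \<open>a\<close> and \<open>prim \<Lambda> b\<close>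
  is orthogonal to all derivatives of test functions, hence to every function of mean zero. After
  subtraction of its own mean \<open>c\<close> it is such a function, so it is orthogonal to
  itself.\<close>

lemma weak_deriv_imp_prim:
  assumes a: "a \<in> L2 \<Lambda>" and b: "b \<in> L2 \<Lambda>" and w: "weak_deriv \<Lambda> a b" and \<Lambda>: "0 < \<Lambda>"
  shows "\<exists>c. AE x in dom_measure \<Lambda>. a x = c + prim \<Lambda> b x"
proof -
  note p = prim_L2[OF b] and one = L2_const[of 1 \<Lambda>]
  define c where "c = L2_inner \<Lambda> (\<lambda>x. a x - prim \<Lambda> b x) (\<lambda>x. 1) / \<Lambda>"
  let ?k = "\<lambda>x. (a x - prim \<Lambda> b x) - c * 1"
  have d: "(\<lambda>x. a x - prim \<Lambda> b x) \<in> L2 \<Lambda>" by (rule L2.diff_mem[OF a p])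
  have cL: "(\<lambda>x. c * 1) \<in> L2 \<Lambda>" using L2_const by simp
  have k: "?k \<in> L2 \<Lambda>" by (intro L2.diff_mem d cL)
  have "L2_inner \<Lambda> (\<lambda>x. 1) (\<lambda>x. 1) = \<Lambda>"
    using L2.N_sq[OF one] L2_norm_const[of \<Lambda> 1] \<Lambda> by simp
  then have m: "L2_inner \<Lambda> ?k (\<lambda>x. 1) = 0"
    unfolding L2.ip_diff[OF d cL one] L2.ip_scale[OF one one] using \<Lambda> by (simp add: c_def)
  obtain \<phi> where \<phi>: "\<And>n. test_function 0 \<Lambda> (\<phi> n)" "(\<lambda>n. L2_norm \<Lambda> (\<lambda>x. deriv (\<phi> n) x - ?k x)) \<longlonglongrightarrow> 0"
    using mean_zero_dense[OF k m \<Lambda>] by blast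
  note dL = test_L2[OF test_deriv[OF \<phi>(1)]]
  have "(\<lambda>n. L2_inner \<Lambda> ?k (deriv (\<phi> n))) \<longlonglongrightarrow> L2_inner \<Lambda> ?k ?k"
    by (rule L2.tendsto_ip_right[OF dL k k \<phi>(2)])
  moreover have "L2_inner \<Lambda> ?k (deriv (\<phi> n)) = 0" for n
    using w weak_deriv_prim[OF \<Lambda> b] \<phi>(1)[of n] L2_inner_const_eq[of \<Lambda> c "deriv (\<phi> n)"]
      test_deriv_mean[OF \<phi>(1) \<Lambda>, of n]
    unfolding L2.ip_diff[OF d cL dL] L2.ip_diff[OF a p dL] by (simp add: weak_deriv_def)
  ultimately have "L2_inner \<Lambda> ?k ?k = 0" by (simp add: LIMSEQ_const_iff)
  then have "AE x in dom_measure \<Lambda>. ?k x = 0" by (intro L2_norm_zero_AE[OF k]) (simp add: L2_norm_def)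
  then have "AE x in dom_measure \<Lambda>. a x = c + prim \<Lambda> b x" by eventually_elim simp
  then show ?thesis by blast
qed

section \<open>The spaces H1 and H10\<close>

lemma Dx:
  assumes "v \<in> H1 \<Lambda>" shows "D\<^sub>x \<Lambda> v \<in> L2 \<Lambda>" "weak_deriv \<Lambda> v (D\<^sub>x \<Lambda> v)"
proof -
  have "\<exists>v'. v' \<in> L2 \<Lambda> \<and> weak_deriv \<Lambda> v v'" using assms by (auto simp: H1_def)
  from someI_ex[OF this] show "D\<^sub>x \<Lambda> v \<in> L2 \<Lambda>" "weak_deriv \<Lambda> v (D\<^sub>x \<Lambda> v)"
    by (simp_all add: D\<^sub>x_def)
qed

lemma H1_L2: "v \<in> H1 \<Lambda> \<Longrightarrow> v \<in> L2 \<Lambda>" by (simp add: H1_def)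

lemma H1_I: "v \<in> L2 \<Lambda> \<Longrightarrow> g \<in> L2 \<Lambda> \<Longrightarrow> weak_deriv \<Lambda> v g \<Longrightarrow> v \<in> H1 \<Lambda>"
  by (auto simp: H1_def)

lemma Dx_unique:
  assumes "v \<in> L2 \<Lambda>" "g \<in> L2 \<Lambda>" "weak_deriv \<Lambda> v g"
  shows "AE x in dom_measure \<Lambda>. D\<^sub>x \<Lambda> v x = g x"
  using weak_deriv_unique[OF _ assms(2) _ assms(3)] Dx[OF H1_I[OF assms]] by blast

text \<open>\<open>D\<^sub>x\<close> picks some representative, so it is linear only almost
  everywhere; the inner products and norms built from it do not see the difference.\<close>

lemma H1_lincomb:
  assumes "v \<in> H1 \<Lambda>" "w \<in> H1 \<Lambda>"
  shows "(\<lambda>x. c * v x + d * w x) \<in> H1 \<Lambda>"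
    "AE x in dom_measure \<Lambda>. D\<^sub>x \<Lambda> (\<lambda>x. c * v x + d * w x) x = c * D\<^sub>x \<Lambda> v x + d * D\<^sub>x \<Lambda> w x"
proof -
  note D = Dx[OF assms(1)] Dx[OF assms(2)] and L = H1_L2[OF assms(1)] H1_L2[OF assms(2)]
  note w = weak_deriv_lincomb[OF L D(1,3) D(2,4), of c d]
  show "(\<lambda>x. c * v x + d * w x) \<in> H1 \<Lambda>"
    by (rule H1_I[OF L2_lincomb[OF L] L2_lincomb[OF D(1,3)] w])
  show "AE x in dom_measure \<Lambda>. D\<^sub>x \<Lambda> (\<lambda>x. c * v x + d * w x) x = c * D\<^sub>x \<Lambda> v x + d * D\<^sub>x \<Lambda> w x"
    by (rule Dx_unique[OF L2_lincomb[OF L] L2_lincomb[OF D(1,3)] w])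
qed

definition H1_inner :: "real \<Rightarrow> (real \<Rightarrow> real) \<Rightarrow> (real \<Rightarrow> real) \<Rightarrow> real" where
  "H1_inner \<Lambda> v w = L2_inner \<Lambda> v w + L2_inner \<Lambda> (D\<^sub>x \<Lambda> v) (D\<^sub>x \<Lambda> w)"

lemma L2_norm_sq_inner: "(L2_norm \<Lambda> g)\<^sup>2 = L2_inner \<Lambda> g g"
  by (simp add: L2_norm_def L2_inner_def)

interpretation H1: semi_inner "H1 \<Lambda>" "H1_inner \<Lambda>" "H1_norm \<Lambda>" for \<Lambda>
proof
  fix a b w c d
  show "(\<lambda>x. 0) \<in> H1 \<Lambda>"
    by (rule H1_I[OF L2.zero_mem L2.zero_mem]) (simp add: weak_deriv_def L2_inner_def)
  show "H1_inner \<Lambda> a b = H1_inner \<Lambda> b a" by (simp add: H1_inner_def L2_inner_def mult.commute)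
  show "0 \<le> H1_inner \<Lambda> a a" by (simp add: H1_inner_def L2_inner_def)
  show "H1_norm \<Lambda> a = sqrt (H1_inner \<Lambda> a a)" by (simp add: H1_norm_def H1_inner_def L2_norm_sq_inner)
  assume a: "a \<in> H1 \<Lambda>" and b: "b \<in> H1 \<Lambda>"
  then show "(\<lambda>x. c * a x + d * b x) \<in> H1 \<Lambda>" by (rule H1_lincomb)
  assume w: "w \<in> H1 \<Lambda>"
  have "L2_inner \<Lambda> (D\<^sub>x \<Lambda> (\<lambda>x. c * a x + d * b x)) (D\<^sub>x \<Lambda> w) =
    L2_inner \<Lambda> (\<lambda>x. c * D\<^sub>x \<Lambda> a x + d * D\<^sub>x \<Lambda> b x) (D\<^sub>x \<Lambda> w)"
    by (intro L2_cong_AE(2)[OF H1_lincomb(2)[OF a b]] L2D(1) Dx L2_lincomb H1_lincomb a b w)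
  also have "\<dots> = c * L2_inner \<Lambda> (D\<^sub>x \<Lambda> a) (D\<^sub>x \<Lambda> w) + d * L2_inner \<Lambda> (D\<^sub>x \<Lambda> b) (D\<^sub>x \<Lambda> w)"
    by (intro L2.ip_lincomb Dx a b w)
  finally show "H1_inner \<Lambda> (\<lambda>x. c * a x + d * b x) w = c * H1_inner \<Lambda> a w + d * H1_inner \<Lambda> b w"
    using L2.ip_lincomb[OF a[THEN H1_L2] b[THEN H1_L2] w[THEN H1_L2], of c d]
    by (simp add: H1_inner_def algebra_simps)
qed

lemma Dx_diff_norm:
  assumes "v \<in> H1 \<Lambda>" "w \<in> H1 \<Lambda>"
  shows "L2_norm \<Lambda> (D\<^sub>x \<Lambda> (\<lambda>x. v x - w x)) = L2_norm \<Lambda> (\<lambda>x. D\<^sub>x \<Lambda> v x - D\<^sub>x \<Lambda> w x)"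
proof (rule L2_cong_AE(1))
  show "AE x in dom_measure \<Lambda>. D\<^sub>x \<Lambda> (\<lambda>x. v x - w x) x = D\<^sub>x \<Lambda> v x - D\<^sub>x \<Lambda> w x"
    using H1_lincomb(2)[OF assms, of 1 "-1"] by simp
qed (intro L2D(1) Dx H1.diff_mem L2.diff_mem assms)+

lemma L2_le_H1: "L2_norm \<Lambda> v \<le> H1_norm \<Lambda> v" "L2_norm \<Lambda> (D\<^sub>x \<Lambda> v) \<le> H1_norm \<Lambda> v"
  unfolding H1_norm_def by (simp_all add: real_le_rsqrt)

lemma H1_le_L2: "H1_norm \<Lambda> v \<le> L2_norm \<Lambda> v + L2_norm \<Lambda> (D\<^sub>x \<Lambda> v)"
  unfolding H1_norm_def by (rule sqrt_sum_squares_le_sum) auto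

text \<open>Functions and derivatives converge separately in L2, and closedness of the weak
  derivative identifies the second limit as the derivative of the first.\<close>

lemma H1_complete:
  assumes g: "\<And>n. g n \<in> H1 \<Lambda>"
    and C: "\<And>e. 0 < e \<Longrightarrow> \<exists>M. \<forall>m\<ge>M. \<forall>n\<ge>M. H1_norm \<Lambda> (\<lambda>x. g m x - g n x) < e"
  shows "\<exists>l\<in>H1 \<Lambda>. (\<lambda>n. H1_norm \<Lambda> (\<lambda>x. g n x - l x)) \<longlonglongrightarrow> 0"
proof -
  have "\<exists>M. \<forall>m\<ge>M. \<forall>n\<ge>M. L2_norm \<Lambda> (\<lambda>x. g m x - g n x) < e" if "0 < e" for e
    using C[OF that] L2_le_H1(1) le_less_trans by blast
  from L2_complete[OF H1_L2[OF g] this]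
  obtain l where l: "l \<in> L2 \<Lambda>" "(\<lambda>n. L2_norm \<Lambda> (\<lambda>x. g n x - l x)) \<longlonglongrightarrow> 0" by blast
  have "\<exists>M. \<forall>m\<ge>M. \<forall>n\<ge>M. L2_norm \<Lambda> (\<lambda>x. D\<^sub>x \<Lambda> (g m) x - D\<^sub>x \<Lambda> (g n) x) < e" if "0 < e" for e
    using C[OF that] L2_le_H1(2) le_less_trans unfolding Dx_diff_norm[OF g g, symmetric] by blast
  from L2_complete[OF Dx(1)[OF g] this]
  obtain l' where l': "l' \<in> L2 \<Lambda>" "(\<lambda>n. L2_norm \<Lambda> (\<lambda>x. D\<^sub>x \<Lambda> (g n) x - l' x)) \<longlonglongrightarrow> 0" by blast
  have wd: "weak_deriv \<Lambda> l l'"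
    by (rule weak_deriv_limit[OF H1_L2[OF g] Dx(1)[OF g] l(1) l'(1) Dx(2)[OF g] l(2) l'(2)])
  have lH: "l \<in> H1 \<Lambda>" by (rule H1_I[OF l(1) l'(1) wd])
  have "(\<lambda>n. H1_norm \<Lambda> (\<lambda>x. g n x - l x)) \<longlonglongrightarrow> 0"
  proof (rule Lim_null_comparison)
    have e: "L2_norm \<Lambda> (D\<^sub>x \<Lambda> (\<lambda>x. g n x - l x)) = L2_norm \<Lambda> (\<lambda>x. D\<^sub>x \<Lambda> (g n) x - l' x)" for n
      unfolding Dx_diff_norm[OF g lH]
    proof (rule L2_cong_AE(1))
      show "AE x in dom_measure \<Lambda>. D\<^sub>x \<Lambda> (g n) x - D\<^sub>x \<Lambda> l x = D\<^sub>x \<Lambda> (g n) x - l' x"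
        using Dx_unique[OF l(1) l'(1) wd] by eventually_elim simp
    qed (intro L2D(1) Dx L2.diff_mem g lH l')+
    show "\<forall>\<^sub>F n in sequentially. norm (H1_norm \<Lambda> (\<lambda>x. g n x - l x)) \<le>
       L2_norm \<Lambda> (\<lambda>x. g n x - l x) + L2_norm \<Lambda> (\<lambda>x. D\<^sub>x \<Lambda> (g n) x - l' x)"
      using H1_le_L2[of \<Lambda> "\<lambda>x. g _ x - l x", unfolded e] H1.N_nonneg[OF H1.diff_mem[OF g lH]] by simp
    show "(\<lambda>n. L2_norm \<Lambda> (\<lambda>x. g n x - l x) + L2_norm \<Lambda> (\<lambda>x. D\<^sub>x \<Lambda> (g n) x - l' x)) \<longlonglongrightarrow> 0"
      using tendsto_add[OF l(2) l'(2)] by simp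
  qed
  with lH show ?thesis by blast
qed

lemma test_H1:
  assumes "test_function 0 \<Lambda> \<phi>" "0 < \<Lambda>"
  shows "\<phi> \<in> H1 \<Lambda>" "AE x in dom_measure \<Lambda>. D\<^sub>x \<Lambda> \<phi> x = deriv \<phi> x"
  using H1_I[OF test_L2[OF assms(1)] test_L2[OF test_deriv[OF assms(1)]] weak_deriv_smooth[OF test_smooth[OF assms(1)] assms(2)]]
    Dx_unique[OF test_L2[OF assms(1)] test_L2[OF test_deriv[OF assms(1)]] weak_deriv_smooth[OF test_smooth[OF assms(1)] assms(2)]]
  by blast+

lemma H10_H1: "v \<in> H10 \<Lambda> \<Longrightarrow> v \<in> H1 \<Lambda>" by (simp add: H10_def)

lemma H10_iff: "v \<in> H10 \<Lambda> \<longleftrightarrow> v \<in> H1 \<Lambda> \<and> (\<forall>e>0. \<exists>\<phi>\<in>Collect (test_function 0 \<Lambda>). H1_norm \<Lambda> (\<lambda>x. v x - \<phi> x) < e)"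
  by (simp add: H10_def)

locale domain =
  fixes \<Lambda> :: real
  assumes \<Lambda>_pos: "0 < \<Lambda>"
begin

lemma test_subset: "Collect (test_function 0 \<Lambda>) \<subseteq> H1 \<Lambda>"
proof
  fix \<phi> assume "\<phi> \<in> Collect (test_function 0 \<Lambda>)"
  then have "test_function 0 \<Lambda> \<phi>" by simp
  then show "\<phi> \<in> H1 \<Lambda>" by (rule test_H1(1)[OF _ \<Lambda>_pos])
qed

lemma H10_lincomb:
  assumes "a \<in> H10 \<Lambda>" "b \<in> H10 \<Lambda>" shows "(\<lambda>x. c * a x + d * b x) \<in> H10 \<Lambda>"
  unfolding H10_iff
proof (intro conjI allI impI)
  show "(\<lambda>x. c * a x + d * b x) \<in> H1 \<Lambda>" by (intro H1_lincomb(1) H10_H1 assms)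
  fix e :: real assume "0 < e"
  with assms show "\<exists>\<phi>\<in>Collect (test_function 0 \<Lambda>). H1_norm \<Lambda> (\<lambda>x. (c * a x + d * b x) - \<phi> x) < e"
    by (intro H1.closure_lincomb[OF _ test_subset]) (auto simp: H10_iff intro: test_lincomb)
qed

lemma H10_closed:
  assumes "\<And>n. h n \<in> H10 \<Lambda>" "a \<in> H1 \<Lambda>" "(\<lambda>n. H1_norm \<Lambda> (\<lambda>x. h n x - a x)) \<longlonglongrightarrow> 0"
  shows "a \<in> H10 \<Lambda>"
  unfolding H10_iff
proof (intro conjI allI impI assms(2))
  fix e :: real assume e: "0 < e"
  show "\<exists>\<phi>\<in>Collect (test_function 0 \<Lambda>). H1_norm \<Lambda> (\<lambda>x. a x - \<phi> x) < e"
    by (rule H1.closure_limit[OF test_subset assms(2) H10_H1[OF assms(1)] _ assms(3) e])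
       (use assms(1) in \<open>auto simp: H10_iff\<close>)
qed

lemma H10_sequence:
  assumes "v \<in> H10 \<Lambda>"
  obtains \<phi> where "\<And>n::nat. test_function 0 \<Lambda> (\<phi> n)" "(\<lambda>n. H1_norm \<Lambda> (\<lambda>x. \<phi> n x - v x)) \<longlonglongrightarrow> 0"
    "(\<lambda>n. L2_norm \<Lambda> (\<lambda>x. \<phi> n x - v x)) \<longlonglongrightarrow> 0" "(\<lambda>n. L2_norm \<Lambda> (\<lambda>x. deriv (\<phi> n) x - D\<^sub>x \<Lambda> v x)) \<longlonglongrightarrow> 0"
proof -
  note v = H10_H1[OF assms]
  obtain \<phi> where \<phi>: "\<And>n::nat. \<phi> n \<in> Collect (test_function 0 \<Lambda>)" and l: "(\<lambda>n. H1_norm \<Lambda> (\<lambda>x. \<phi> n x - v x)) \<longlonglongrightarrow> 0"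
    by (rule H1.closure_sequence[OF test_subset v]) (use assms in \<open>auto simp: H10_iff\<close>)
  have t: "test_function 0 \<Lambda> (\<phi> n)" for n using \<phi> by simp
  note tH = test_H1[OF t \<Lambda>_pos]
  have e: "L2_norm \<Lambda> (\<lambda>x. deriv (\<phi> n) x - D\<^sub>x \<Lambda> v x) = L2_norm \<Lambda> (D\<^sub>x \<Lambda> (\<lambda>x. \<phi> n x - v x))" for n
    unfolding Dx_diff_norm[OF tH(1) v]
  proof (rule L2_cong_AE(1))
    show "AE x in dom_measure \<Lambda>. deriv (\<phi> n) x - D\<^sub>x \<Lambda> v x = D\<^sub>x \<Lambda> (\<phi> n) x - D\<^sub>x \<Lambda> v x"
      using tH(2)[of n] by eventually_elim simp
  qed (intro L2D(1) L2.diff_mem Dx tH v test_L2[OF test_deriv[OF t]])+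
  show ?thesis
  proof (rule that[OF t l])
    show "(\<lambda>n. L2_norm \<Lambda> (\<lambda>x. \<phi> n x - v x)) \<longlonglongrightarrow> 0"
      by (rule Lim_null_comparison[OF _ l]) (use L2_le_H1 in simp)
    show "(\<lambda>n. L2_norm \<Lambda> (\<lambda>x. deriv (\<phi> n) x - D\<^sub>x \<Lambda> v x)) \<longlonglongrightarrow> 0"
      by (rule Lim_null_comparison[OF _ l]) (use L2_le_H1 e in simp)
  qed
qed

text \<open>The trace that the two boundary conditions leave on the derivative. It makes constants
  invisible when an equation is tested with derivatives of members of H10.\<close>

lemma H10_mean:
  assumes "v \<in> H10 \<Lambda>" shows "L2_inner \<Lambda> (D\<^sub>x \<Lambda> v) (\<lambda>x. 1) = 0"
proof -
  obtain \<phi> where \<phi>: "\<And>n::nat. test_function 0 \<Lambda> (\<phi> n)" "(\<lambda>n. L2_norm \<Lambda> (\<lambda>x. deriv (\<phi> n) x - D\<^sub>x \<Lambda> v x)) \<longlonglongrightarrow> 0"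
    using H10_sequence[OF assms] by metis
  have "(\<lambda>n. L2_inner \<Lambda> (deriv (\<phi> n)) (\<lambda>x. 1)) \<longlonglongrightarrow> L2_inner \<Lambda> (D\<^sub>x \<Lambda> v) (\<lambda>x. 1)"
    by (rule L2.tendsto_ip[OF test_L2[OF test_deriv[OF \<phi>(1)]] Dx(1)[OF H10_H1[OF assms]] L2_const \<phi>(2)])
  then show ?thesis by (simp add: test_deriv_mean[OF \<phi>(1) \<Lambda>_pos] LIMSEQ_const_iff)
qed

text \<open>A test function is the primitive of its derivative, and \<open>prim_norm\<close>
  supplies the constant; both norms pass to the limit in H1.\<close>

lemma poincare:
  assumes "v \<in> H10 \<Lambda>" shows "L2_norm \<Lambda> v \<le> \<Lambda> * L2_norm \<Lambda> (D\<^sub>x \<Lambda> v)"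
proof -
  note v = H10_H1[OF assms]
  obtain \<phi> where \<phi>: "\<And>n::nat. test_function 0 \<Lambda> (\<phi> n)" 
    "(\<lambda>n. H1_norm \<Lambda> (\<lambda>x. \<phi> n x - v x)) \<longlonglongrightarrow> 0"
    "(\<lambda>n. L2_norm \<Lambda> (\<lambda>x. \<phi> n x - v x)) \<longlonglongrightarrow> 0" "(\<lambda>n. L2_norm \<Lambda> (\<lambda>x. deriv (\<phi> n) x - D\<^sub>x \<Lambda> v x)) \<longlonglongrightarrow> 0"
    by (rule H10_sequence[OF assms]) (rule that, assumption+)
  have "L2_norm \<Lambda> (\<phi> n) \<le> \<Lambda> * L2_norm \<Lambda> (deriv (\<phi> n))" for n
  proof -
    note dL = test_L2[OF test_deriv[OF \<phi>(1)[of n]]]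
    have z: "\<phi> n 0 = 0" using \<phi>(1)[of n] unfolding test_function_alt by force
    have "\<phi> n x = prim \<Lambda> (deriv (\<phi> n)) x" if "x \<in> {0..\<Lambda>}" for x
      using prim_FTC[of "\<phi> n" "deriv (\<phi> n)" x \<Lambda>] z that
        smooth_has_deriv[OF test_smooth[OF \<phi>(1)]] smooth_continuous[OF smooth_deriv[OF test_smooth[OF \<phi>(1)]]] by simp
    then have "L2_norm \<Lambda> (\<phi> n) = L2_norm \<Lambda> (prim \<Lambda> (deriv (\<phi> n)))"
      by (intro L2_cong_AE(1) AE_I2 L2D(1) test_L2[OF \<phi>(1)] prim_L2 dL) auto
    then show ?thesis using prim_norm[OF _ dL] \<Lambda>_pos by simp
  qed
  moreover have "(\<lambda>n. L2_norm \<Lambda> (\<phi> n)) \<longlonglongrightarrow> L2_norm \<Lambda> v"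
    by (rule L2.tendsto_N[OF test_L2[OF \<phi>(1)] H1_L2[OF v] \<phi>(3)])
  moreover have "(\<lambda>n. \<Lambda> * L2_norm \<Lambda> (deriv (\<phi> n))) \<longlonglongrightarrow> \<Lambda> * L2_norm \<Lambda> (D\<^sub>x \<Lambda> v)"
    by (intro tendsto_mult_left L2.tendsto_N[OF test_L2[OF test_deriv[OF \<phi>(1)]] Dx(1)[OF v] \<phi>(4)])
  ultimately show ?thesis by (meson LIMSEQ_le)
qed

text \<open>Source of the factor 1 + \<Lambda> in the later constants: coefficients control the
  derivative alone.\<close>

lemma H1_norm_le: "v \<in> H10 \<Lambda> \<Longrightarrow> H1_norm \<Lambda> v \<le> (1 + \<Lambda>) * L2_norm \<Lambda> (D\<^sub>x \<Lambda> v)"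
  using H1_le_L2[of \<Lambda> v] poincare[of v] by (simp add: algebra_simps)

text \<open>Converse to \<open>H10_mean\<close>. If the derivatives of test functions tend to
  \<open>g\<close>, then the test functions tend to \<open>prim \<Lambda> g\<close> in H1, since the
  difference is the primitive of the error in the derivative.\<close>

lemma prim_H10:
  assumes "g \<in> L2 \<Lambda>" "L2_inner \<Lambda> g (\<lambda>x. 1) = 0"
  shows "prim \<Lambda> g \<in> H10 \<Lambda>" "AE x in dom_measure \<Lambda>. D\<^sub>x \<Lambda> (prim \<Lambda> g) x = g x"
proof -
  note wd = weak_deriv_prim[OF \<Lambda>_pos assms(1)] and pL = prim_L2[OF assms(1)]
  have pH: "prim \<Lambda> g \<in> H1 \<Lambda>" by (rule H1_I[OF pL assms(1) wd])
  show D: "AE x in dom_measure \<Lambda>. D\<^sub>x \<Lambda> (prim \<Lambda> g) x = g x" by (rule Dx_unique[OF pL assms(1) wd])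
  obtain \<phi> where \<phi>: "\<And>n::nat. test_function 0 \<Lambda> (\<phi> n)" "(\<lambda>n. L2_norm \<Lambda> (\<lambda>x. deriv (\<phi> n) x - g x)) \<longlonglongrightarrow> 0"
    using mean_zero_dense[OF assms \<Lambda>_pos] by blast
  note tH = test_H1[OF \<phi>(1) \<Lambda>_pos] and dL = test_L2[OF test_deriv[OF \<phi>(1)]]
  have le: "H1_norm \<Lambda> (\<lambda>x. \<phi> n x - prim \<Lambda> g x) \<le> (1 + \<Lambda>) * L2_norm \<Lambda> (\<lambda>x. deriv (\<phi> n) x - g x)" for n
  proof -
    have z: "\<phi> n 0 = 0" using \<phi>(1)[of n] unfolding test_function_alt by force
    have "\<phi> n x - prim \<Lambda> g x = prim \<Lambda> (\<lambda>x. deriv (\<phi> n) x - g x) x" if "x \<in> {0..\<Lambda>}" for x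
      using prim_FTC[of "\<phi> n" "deriv (\<phi> n)" x \<Lambda>] z that prim_diff[OF dL assms(1), of n]
        smooth_has_deriv[OF test_smooth[OF \<phi>(1)]] smooth_continuous[OF smooth_deriv[OF test_smooth[OF \<phi>(1)]]] by simp
    then have "L2_norm \<Lambda> (\<lambda>x. \<phi> n x - prim \<Lambda> g x) = L2_norm \<Lambda> (prim \<Lambda> (\<lambda>x. deriv (\<phi> n) x - g x))"
      by (intro L2_cong_AE(1) AE_I2 L2D(1) L2.diff_mem test_L2[OF \<phi>(1)] prim_L2 dL assms) auto
    then have 1: "L2_norm \<Lambda> (\<lambda>x. \<phi> n x - prim \<Lambda> g x) \<le> \<Lambda> * L2_norm \<Lambda> (\<lambda>x. deriv (\<phi> n) x - g x)"
      using prim_norm[OF _ L2.diff_mem[OF dL assms(1)]] \<Lambda>_pos by simp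
    have "L2_norm \<Lambda> (D\<^sub>x \<Lambda> (\<lambda>x. \<phi> n x - prim \<Lambda> g x)) = L2_norm \<Lambda> (\<lambda>x. deriv (\<phi> n) x - g x)"
      unfolding Dx_diff_norm[OF tH(1) pH]
    proof (rule L2_cong_AE(1))
      show "AE x in dom_measure \<Lambda>. D\<^sub>x \<Lambda> (\<phi> n) x - D\<^sub>x \<Lambda> (prim \<Lambda> g) x = deriv (\<phi> n) x - g x"
        using tH(2)[of n] D by eventually_elim simp
    qed (intro L2D(1) L2.diff_mem Dx tH pH dL assms)+
    with 1 H1_le_L2[of \<Lambda> "\<lambda>x. \<phi> n x - prim \<Lambda> g x"] show ?thesis by (simp add: algebra_simps)
  qed
  have lim: "(\<lambda>n. H1_norm \<Lambda> (\<lambda>x. \<phi> n x - prim \<Lambda> g x)) \<longlonglongrightarrow> 0"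
    by (rule Lim_null_comparison[OF _ tendsto_mult_right_zero[OF \<phi>(2), of "1 + \<Lambda>"]])
       (use le H1.N_nonneg[OF H1.diff_mem[OF tH(1) pH]] in simp)
  have "\<phi> n \<in> H10 \<Lambda>" for n
    unfolding H10_iff
  proof (intro conjI allI impI tH(1))
    show "\<exists>\<phi>'\<in>Collect (test_function 0 \<Lambda>). H1_norm \<Lambda> (\<lambda>x. \<phi> n x - \<phi>' x) < e" if "0 < e" for e
      by (rule bexI[of _ "\<phi> n"]) (use that \<phi>(1) H1.N_zero in auto)
  qed
  then show "prim \<Lambda> g \<in> H10 \<Lambda>" by (rule H10_closed[OF _ pH lim])
qed

end

section \<open>Bochner integrals of functions of time\<close>

text \<open>Lebesgue measure is complete, so a change on a null set preserves measurability;
  multiplication by the indicator carries this over to the restricted measure.\<close>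

lemma borel_measurable_lebesgue_on_AE:
  fixes f g :: "real \<Rightarrow> real"
  assumes A: "A \<in> sets lebesgue" and f: "f \<in> borel_measurable (lebesgue_on A)"
    and ae: "AE x in lebesgue_on A. f x = g x"
  shows "g \<in> borel_measurable (lebesgue_on A)"
proof -
  have A': "A \<inter> space lebesgue \<in> sets lebesgue" using A by simp
  have "(\<lambda>x. indicator A x *\<^sub>R f x) \<in> borel_measurable lebesgue"
    using f borel_measurable_restrict_space_iff[OF A', of f] by simp
  moreover have "AE x in lebesgue. indicator A x *\<^sub>R f x = indicator A x *\<^sub>R g x"
    using ae unfolding AE_restrict_space_iff[OF A'] by eventually_elim (auto simp: indicator_def)
  ultimately have "(\<lambda>x. indicator A x *\<^sub>R g x) \<in> borel_measurable lebesgue"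
    by (rule borel_measurable_AE)
  then show ?thesis using borel_measurable_restrict_space_iff[OF A', of g] by simp
qed

lemma borel_measurable_lebesgue_on_limit:
  fixes g :: "nat \<Rightarrow> real \<Rightarrow> real"
  assumes "A \<in> sets lebesgue" "\<And>n. g n \<in> borel_measurable (lebesgue_on A)"
    "AE x in lebesgue_on A. (\<lambda>n. g n x) \<longlonglongrightarrow> l x"
  shows "l \<in> borel_measurable (lebesgue_on A)"
proof (rule borel_measurable_lebesgue_on_AE[OF assms(1)])
  show "(\<lambda>x. lim (\<lambda>n. g n x)) \<in> borel_measurable (lebesgue_on A)"
    using assms(2) by (rule borel_measurable_lim_metric)
  show "AE x in lebesgue_on A. lim (\<lambda>n. g n x) = l x"
    using assms(3) by eventually_elim (rule limI)
qed

section \<open>Passage between the open and the closed time interval\<close>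

abbreviation (input) time_measure :: "real \<Rightarrow> real measure" where
  "time_measure T \<equiv> lebesgue_on {0<..<T}"

text \<open>The problem is posed on the open interval, while \<open>L2\<close> and
  \<open>prim\<close> live on the closed one.\<close>

lemma AE_time_iff: "(AE t in time_measure T. P t) \<longleftrightarrow> (AE t in dom_measure T. P t)"
proof -
  have *: "AE t in lebesgue. t \<noteq> 0 \<and> t \<noteq> T"
  proof (rule AE_I')
    show "{0, T} \<in> null_sets lebesgue"
      by (intro null_sets_completionI finite_imp_null_set_lborel) auto
  qed auto
  have "(AE t in lebesgue. t \<in> {0<..<T} \<longrightarrow> P t) \<longleftrightarrow> (AE t in lebesgue. t \<in> {0..T} \<longrightarrow> P t)"
  proof
    assume "AE t in lebesgue. t \<in> {0<..<T} \<longrightarrow> P t"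
    with * show "AE t in lebesgue. t \<in> {0..T} \<longrightarrow> P t" by eventually_elim auto
  next
    assume "AE t in lebesgue. t \<in> {0..T} \<longrightarrow> P t"
    then show "AE t in lebesgue. t \<in> {0<..<T} \<longrightarrow> P t" by eventually_elim auto
  qed
  then show ?thesis by (simp add: AE_restrict_space_iff)
qed

lemma indicator_time_AE: "AE t in lebesgue. indicator {0..T} t *\<^sub>R f t = indicator {0<..<T::real} t *\<^sub>R (f t :: real)"
proof -
  have "AE t in lebesgue. t \<in> {0..T} \<longrightarrow> 0 < t \<and> t < T"
    using AE_dom_measure_endpoints[of T] by (subst (asm) AE_restrict_space_iff) auto
  then show ?thesis by eventually_elim (auto simp: indicator_def)
qed

lemma measurable_time_iff:
  fixes f :: "real \<Rightarrow> real"
  shows "f \<in> borel_measurable (time_measure T) \<longleftrightarrow> f \<in> borel_measurable (dom_measure T)"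
proof -
  have "f \<in> borel_measurable (lebesgue_on A) \<longleftrightarrow> (\<lambda>x. indicator A x *\<^sub>R f x) \<in> borel_measurable lebesgue"
    if "A \<in> sets lebesgue" for A
    by (rule borel_measurable_restrict_space_iff) (use that in auto)
  note this[of "{0<..<T}"] this[of "{0..T}"]
  moreover have sym: "AE t in lebesgue. indicator {0<..<T} t *\<^sub>R f t = indicator {0..T} t *\<^sub>R f t"
    using indicator_time_AE[of T f] by eventually_elim (rule sym)
  have "(\<lambda>t. indicator {0<..<T} t *\<^sub>R f t) \<in> borel_measurable lebesgue \<longleftrightarrow>
      (\<lambda>t. indicator {0..T} t *\<^sub>R f t) \<in> borel_measurable lebesgue"
    by (rule iffI; rule borel_measurable_AE, assumption) (rule sym, rule indicator_time_AE)
  ultimately show ?thesis by simp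
qed

lemma integral_time_eq:
  fixes f :: "real \<Rightarrow> real"
  assumes "f \<in> borel_measurable (dom_measure T)"
  shows "(LINT t|time_measure T. f t) = (LINT t|dom_measure T. f t)"
    "integrable (time_measure T) f \<longleftrightarrow> integrable (dom_measure T) f"
proof -
  have m: "(\<lambda>t. indicator {0<..<T} t *\<^sub>R f t) \<in> borel_measurable lebesgue" 
    "(\<lambda>t. indicator {0..T} t *\<^sub>R f t) \<in> borel_measurable lebesgue"
    using assms measurable_time_iff[of f T] borel_measurable_restrict_space_iff[of "{0<..<T}" lebesgue f]
      borel_measurable_restrict_space_iff[of "{0..T}" lebesgue f] by auto
  show "(LINT t|time_measure T. f t) = (LINT t|dom_measure T. f t)"
    using integral_cong_AE[OF m(2,1) indicator_time_AE] by (simp add: integral_restrict_space)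
  show "integrable (time_measure T) f \<longleftrightarrow> integrable (dom_measure T) f"
    using integrable_cong_AE[OF m(2,1) indicator_time_AE] by (simp add: integrable_restrict_space)
qed

text \<open>\<open>simple_valued\<close> without the membership condition and with any type of
  values, so that pairs, integers and truth values are allowed. With finitely many measurable level
  sets, every function or predicate of the value is measurable.\<close>

definition finitely_valued :: "real set \<Rightarrow> (real \<Rightarrow> 'a) \<Rightarrow> bool" where
  "finitely_valued I s \<longleftrightarrow> finite (s ` I) \<and> (\<forall>y. {t \<in> I. s t = y} \<in> sets lebesgue)"

lemma simple_valued_iff: "simple_valued I X s \<longleftrightarrow> s ` I \<subseteq> X \<and> finitely_valued I s"
  by (auto simp: simple_valued_def finitely_valued_def)

lemma finitely_valued_Collect:
  assumes "finitely_valued I s" shows "{t \<in> I. P (s t)} \<in> sets lebesgue"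
proof -
  have "{t \<in> I. P (s t)} = (\<Union>z\<in>{z \<in> s ` I. P z}. {t \<in> I. s t = z})" by auto
  also have "\<dots> \<in> sets lebesgue"
    using assms by (intro sets.finite_UN) (auto simp: finitely_valued_def)
  finally show ?thesis .
qed

lemma finitely_valued_map:
  assumes "finitely_valued I s" shows "finitely_valued I (\<lambda>t. F (s t))"
  unfolding finitely_valued_def
proof (intro conjI allI)
  have "(\<lambda>t. F (s t)) ` I = F ` s ` I" by auto
  then show "finite ((\<lambda>t. F (s t)) ` I)" using assms by (simp add: finitely_valued_def)
  show "{t \<in> I. F (s t) = y} \<in> sets lebesgue" for y
    using finitely_valued_Collect[OF assms, of "\<lambda>z. F z = y"] .
qed

lemma finitely_valued_map2:
  assumes "finitely_valued I s" "finitely_valued I r" shows "finitely_valued I (\<lambda>t. F (s t) (r t))"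
proof -
  have "finitely_valued I (\<lambda>t. (s t, r t))"
    unfolding finitely_valued_def
  proof (intro conjI allI)
    have "(\<lambda>t. (s t, r t)) ` I \<subseteq> s ` I \<times> r ` I" by auto
    then show "finite ((\<lambda>t. (s t, r t)) ` I)"
      using assms by (meson finite_SigmaI finite_subset finitely_valued_def)
    fix y
    have eq: "{t \<in> I. (s t, r t) = y} = {t \<in> I. s t = fst y} \<inter> {t \<in> I. r t = snd y}" by auto
    show "{t \<in> I. (s t, r t) = y} \<in> sets lebesgue"
      unfolding eq by (rule sets.Int) (use assms in \<open>auto simp: finitely_valued_def\<close>)
  qed
  from finitely_valued_map[OF this, of "\<lambda>(a, b). F a b"] show ?thesis by simp
qed

lemma finitely_valued_predicate:
  assumes "{t \<in> I. P t} \<in> sets lebesgue" "I \<in> sets lebesgue" shows "finitely_valued I P"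
  unfolding finitely_valued_def
proof (intro conjI allI)
  show "finite (P ` I)" by (rule finite_subset[of _ UNIV]) auto
  fix y
  have "{t \<in> I. P t = y} = (if y then {t \<in> I. P t} else I - {t \<in> I. P t})" by auto
  then show "{t \<in> I. P t = y} \<in> sets lebesgue" using assms by auto
qed

lemma finitely_valued_measurable:
  assumes "finitely_valued I s" "I \<in> sets lebesgue"
  shows "(\<lambda>t. g (s t) :: real) \<in> borel_measurable (lebesgue_on I)"
proof (rule borel_measurableI)
  fix S :: "real set"
  have "(\<lambda>t. g (s t)) -` S \<inter> space (lebesgue_on I) = {t \<in> I. g (s t) \<in> S}" by auto
  then show "(\<lambda>t. g (s t)) -` S \<inter> space (lebesgue_on I) \<in> sets (lebesgue_on I)"
    using finitely_valued_Collect[OF assms(1), of "\<lambda>z. g z \<in> S"] assms(2)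
    by (simp add: sets_restrict_space_iff)
qed

lemma finitely_valued_simple_function:
  assumes "simple_function (lebesgue_on I) s" "I \<in> sets lebesgue" shows "finitely_valued I s"
  unfolding finitely_valued_def
proof (intro conjI allI)
  show "finite (s ` I)" using simple_functionD(1)[OF assms(1)] by simp
  fix y
  have "s -` {y} \<inter> I \<in> sets (lebesgue_on I)" using simple_functionD(2)[OF assms(1), of "{y}"] by simp
  then have "s -` {y} \<inter> I \<in> sets lebesgue" using assms(2) by (simp add: sets_restrict_space_iff)
  moreover have "s -` {y} \<inter> I = {t \<in> I. s t = y}" by auto
  ultimately show "{t \<in> I. s t = y} \<in> sets lebesgue" by simp
qed

lemma finitely_valued_floor: "finitely_valued {0<..<T} (\<lambda>t. \<lfloor>real n * t\<rfloor>)"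
  unfolding finitely_valued_def
proof (intro conjI allI)
  have "(\<lambda>t. \<lfloor>real n * t\<rfloor>) ` {0<..<T} \<subseteq> {0..\<lfloor>real n * T\<rfloor>}"
    by (auto intro!: floor_mono mult_left_mono)
  then show "finite ((\<lambda>t. \<lfloor>real n * t\<rfloor>) ` {0<..<T})" by (rule finite_subset) simp
  fix y
  have "{t \<in> {0<..<T}. \<lfloor>real n * t\<rfloor> = y} \<in> sets borel" by measurable
  then show "{t \<in> {0<..<T}. \<lfloor>real n * t\<rfloor> = y} \<in> sets lebesgue" by (simp add: sets_completionI_sets)
qed

section \<open>Bochner integration in a complete semi-inner product space\<close>

locale bochner_space = semi_inner +
  fixes T :: real
  assumes T_pos: "0 < T"
    and complete: "(\<And>n. g n \<in> X) \<Longrightarrow> (\<And>e. 0 < e \<Longrightarrow> \<exists>M. \<forall>m\<ge>M. \<forall>n\<ge>M. N (\<lambda>x. g m x - g n x) < e) \<Longrightarrow>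
      \<exists>l\<in>X. (\<lambda>n::nat. N (\<lambda>x. g n x - l x)) \<longlonglongrightarrow> 0"
begin

abbreviation "SM \<equiv> strongly_measurable {0<..<T} X N"

lemma SM_mem: "SM h \<Longrightarrow> t \<in> {0<..<T} \<Longrightarrow> h t \<in> X" by (simp add: strongly_measurable_def)

lemma SM_approx:
  assumes "SM h"
  obtains S where "\<And>n::nat. finitely_valued {0<..<T} (S n)" "\<And>n t. t \<in> {0<..<T} \<Longrightarrow> S n t \<in> X"
    "AE t in lebesgue_on {0<..<T}. (\<lambda>n. N (\<lambda>x. S n t x - h t x)) \<longlonglongrightarrow> 0"
  using assms unfolding strongly_measurable_def simple_valued_iff by (meson image_subset_iff)

lemma SM_I:
  assumes "\<And>t. t \<in> {0<..<T} \<Longrightarrow> h t \<in> X" "\<And>n::nat. finitely_valued {0<..<T} (S n)" "\<And>n t. t \<in> {0<..<T} \<Longrightarrow> S n t \<in> X"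
    "AE t in lebesgue_on {0<..<T}. (\<lambda>n. N (\<lambda>x. S n t x - h t x)) \<longlonglongrightarrow> 0"
  shows "SM h"
  using assms unfolding strongly_measurable_def simple_valued_iff by (meson image_subsetI)

lemma AE_I: "(\<And>t. t \<in> {0<..<T} \<Longrightarrow> P t) \<Longrightarrow> AE t in lebesgue_on {0<..<T}. P t"
  by (rule AE_I2) simp

text \<open>Along the approximating simple functions the values of \<open>G\<close> are finitely
  valued, and the Lipschitz bound makes them converge almost everywhere. Norms, inner products with
  a fixed vector and coefficient errors are all of this kind.\<close>

lemma SM_Lipschitz_measurable:
  assumes "SM h" and G: "\<And>a b. a \<in> X \<Longrightarrow> b \<in> X \<Longrightarrow> \<bar>G a - G b\<bar> \<le> C * N (\<lambda>x. a x - b x)"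
  shows "(\<lambda>t. G (h t) :: real) \<in> borel_measurable (lebesgue_on {0<..<T})"
proof -
  obtain S where S: "\<And>n::nat. finitely_valued {0<..<T} (S n)" "\<And>n t. t \<in> {0<..<T} \<Longrightarrow> S n t \<in> X"
    "AE t in lebesgue_on {0<..<T}. (\<lambda>n. N (\<lambda>x. S n t x - h t x)) \<longlonglongrightarrow> 0"
    using SM_approx[OF assms(1)] by blast
  show ?thesis
  proof (rule borel_measurable_lebesgue_on_limit)
    show "(\<lambda>t. G (S n t)) \<in> borel_measurable (lebesgue_on {0<..<T})" for n
      by (rule finitely_valued_measurable[OF S(1)]) simp
    show "AE t in lebesgue_on {0<..<T}. (\<lambda>n. G (S n t)) \<longlonglongrightarrow> G (h t)"
      using S(3) AE_space
    proof eventually_elim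
      case (elim t)
      then have t: "t \<in> {0<..<T}" by simp
      show ?case
      proof (rule LIM_zero_cancel, rule Lim_null_comparison)
        show "\<forall>\<^sub>F n in sequentially. norm (G (S n t) - G (h t)) \<le> C * N (\<lambda>x. S n t x - h t x)"
          using G[OF S(2)[OF t] SM_mem[OF assms(1) t]] by simp
        show "(\<lambda>n. C * N (\<lambda>x. S n t x - h t x)) \<longlonglongrightarrow> 0"
          by (rule tendsto_mult_right_zero[OF elim(1)])
      qed
    qed
  qed simp
qed

lemma ip_Lipschitz: "a \<in> X \<Longrightarrow> b \<in> X \<Longrightarrow> w \<in> X \<Longrightarrow> \<bar>ip a w - ip b w\<bar> \<le> N w * N (\<lambda>x. a x - b x)"
  using Cauchy_Schwarz[OF diff_mem, of a b w] ip_diff[of a b w] by (simp add: mult.commute)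

lemma SM_ip_measurable:
  assumes "SM h" "w \<in> X" shows "(\<lambda>t. ip (h t) w) \<in> borel_measurable (lebesgue_on {0<..<T})"
  using assms(1) ip_Lipschitz[OF _ _ assms(2)] by (rule SM_Lipschitz_measurable)

lemma SM_N_measurable: "SM h \<Longrightarrow> (\<lambda>t. N (h t)) \<in> borel_measurable (lebesgue_on {0<..<T})"
  by (erule SM_Lipschitz_measurable[where C=1]) (simp add: N_abs_diff)

text \<open>Two arguments, so that differences of functions and maps of velocity and displacement
  together are covered by one statement.\<close>

lemma SM_map2:
  assumes h: "SM h1" "SM h2" and F: "\<And>a b. a \<in> X \<Longrightarrow> b \<in> X \<Longrightarrow> F a b \<in> X"
    and L: "\<And>a b a' b'. a \<in> X \<Longrightarrow> b \<in> X \<Longrightarrow> a' \<in> X \<Longrightarrow> b' \<in> X \<Longrightarrow>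
       N (\<lambda>x. F a b x - F a' b' x) \<le> C * (N (\<lambda>x. a x - a' x) + N (\<lambda>x. b x - b' x))"
  shows "SM (\<lambda>t. F (h1 t) (h2 t))"
proof -
  obtain S where S: "\<And>n::nat. finitely_valued {0<..<T} (S n)" "\<And>n t. t \<in> {0<..<T} \<Longrightarrow> S n t \<in> X"
    "AE t in lebesgue_on {0<..<T}. (\<lambda>n. N (\<lambda>x. S n t x - h1 t x)) \<longlonglongrightarrow> 0"
    using SM_approx[OF h(1)] by blast
  obtain R where R: "\<And>n::nat. finitely_valued {0<..<T} (R n)" "\<And>n t. t \<in> {0<..<T} \<Longrightarrow> R n t \<in> X"
    "AE t in lebesgue_on {0<..<T}. (\<lambda>n. N (\<lambda>x. R n t x - h2 t x)) \<longlonglongrightarrow> 0"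
    using SM_approx[OF h(2)] by blast
  show ?thesis
  proof (rule SM_I)
    show "finitely_valued {0<..<T} (\<lambda>t. F (S n t) (R n t))" for n
      by (rule finitely_valued_map2[OF S(1) R(1)])
    show "AE t in lebesgue_on {0<..<T}. (\<lambda>n. N (\<lambda>x. F (S n t) (R n t) x - F (h1 t) (h2 t) x)) \<longlonglongrightarrow> 0"
      using S(3) R(3) AE_space
    proof eventually_elim
      case (elim t)
      then have t: "t \<in> {0<..<T}" by simp
      note m = S(2)[OF t] R(2)[OF t] SM_mem[OF h(1) t] SM_mem[OF h(2) t]
      show ?case
      proof (rule Lim_null_comparison)
        show "\<forall>\<^sub>F n in sequentially. norm (N (\<lambda>x. F (S n t) (R n t) x - F (h1 t) (h2 t) x)) \<le>
            C * (N (\<lambda>x. S n t x - h1 t x) + N (\<lambda>x. R n t x - h2 t x))"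
          using L[OF m] N_nonneg[OF diff_mem[OF F[OF m(1,2)] F[OF m(3,4)]]] by simp
        show "(\<lambda>n. C * (N (\<lambda>x. S n t x - h1 t x) + N (\<lambda>x. R n t x - h2 t x))) \<longlonglongrightarrow> 0"
          using tendsto_mult_right_zero[OF tendsto_add_zero[OF elim(1,2)]] .
      qed
    qed
  qed (use S R h F SM_mem in auto)
qed

lemma SM_diff:
  assumes "SM a" "SM b" shows "SM (\<lambda>t x. a t x - b t x)"
proof (rule SM_map2[OF assms, where F="\<lambda>a b x. a x - b x" and C=1])
  fix a b a' b' assume "a \<in> X" "b \<in> X" "a' \<in> X" "b' \<in> X"
  then show "N (\<lambda>x. a x - b x - (a' x - b' x)) \<le> 1 * (N (\<lambda>x. a x - a' x) + N (\<lambda>x. b x - b' x))"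
    using N_le_add[OF diff_mem diff_mem, of a a' b b'] by (simp add: algebra_simps)
qed (rule diff_mem)

lemma SM_finitely_valued:
  "finitely_valued {0<..<T} s \<Longrightarrow> (\<And>t. t \<in> {0<..<T} \<Longrightarrow> s t \<in> X) \<Longrightarrow> SM s"
  by (rule SM_I[of _ "\<lambda>_. s"]) (use N_zero in auto)

text \<open>Multiplication is not globally Lipschitz, so both factors are approximated and the error
  is split as s (S - h) + (s - \<eta>) h.\<close>

lemma SM_scale:
  assumes h: "SM h" and \<eta>: "\<eta> \<in> borel_measurable (lebesgue_on {0<..<T})"
  shows "SM (\<lambda>t x. \<eta> t * h t x)"
proof -
  obtain S where S: "\<And>n::nat. finitely_valued {0<..<T} (S n)" "\<And>n t. t \<in> {0<..<T} \<Longrightarrow> S n t \<in> X"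
    "AE t in lebesgue_on {0<..<T}. (\<lambda>n. N (\<lambda>x. S n t x - h t x)) \<longlonglongrightarrow> 0"
    using SM_approx[OF h] by blast
  obtain s where s: "\<And>i. simple_function (lebesgue_on {0<..<T}) (s i)"
    "\<And>x. x \<in> space (lebesgue_on {0<..<T}) \<Longrightarrow> (\<lambda>i. s i x) \<longlonglongrightarrow> \<eta> x"
    using borel_measurable_implies_sequence_metric[OF \<eta>, of 0] by blast
  show ?thesis
  proof (rule SM_I)
    show "finitely_valued {0<..<T} (\<lambda>t x. s n t * S n t x)" for n
      by (rule finitely_valued_map2[where F="\<lambda>a b x. a * b x", OF finitely_valued_simple_function[OF s(1)] S(1)]) simp
    show "AE t in lebesgue_on {0<..<T}. (\<lambda>n. N (\<lambda>x. s n t * S n t x - \<eta> t * h t x)) \<longlonglongrightarrow> 0"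
      using S(3) AE_space
    proof eventually_elim
      case (elim t)
      then have t: "t \<in> {0<..<T}" by simp
      note m = S(2)[OF t] SM_mem[OF h t]
      show ?case
      proof (rule Lim_null_comparison)
        have "N (\<lambda>x. s n t * S n t x - \<eta> t * h t x) \<le>
            \<bar>s n t\<bar> * N (\<lambda>x. S n t x - h t x) + \<bar>s n t - \<eta> t\<bar> * N (h t)" for n
          using N_triangle[OF scale_mem[OF diff_mem[OF m]] scale_mem[OF m(2)], of "s n t" n "s n t - \<eta> t"]
            N_scale[OF diff_mem[OF m], of "s n t" n] N_scale[OF m(2), of "s n t - \<eta> t"]
          by (simp add: algebra_simps)
        then show "\<forall>\<^sub>F n in sequentially. norm (N (\<lambda>x. s n t * S n t x - \<eta> t * h t x)) \<le>
            \<bar>s n t\<bar> * N (\<lambda>x. S n t x - h t x) + \<bar>s n t - \<eta> t\<bar> * N (h t)"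
          using N_nonneg[OF diff_mem[OF scale_mem[OF m(1)] scale_mem[OF m(2)]]] by simp
        have st: "(\<lambda>n. s n t) \<longlonglongrightarrow> \<eta> t" using s(2) elim by blast
        have "(\<lambda>n. \<bar>s n t\<bar> * N (\<lambda>x. S n t x - h t x) + \<bar>s n t - \<eta> t\<bar> * N (h t)) \<longlonglongrightarrow>
           \<bar>\<eta> t\<bar> * 0 + \<bar>\<eta> t - \<eta> t\<bar> * N (h t)"
          by (intro tendsto_intros st elim)
        then show "(\<lambda>n. \<bar>s n t\<bar> * N (\<lambda>x. S n t x - h t x) + \<bar>s n t - \<eta> t\<bar> * N (h t)) \<longlonglongrightarrow> 0" by simp
      qed
    qed
  qed (use S h SM_mem scale_mem in auto)
qed

definition CX :: "(real \<Rightarrow> real \<Rightarrow> real) \<Rightarrow> bool" where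
  "CX u \<longleftrightarrow> (\<forall>t\<in>{0..T}. u t \<in> X \<and> ((\<lambda>s. N (\<lambda>x. u s x - u t x)) \<longlongrightarrow> 0) (at t within {0..T}))"

lemma CX_mem: "CX u \<Longrightarrow> t \<in> {0..T} \<Longrightarrow> u t \<in> X" by (simp add: CX_def)

lemma CX_Lipschitz_continuous:
  assumes "CX u" and G: "\<And>a b. a \<in> X \<Longrightarrow> b \<in> X \<Longrightarrow> \<bar>G a - G b\<bar> \<le> C * N (\<lambda>x. a x - b x)"
  shows "continuous_on {0..T} (\<lambda>t. G (u t) :: real)"
  unfolding continuous_on_def
proof
  fix t assume t: "t \<in> {0..T}"
  show "((\<lambda>t. G (u t)) \<longlongrightarrow> G (u t)) (at t within {0..T})"
  proof (rule LIM_zero_cancel, rule Lim_null_comparison)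
    show "\<forall>\<^sub>F s in at t within {0..T}. norm (G (u s) - G (u t)) \<le> C * N (\<lambda>x. u s x - u t x)"
      unfolding eventually_at_filter
    proof (intro always_eventually allI impI)
      fix s assume "s \<in> {0..T}"
      then show "norm (G (u s) - G (u t)) \<le> C * N (\<lambda>x. u s x - u t x)"
        using G CX_mem[OF assms(1)] t by simp
    qed
    have "((\<lambda>s. N (\<lambda>x. u s x - u t x)) \<longlongrightarrow> 0) (at t within {0..T})"
      using assms t by (simp add: CX_def)
    then show "((\<lambda>s. C * N (\<lambda>x. u s x - u t x)) \<longlongrightarrow> 0) (at t within {0..T})"
      by (rule tendsto_mult_right_zero)
  qed
qed

lemma CX_ip_continuous:
  assumes "CX u" "w \<in> X" shows "continuous_on {0..T} (\<lambda>t. ip (u t) w)"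
  using assms(1) ip_Lipschitz[OF _ _ assms(2)] by (rule CX_Lipschitz_continuous)

lemma CX_N_continuous: "CX u \<Longrightarrow> continuous_on {0..T} (\<lambda>t. N (u t))"
  by (erule CX_Lipschitz_continuous[where C=1]) (simp add: N_abs_diff)

text \<open>The function is sampled on a grid of width 1/(n+1). Rounding down keeps the sample
  points in [0, T], and continuity gives convergence at every time.\<close>

lemma CX_SM:
  assumes "CX u" shows "SM u"
proof (rule SM_I)
  let ?r = "\<lambda>n t. real_of_int \<lfloor>real (Suc n) * t\<rfloor> / real (Suc n)"
  have r: "?r n t \<in> {0..T}" if "t \<in> {0<..<T}" for n t
  proof -
    have "real_of_int \<lfloor>real (Suc n) * t\<rfloor> \<le> real (Suc n) * t" by (rule of_int_floor_le)
    then have "?r n t \<le> t" by (simp add: divide_le_eq mult.commute)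
    moreover have "0 \<le> ?r n t" using that by simp
    ultimately show ?thesis using that by simp
  qed
  show "finitely_valued {0<..<T} (\<lambda>t. u (?r n t))" for n
    by (rule finitely_valued_map[OF finitely_valued_floor[of T "Suc n"], of "\<lambda>k. u (real_of_int k / real (Suc n))"])
  show "u (?r n t) \<in> X" if "t \<in> {0<..<T}" for n t using r[OF that] CX_mem[OF assms] by blast
  show "u t \<in> X" if "t \<in> {0<..<T}" for t using that CX_mem[OF assms] by simp
  show "AE t in lebesgue_on {0<..<T}. (\<lambda>n. N (\<lambda>x. u (?r n t) x - u t x)) \<longlonglongrightarrow> 0"
  proof (rule AE_I)
    fix t assume t: "t \<in> {0<..<T}"
    have "(\<lambda>n. ?r n t) \<longlonglongrightarrow> t"
    proof (rule LIM_zero_cancel, rule Lim_null_comparison[OF _ LIMSEQ_inverse_real_of_nat])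
      have "norm (?r n t - t) \<le> inverse (real (Suc n))" for n
      proof -
        have "real (Suc n) * t - 1 \<le> real_of_int \<lfloor>real (Suc n) * t\<rfloor>" "real_of_int \<lfloor>real (Suc n) * t\<rfloor> \<le> real (Suc n) * t"
          by linarith+
        then have "\<bar>real_of_int \<lfloor>real (Suc n) * t\<rfloor> - real (Suc n) * t\<bar> \<le> 1" by linarith
        moreover have "?r n t - t = (real_of_int \<lfloor>real (Suc n) * t\<rfloor> - real (Suc n) * t) / real (Suc n)"
          by (simp add: field_simps)
        ultimately show ?thesis by (simp add: abs_divide divide_right_mono inverse_eq_divide del: of_nat_Suc)
      qed
      then show "\<forall>\<^sub>F n in sequentially. norm (?r n t - t) \<le> inverse (real (Suc n))" by simp
    qed
    moreover have "continuous (at t within {0..T}) (\<lambda>s. N (\<lambda>x. u s x - u t x))"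
      using assms t N_zero unfolding continuous_within CX_def by simp
    ultimately have "(\<lambda>n. N (\<lambda>x. u (?r n t) x - u t x)) \<longlonglongrightarrow> N (\<lambda>x. u t x - u t x)"
      using r[OF t] unfolding continuous_within_sequentially comp_def
      by (elim allE[of _ "\<lambda>n. ?r n t"] impE) auto
    then show "(\<lambda>n. N (\<lambda>x. u (?r n t) x - u t x)) \<longlonglongrightarrow> 0" using N_zero by simp
  qed
qed

text \<open>Tested with a fixed \<open>w\<close>, vector integrals become Lebesgue integrals of real
  functions; the general Bochner integral is reduced to this case by limits.\<close>

lemma simple_integral_ip:
  assumes S: "finitely_valued {0<..<T} S" "\<And>t. t \<in> {0<..<T} \<Longrightarrow> S t \<in> X" and w: "w \<in> X"
  shows "simple_integral {0<..<T} S \<in> X" "integrable (lebesgue_on {0<..<T}) (\<lambda>t. ip (S t) w)"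
    "ip (simple_integral {0<..<T} S) w = (LINT t|lebesgue_on {0<..<T}. ip (S t) w)"
proof -
  let ?m = "\<lambda>g. measure lebesgue {t \<in> {0<..<T}. S t = g}"
  have fin: "finite (S ` {0<..<T})" and sets: "\<And>g. {t \<in> {0<..<T}. S t = g} \<in> sets lebesgue"
    using S(1) by (auto simp: finitely_valued_def)
  show "simple_integral {0<..<T} S \<in> X"
    unfolding simple_integral_def by (rule sum_mem) (use S in auto)
  have eq: "ip (S t) w = (\<Sum>g\<in>S ` {0<..<T}. indicator {t \<in> {0<..<T}. S t = g} t *\<^sub>R ip g w)" if "t \<in> {0<..<T}" for t
  proof -
    have "(\<Sum>g\<in>S ` {0<..<T}. indicator {t \<in> {0<..<T}. S t = g} t *\<^sub>R ip g w) = (\<Sum>g\<in>S ` {0<..<T}. if S t = g then ip g w else 0)"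
      using that by (intro sum.cong) (auto simp: indicator_def)
    then show ?thesis using fin that by simp
  qed
  have s': "{t \<in> {0<..<T}. S t = g} \<in> sets (lebesgue_on {0<..<T})" for g
    using sets[of g] by (subst sets_restrict_space_iff) auto
  interpret finite_measure "lebesgue_on {0<..<T}" by (rule finite_measure_lebesgue_on) simp
  have ii: "integrable (lebesgue_on {0<..<T}) (\<lambda>t. indicator {t \<in> {0<..<T}. S t = g} t *\<^sub>R ip g w)" for g
    using s'[of g] by (intro integrable_indicator) (simp_all add: less_top[symmetric] emeasure_finite)
  have "integrable (lebesgue_on {0<..<T}) (\<lambda>t. \<Sum>g\<in>S ` {0<..<T}. indicator {t \<in> {0<..<T}. S t = g} t *\<^sub>R ip g w)"
    by (rule Bochner_Integration.integrable_sum) (rule ii)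
  then show "integrable (lebesgue_on {0<..<T}) (\<lambda>t. ip (S t) w)"
    by (subst Bochner_Integration.integrable_cong[OF refl eq]) auto
  have "(LINT t|lebesgue_on {0<..<T}. ip (S t) w) = (LINT t|lebesgue_on {0<..<T}. (\<Sum>g\<in>S ` {0<..<T}. indicator {t \<in> {0<..<T}. S t = g} t *\<^sub>R ip g w))"
    by (intro Bochner_Integration.integral_cong eq) auto
  also have "\<dots> = (\<Sum>g\<in>S ` {0<..<T}. LINT t|lebesgue_on {0<..<T}. indicator {t \<in> {0<..<T}. S t = g} t *\<^sub>R ip g w)"
    by (rule Bochner_Integration.integral_sum) (rule ii)
  also have "\<dots> = (\<Sum>g\<in>S ` {0<..<T}. ?m g * ip g w)"
  proof (rule sum.cong[OF refl])
    fix g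
    have "(LINT t|lebesgue_on {0<..<T}. indicator {t \<in> {0<..<T}. S t = g} t *\<^sub>R ip g w) = measure (lebesgue_on {0<..<T}) {t \<in> {0<..<T}. S t = g} * ip g w"
      using has_bochner_integral_integral_eq[OF has_bochner_integral_indicator[OF s'[of g], of "ip g w"]]
      by (simp add: less_top[symmetric] emeasure_finite)
    also have "measure (lebesgue_on {0<..<T}) {t \<in> {0<..<T}. S t = g} = ?m g" by (rule measure_restrict_space) auto
    finally show "(LINT t|lebesgue_on {0<..<T}. indicator {t \<in> {0<..<T}. S t = g} t *\<^sub>R ip g w) = ?m g * ip g w" .
  qed
  also have "\<dots> = ip (simple_integral {0<..<T} S) w"
    unfolding simple_integral_def by (rule ip_sum[symmetric]) (use S w in auto)
  finally show "ip (simple_integral {0<..<T} S) w = (LINT t|lebesgue_on {0<..<T}. ip (S t) w)" ..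
qed

text \<open>For the simple approximants the tested error is at most \<open>N w\<close> times the
  integral of the norm of S n - h, which tends to zero. Later arguments identify Bochner integrals
  by these inner products.\<close>

lemma bochner_ip:
  assumes hb: "has_bochner {0<..<T} X N h J" and int: "integrable (lebesgue_on {0<..<T}) (\<lambda>t. N (h t))" and w: "w \<in> X"
  shows "integrable (lebesgue_on {0<..<T}) (\<lambda>t. ip (h t) w)" "ip J w = (LINT t|lebesgue_on {0<..<T}. ip (h t) w)"
proof -
  let ?M = "lebesgue_on {0<..<T}"
  have h: "SM h" and J: "J \<in> X" using hb by (auto simp: has_bochner_def)
  obtain S where S: "\<And>n. simple_valued {0<..<T} X (S n)"
    "(\<lambda>n. \<integral>\<^sup>+ t. ennreal (N (\<lambda>x. S n t x - h t x)) \<partial>?M) \<longlonglongrightarrow> 0"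
    "(\<lambda>n. N (\<lambda>x. simple_integral {0<..<T} (S n) x - J x)) \<longlonglongrightarrow> 0"
    using hb unfolding has_bochner_def by blast
  have f: "finitely_valued {0<..<T} (S n)" and m: "t \<in> {0<..<T} \<Longrightarrow> S n t \<in> X" for n t
    using S(1) by (auto simp: simple_valued_iff image_subset_iff)
  note si = simple_integral_ip[OF f m w]
  show ih: "integrable ?M (\<lambda>t. ip (h t) w)"
  proof (rule Bochner_Integration.integrable_bound)
    show "integrable ?M (\<lambda>t. N (h t) * N w)" using int by simp
    show "(\<lambda>t. ip (h t) w) \<in> borel_measurable ?M" by (rule SM_ip_measurable[OF h w])
    show "AE t in ?M. norm (ip (h t) w) \<le> norm (N (h t) * N w)"
    proof (rule AE_I)
      fix t assume t: "t \<in> {0<..<T}"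
      show "norm (ip (h t) w) \<le> norm (N (h t) * N w)"
        using Cauchy_Schwarz[OF SM_mem[OF h t] w] by simp
    qed
  qed
  have "(\<lambda>n. LINT t|?M. ip (S n t) w) \<longlonglongrightarrow> (LINT t|?M. ip (h t) w)"
  proof (rule LIM_zero_cancel, rule tendsto_norm_zero_cancel)
    have le: "ennreal (norm ((LINT t|?M. ip (S n t) w) - (LINT t|?M. ip (h t) w)))
       \<le> ennreal (N w) * (\<integral>\<^sup>+ t. ennreal (N (\<lambda>x. S n t x - h t x)) \<partial>?M)" for n
    proof -
      have id: "integrable ?M (\<lambda>t. ip (S n t) w - ip (h t) w)" by (intro Bochner_Integration.integrable_diff si ih)
      have "(LINT t|?M. ip (S n t) w) - (LINT t|?M. ip (h t) w) = (LINT t|?M. ip (S n t) w - ip (h t) w)"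
        by (rule Bochner_Integration.integral_diff[symmetric, OF si(2) ih])
      then have "ennreal (norm ((LINT t|?M. ip (S n t) w) - (LINT t|?M. ip (h t) w))) \<le> (\<integral>\<^sup>+ t. ennreal (norm (ip (S n t) w - ip (h t) w)) \<partial>?M)"
        using integral_norm_bound_ennreal[OF id] by simp
      also have "\<dots> \<le> (\<integral>\<^sup>+ t. ennreal (N w) * ennreal (N (\<lambda>x. S n t x - h t x)) \<partial>?M)"
      proof (rule nn_integral_mono)
        fix t assume "t \<in> space ?M"
        then have t: "t \<in> {0<..<T}" by simp
        have "norm (ip (S n t) w - ip (h t) w) \<le> N w * N (\<lambda>x. S n t x - h t x)"
          using Cauchy_Schwarz[OF diff_mem[OF m[OF t] SM_mem[OF h t]] w, of n] ip_diff[OF m[OF t] SM_mem[OF h t] w, of n]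
          by (simp add: mult.commute)
        then show "ennreal (norm (ip (S n t) w - ip (h t) w)) \<le> ennreal (N w) * ennreal (N (\<lambda>x. S n t x - h t x))"
          using N_nonneg[OF w] N_nonneg[OF diff_mem[OF m[OF t] SM_mem[OF h t]]]
          by (simp add: ennreal_mult[symmetric] ennreal_leI)
      qed
      also have "\<dots> = ennreal (N w) * (\<integral>\<^sup>+ t. ennreal (N (\<lambda>x. S n t x - h t x)) \<partial>?M)"
      proof (rule nn_integral_cmult)
        show "(\<lambda>t. ennreal (N (\<lambda>x. S n t x - h t x))) \<in> borel_measurable ?M"
          by (intro measurable_compose[OF _ measurable_ennreal] SM_N_measurable SM_diff SM_finitely_valued f m h)
      qed
      finally show ?thesis .
    qed
    have "(\<lambda>n. ennreal (N w) * (\<integral>\<^sup>+ t. ennreal (N (\<lambda>x. S n t x - h t x)) \<partial>?M)) \<longlonglongrightarrow> ennreal (N w) * 0"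
      by (rule ennreal_tendsto_cmult[OF _ S(2)]) simp
    then have "(\<lambda>n. ennreal (norm ((LINT t|?M. ip (S n t) w) - (LINT t|?M. ip (h t) w)))) \<longlonglongrightarrow> ennreal 0"
      by (intro tendsto_sandwich[OF _ always_eventually[OF allI[OF le]] tendsto_const]) auto
    then show "(\<lambda>n. norm ((LINT t|?M. ip (S n t) w) - (LINT t|?M. ip (h t) w))) \<longlonglongrightarrow> 0"
      by (subst (asm) tendsto_ennreal_iff) auto
  qed
  moreover have "(\<lambda>n. LINT t|?M. ip (S n t) w) \<longlonglongrightarrow> ip J w"
    using tendsto_ip[OF si(1) J w S(3)] si(3) by simp
  ultimately show "ip J w = (LINT t|?M. ip (h t) w)" by (rule LIMSEQ_unique[symmetric])
qed

text \<open>Truncated simple approximants are dominated by a multiple of N (h t), so their distance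
  to \<open>h\<close> tends to zero in the integral. Their simple integrals then form a Cauchy
  sequence, and completeness supplies the limit.\<close>

lemma bochner_ex:
  assumes h: "SM h" and int: "integrable (lebesgue_on {0<..<T}) (\<lambda>t. N (h t))"
  shows "\<exists>J. has_bochner {0<..<T} X N h J"
proof -
  let ?M = "lebesgue_on {0<..<T}"
  obtain R where R: "\<And>n::nat. finitely_valued {0<..<T} (R n)" "\<And>n t. t \<in> {0<..<T} \<Longrightarrow> R n t \<in> X"
    "AE t in ?M. (\<lambda>n. N (\<lambda>x. R n t x - h t x)) \<longlonglongrightarrow> 0"
    using SM_approx[OF h] by blast
  \<comment> \<open>Where N (R n t) exceeds 2 N (h t), the error of R n t is at least N (h t), which
    is the error of the zero function. So truncation never increases the error, and the error is at
    most 3 N (h t) everywhere.\<close>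
  define S where "S n t = (if N (R n t) \<le> 2 * N (h t) then R n t else (\<lambda>x. 0))" for n t
  have Sm: "S n t \<in> X" if "t \<in> {0<..<T}" for n t using R(2)[OF that] zero_mem by (simp add: S_def)
  have Sf: "finitely_valued {0<..<T} (S n)" for n
  proof -
    have [measurable]: "(\<lambda>t. N (R n t)) \<in> borel_measurable ?M" "(\<lambda>t. N (h t)) \<in> borel_measurable ?M"
      by (rule finitely_valued_measurable[OF R(1)], simp) (rule SM_N_measurable[OF h])
    have "{t \<in> space ?M. N (R n t) \<le> 2 * N (h t)} \<in> sets ?M" by measurable
    then have "finitely_valued {0<..<T} (\<lambda>t. N (R n t) \<le> 2 * N (h t))"
      by (intro finitely_valued_predicate) (simp_all add: sets_restrict_space_iff)
    from finitely_valued_map2[OF this R(1), of "\<lambda>b a. if b then a else (\<lambda>x. 0)" n]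
    show ?thesis by (simp add: S_def[abs_def])
  qed
  have SMd: "SM (\<lambda>t x. S n t x - h t x)" for n
    by (intro SM_diff SM_finitely_valued Sf Sm h)
  have bounds: "N (\<lambda>x. S n t x - h t x) \<le> N (\<lambda>x. R n t x - h t x)" "N (\<lambda>x. S n t x - h t x) \<le> 3 * N (h t)"
    "0 \<le> N (\<lambda>x. S n t x - h t x)" if t: "t \<in> {0<..<T}" for n t
  proof -
    note m = R(2)[OF t] SM_mem[OF h t]
    show "0 \<le> N (\<lambda>x. S n t x - h t x)" by (rule N_nonneg[OF diff_mem[OF Sm[OF t] m(2)]])
    show "N (\<lambda>x. S n t x - h t x) \<le> N (\<lambda>x. R n t x - h t x)"
      using N_triangle_diff[OF m, of n] N_minus[OF m(2)] by (auto simp: S_def)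
    show "N (\<lambda>x. S n t x - h t x) \<le> 3 * N (h t)"
      using N_le_add[OF m, of n] N_minus[OF m(2)] N_nonneg[OF m(2)] by (auto simp: S_def)
  qed
  have id: "integrable ?M (\<lambda>t. N (\<lambda>x. S n t x - h t x))" for n
  proof (rule Bochner_Integration.integrable_bound)
    show "integrable ?M (\<lambda>t. 3 * N (h t))" using int by simp
    show "(\<lambda>t. N (\<lambda>x. S n t x - h t x)) \<in> borel_measurable ?M" by (rule SM_N_measurable[OF SMd])
    show "AE t in ?M. norm (N (\<lambda>x. S n t x - h t x)) \<le> norm (3 * N (h t))"
    proof (rule AE_I)
      fix t assume t: "t \<in> {0<..<T}"
      show "norm (N (\<lambda>x. S n t x - h t x)) \<le> norm (3 * N (h t))"
        using bounds(2,3)[OF t, of n] unfolding real_norm_def by linarith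
    qed
  qed
  have lim: "(\<lambda>n. LINT t|?M. N (\<lambda>x. S n t x - h t x)) \<longlonglongrightarrow> (LINT t|?M. 0)"
  proof (rule integral_dominated_convergence[where w="\<lambda>t. 3 * N (h t)"])
    show "integrable ?M (\<lambda>t. 3 * N (h t))" using int by simp
    show "(\<lambda>t. N (\<lambda>x. S n t x - h t x)) \<in> borel_measurable ?M" for n by (rule SM_N_measurable[OF SMd])
    show "AE t in ?M. norm (N (\<lambda>x. S n t x - h t x)) \<le> 3 * N (h t)" for n
      by (rule AE_I) (use bounds(2,3) in simp)
    show "AE t in ?M. (\<lambda>n. N (\<lambda>x. S n t x - h t x)) \<longlonglongrightarrow> 0"
      using R(3) AE_space
    proof eventually_elim
      case (elim t)
      then have t: "t \<in> {0<..<T}" by simp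
      show ?case by (rule Lim_null_comparison[OF _ elim(1)]) (use bounds[OF t] in simp)
    qed
  qed simp
  let ?e = "\<lambda>n. LINT t|?M. N (\<lambda>x. S n t x - h t x)"
  let ?J = "\<lambda>n. simple_integral {0<..<T} (S n)"
  have JX: "?J n \<in> X" for n by (rule simple_integral_ip(1)[OF Sf Sm zero_mem])
  \<comment> \<open>The integrals are accessible through inner products only, so the difference is
    tested with itself and one factor of its norm is cancelled at the end.\<close>
  have Jd: "N (\<lambda>x. ?J n x - ?J m x) \<le> ?e n + ?e m" for n m
  proof -
    let ?d = "\<lambda>x. ?J n x - ?J m x"
    have d: "?d \<in> X" by (rule diff_mem[OF JX JX])
    note si = simple_integral_ip(2,3)[OF Sf Sm d]
    have e0: "0 \<le> ?e n + ?e m" using bounds(3) by (intro add_nonneg_nonneg integral_nonneg_AE AE_I) auto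
    have "(N ?d)\<^sup>2 = ip (?J n) ?d - ip (?J m) ?d" using N_sq[OF d] ip_diff[OF JX JX d] by simp
    also have "\<dots> = (LINT t|?M. ip (S n t) ?d - ip (S m t) ?d)"
      using si by simp
    also have "\<dots> \<le> (LINT t|?M. (N (\<lambda>x. S n t x - h t x) + N (\<lambda>x. S m t x - h t x)) * N ?d)"
    proof (rule integral_mono)
      show "integrable ?M (\<lambda>t. ip (S n t) ?d - ip (S m t) ?d)" using si by simp
      show "integrable ?M (\<lambda>t. (N (\<lambda>x. S n t x - h t x) + N (\<lambda>x. S m t x - h t x)) * N ?d)" using id by simp
      fix t assume "t \<in> space ?M"
      then have t: "t \<in> {0<..<T}" by simp
      have "ip (S n t) ?d - ip (S m t) ?d \<le> N (\<lambda>x. S n t x - S m t x) * N ?d"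
        using Cauchy_Schwarz[OF diff_mem[OF Sm[OF t] Sm[OF t]] d, of n m] ip_diff[OF Sm[OF t] Sm[OF t] d, of n m] by simp
      also have "\<dots> \<le> (N (\<lambda>x. S n t x - h t x) + N (\<lambda>x. S m t x - h t x)) * N ?d"
        using N_diff_triangle[OF Sm[OF t] SM_mem[OF h t] Sm[OF t], of n m] N_commute[OF Sm[OF t] SM_mem[OF h t], of m]
        by (intro mult_right_mono N_nonneg[OF d]) simp
      finally show "ip (S n t) ?d - ip (S m t) ?d \<le> (N (\<lambda>x. S n t x - h t x) + N (\<lambda>x. S m t x - h t x)) * N ?d" .
    qed
    also have "\<dots> = (?e n + ?e m) * N ?d" using id by simp
    finally have "N ?d * N ?d \<le> (?e n + ?e m) * N ?d" by (simp add: power2_eq_square)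
    then show ?thesis using N_nonneg[OF d] e0 by (cases "N ?d = 0") (auto simp: mult_le_cancel_right)
  qed
  have e0: "?e \<longlonglongrightarrow> 0" using lim by simp
  have "\<exists>J\<in>X. (\<lambda>n. N (\<lambda>x. ?J n x - J x)) \<longlonglongrightarrow> 0"
  proof (rule complete[OF JX])
    fix e :: real assume "0 < e"
    then obtain M where M: "\<And>n. n \<ge> M \<Longrightarrow> \<bar>?e n\<bar> < e / 2"
      using LIMSEQ_D[OF e0, of "e/2"] by auto
    have "N (\<lambda>x. ?J m x - ?J n x) < e" if "m \<ge> M" "n \<ge> M" for m n
      using Jd[of m n] M[OF that(1)] M[OF that(2)] by linarith
    then show "\<exists>M. \<forall>m\<ge>M. \<forall>n\<ge>M. N (\<lambda>x. ?J m x - ?J n x) < e" by blast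
  qed
  then obtain J where J: "J \<in> X" "(\<lambda>n. N (\<lambda>x. ?J n x - J x)) \<longlonglongrightarrow> 0" by blast
  have "(\<integral>\<^sup>+ t. ennreal (N (\<lambda>x. S n t x - h t x)) \<partial>?M) = ennreal (?e n)" for n
    by (rule nn_integral_eq_integral[OF id]) (use bounds(3) in \<open>auto intro: AE_I\<close>)
  then have "(\<lambda>n. \<integral>\<^sup>+ t. ennreal (N (\<lambda>x. S n t x - h t x)) \<partial>?M) \<longlonglongrightarrow> 0"
    using tendsto_ennrealI[OF e0] by simp
  moreover have "simple_valued {0<..<T} X (S n)" for n
    using Sf Sm by (auto simp: simple_valued_iff)
  ultimately have "has_bochner {0<..<T} X N h J"
    unfolding has_bochner_def using h J by blast
  then show ?thesis by blast
qed

end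

section \<open>Weak integrals and weak time derivatives\<close>

lemma prim_mono:
  assumes "a \<in> L2 \<Lambda>" "b \<in> L2 \<Lambda>" "AE x in dom_measure \<Lambda>. a x \<le> b x"
  shows "prim \<Lambda> a t \<le> prim \<Lambda> b t"
  unfolding prim_def L2_inner_def
proof (rule integral_mono_AE)
  show "AE x in dom_measure \<Lambda>. a x * indicator {..t} x \<le> b x * indicator {..t} x"
    using assms(3) by eventually_elim (simp add: indicator_def)
qed (intro L2_mult_integrable indicator_L2 assms, simp)+

lemma prim_nonneg:
  assumes "AE x in dom_measure \<Lambda>. 0 \<le> a x" shows "0 \<le> prim \<Lambda> a t"
  unfolding prim_def L2_inner_def
  by (rule integral_nonneg_AE) (use assms in \<open>auto simp: indicator_def elim!: eventually_mono\<close>)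

lemma prim_mono_end:
  assumes "a \<in> L2 \<Lambda>" "AE x in dom_measure \<Lambda>. 0 \<le> a x"
  shows "prim \<Lambda> a t \<le> prim \<Lambda> a \<Lambda>"
  unfolding prim_def L2_inner_def
proof (rule integral_mono_AE)
  show "AE x in dom_measure \<Lambda>. a x * indicator {..t} x \<le> a x * indicator {..\<Lambda>} x"
    using assms(2) AE_space by eventually_elim (auto simp: indicator_def)
qed (intro L2_mult_integrable indicator_L2 assms, simp)+

lemma prim_0: "prim \<Lambda> b 0 = 0"
proof -
  have "AE x in dom_measure \<Lambda>. b x * indicator {..0} x = 0"
    using AE_dom_measure_endpoints[of \<Lambda>] by eventually_elim auto
  then show ?thesis unfolding prim_def L2_inner_def by (rule integral_eq_zero_AE)
qed

lemma prim_cmult: "prim \<Lambda> (\<lambda>x. c * a x) t = c * prim \<Lambda> a t"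
  unfolding prim_def L2_inner_def by (simp add: mult.assoc)

lemma prim_exp:
  assumes "K \<noteq> 0" "0 \<le> t" "t \<le> T"
  shows "prim T (\<lambda>s. exp (K * s)) t = (exp (K * t) - 1) / K"
proof -
  have "((\<lambda>s. exp (K * s) / K) has_real_derivative exp (K * s)) (at s)" for s
    using assms(1) by (auto intro!: derivative_eq_intros)
  from prim_FTC[OF this _ assms(2,3)] show ?thesis
    by (simp add: continuous_intros diff_divide_distrib)
qed

text \<open>Let \<open>m\<close> be the maximum of exp(-2Kt) g(t), attained at t'. Inserting g s
  \<le> m exp(2Ks) into the hypothesis at t', the integral of K g is at most half of m exp(2Kt'),
  which the left side absorbs. The weight 2K in place of K produces this half, and with it the
  factor 2 in the bound.\<close>

lemma gronwall:
  assumes T: "0 < T" and K: "0 < K" and g: "continuous_on {0..T} g"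
    and r: "r \<in> L2 T" "AE s in dom_measure T. 0 \<le> r s"
    and le: "\<And>t. t \<in> {0..T} \<Longrightarrow> g t \<le> prim T (\<lambda>s. K * g s + r s) t"
    and t: "t \<in> {0..T}"
  shows "g t \<le> 2 * exp (2 * K * T) * prim T r T"
proof -
  let ?R = "prim T r T"
  have "continuous_on {0..T} (\<lambda>t. exp (- (2 * K * t)) * g t)"
    by (intro continuous_intros g)
  then obtain t' where t': "t' \<in> {0..T}" and max: "\<And>s. s \<in> {0..T} \<Longrightarrow> exp (- (2 * K * s)) * g s \<le> exp (- (2 * K * t')) * g t'"
    using continuous_attains_sup[of "{0..T}" "\<lambda>t. exp (- (2 * K * t)) * g t"] T by auto
  define m where "m = exp (- (2 * K * t')) * g t'"
  have gm: "g s \<le> m * exp (2 * K * s)" if "s \<in> {0..T}" for s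
    using mult_right_mono[OF max[OF that], of "exp (2 * K * s)"]
    by (simp add: m_def mult.commute mult.left_commute exp_minus field_simps)
  have gt': "g t' = m * exp (2 * K * t')" by (simp add: m_def exp_minus field_simps)
  have R0: "0 \<le> ?R" by (rule prim_nonneg[OF r(2)])
  have e1: "1 \<le> exp (2 * K * t')" using K t' by simp
  have gL: "g \<in> L2 T" by (rule L2_continuous[OF g])
  have eL: "(\<lambda>s. exp (2 * K * s)) \<in> L2 T" by (intro L2_continuous continuous_intros)
  have "m \<le> 2 * ?R"
  proof (cases "m \<le> 0")
    case False
    have "g t' \<le> K * prim T g t' + prim T r t'"
      using le[OF t'] prim_lincomb[OF gL r(1), of K 1 t'] by simp
    also have "prim T r t' \<le> ?R" by (rule prim_mono_end[OF r])
    also have "prim T g t' \<le> prim T (\<lambda>s. m * exp (2 * K * s)) t'"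
      by (rule prim_mono[OF gL L2.scale_mem[OF eL]]) (rule AE_I2, use gm in simp)
    also have "prim T (\<lambda>s. m * exp (2 * K * s)) t' = m * ((exp (2 * K * t') - 1) / (2 * K))"
      using prim_exp[of "2 * K" t' T] K t' by (simp add: prim_cmult)
    finally have "g t' \<le> K * (m * ((exp (2 * K * t') - 1) / (2 * K))) + ?R"
      using K by simp
    also have "K * (m * ((exp (2 * K * t') - 1) / (2 * K))) = m * exp (2 * K * t') / 2 - m / 2"
      using K by (simp add: field_simps)
    finally have "m * exp (2 * K * t') \<le> 2 * ?R" using gt' False by linarith
    moreover have "m * 1 \<le> m * exp (2 * K * t')" using False e1 by (intro mult_left_mono) auto
    ultimately show ?thesis by linarith
  qed (use R0 in linarith)
  have "g t \<le> m * exp (2 * K * t)" by (rule gm[OF t])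
  also have "\<dots> \<le> (2 * ?R) * exp (2 * K * T)"
    using \<open>m \<le> 2 * ?R\<close> R0 K t by (intro mult_mono) auto
  finally show ?thesis by (simp add: mult_ac)
qed

text \<open>The set of equality is closed and has full measure in (0, T), so it contains (0, T) and
  by continuity the end points.\<close>

lemma continuous_AE_eq:
  fixes f g :: "real \<Rightarrow> real"
  assumes "0 < T" "continuous_on {0..T} f" "continuous_on {0..T} g" "AE t in dom_measure T. f t = g t" "t \<in> {0..T}"
  shows "f t = g t"
proof -
  have c: "continuous_on {0..T} (\<lambda>t. f t - g t)" by (intro continuous_intros assms)
  let ?C = "{0..T} \<inter> (\<lambda>t. f t - g t) -` {0}"
  have "s \<in> ?C" if "s \<in> {0<..<T}" for s
  proof (rule mem_closed_if_AE_lebesgue_open[of "{0<..<T}" ?C])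
    show "closed ?C" by (rule continuous_closed_preimage[OF c]) auto
    have "AE t in time_measure T. f t = g t" using assms(4) by (simp add: AE_time_iff)
    then have "AE t in lebesgue. t \<in> {0<..<T} \<longrightarrow> f t = g t"
      by (subst (asm) AE_restrict_space_iff) auto
    then show "AE t\<in>{0<..<T} in lebesgue. t \<in> ?C" by eventually_elim auto
  qed (use that in auto)
  moreover have "closure {0<..<T} = {0..T}" using assms(1) by simp
  ultimately have "f t - g t = 0"
    using continuous_constant_on_closure[of "{0<..<T}" "\<lambda>t. f t - g t" 0 t] c assms(5) by auto
  then show ?thesis by simp
qed

text \<open>Cancels one factor of a norm after a difference has been tested with itself, including
  the case that the norm is zero.\<close>

lemma le_if_mult_self_le: "0 \<le> c \<Longrightarrow> 0 \<le> y \<Longrightarrow> c * c \<le> y * c \<Longrightarrow> c \<le> (y::real)"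
  by (cases "c = 0") auto

section \<open>Integral identities tested with fixed vectors\<close>

context bochner_space
begin

definition L2X :: "(real \<Rightarrow> real \<Rightarrow> real) \<Rightarrow> bool" where
  "L2X v \<longleftrightarrow> SM v \<and> (\<lambda>t. N (v t)) \<in> L2 T"

text \<open>The identity u(t) = u0 + integral of v over (0, t), tested with each \<open>w\<close>.
  It fixes \<open>u t\<close> only up to norm zero, so \<open>u 0\<close> and \<open>u0\<close> may
  be different functions.\<close>

definition weak_integral :: "(real \<Rightarrow> real) \<Rightarrow> (real \<Rightarrow> real \<Rightarrow> real) \<Rightarrow> (real \<Rightarrow> real \<Rightarrow> real) \<Rightarrow> bool" where
  "weak_integral u0 v u \<longleftrightarrow>
     (\<forall>t\<in>{0..T}. u t \<in> X \<and> (\<forall>w\<in>X. ip (u t) w = ip u0 w + prim T (\<lambda>s. ip (v s) w) t))"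

lemma AE_dom: "(\<And>t. t \<in> {0<..<T} \<Longrightarrow> P t) \<Longrightarrow> AE t in dom_measure T. P t"
  using AE_I[of P] by (simp add: AE_time_iff)

lemma L2X_SM: "L2X v \<Longrightarrow> SM v" by (simp add: L2X_def)

lemma L2X_mem: "L2X v \<Longrightarrow> t \<in> {0<..<T} \<Longrightarrow> v t \<in> X" by (auto simp: L2X_def SM_mem)

lemma L2X_I:
  assumes "SM v" "g \<in> L2 T" "\<And>t. t \<in> {0<..<T} \<Longrightarrow> N (v t) \<le> g t" shows "L2X v"
proof -
  have "(\<lambda>t. N (v t)) \<in> L2 T"
  proof (rule L2_mono(1)[OF assms(2)])
    show "(\<lambda>t. N (v t)) \<in> borel_measurable (dom_measure T)"
      using SM_N_measurable[OF assms(1)] by (simp add: measurable_time_iff)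
    show "AE t in dom_measure T. \<bar>N (v t)\<bar> \<le> \<bar>g t\<bar>"
      by (rule AE_dom) (use assms(3) N_nonneg SM_mem[OF assms(1)] in fastforce)
  qed
  with assms(1) show ?thesis by (simp add: L2X_def)
qed

lemma L2X_ip:
  assumes "L2X v" "w \<in> X"
  shows "(\<lambda>t. ip (v t) w) \<in> L2 T" "L2_norm T (\<lambda>t. ip (v t) w) \<le> N w * L2_norm T (\<lambda>t. N (v t))"
proof -
  have m: "(\<lambda>t. ip (v t) w) \<in> borel_measurable (dom_measure T)"
    using SM_ip_measurable[OF L2X_SM[OF assms(1)] assms(2)] by (simp add: measurable_time_iff)
  have NL: "(\<lambda>t. N (v t)) \<in> L2 T" using assms by (simp add: L2X_def)
  have b: "AE t in dom_measure T. \<bar>ip (v t) w\<bar> \<le> \<bar>N w * N (v t)\<bar>"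
  proof (rule AE_dom)
    fix t assume "t \<in> {0<..<T}"
    from Cauchy_Schwarz[OF L2X_mem[OF assms(1) this] assms(2)]
    show "\<bar>ip (v t) w\<bar> \<le> \<bar>N w * N (v t)\<bar>" by (simp add: mult.commute)
  qed
  show "(\<lambda>t. ip (v t) w) \<in> L2 T" by (rule L2_mono(1)[OF L2.scale_mem[OF NL] m b])
  show "L2_norm T (\<lambda>t. ip (v t) w) \<le> N w * L2_norm T (\<lambda>t. N (v t))"
    using L2_mono(2)[OF L2.scale_mem[OF NL] m b] L2.N_scale[OF NL] N_nonneg[OF assms(2)] by simp
qed

lemma CX_L2X: "CX u \<Longrightarrow> L2X u"
  by (rule L2X_I[OF CX_SM L2_continuous[OF CX_N_continuous]]) auto

lemma L2X_diff:
  assumes "L2X a" "L2X b" shows "L2X (\<lambda>t x. a t x - b t x)"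
proof (rule L2X_I[OF SM_diff])
  show "(\<lambda>t. N (a t) + N (b t)) \<in> L2 T" using assms by (intro L2.add_mem) (auto simp: L2X_def)
qed (use assms N_le_add L2X_mem in \<open>auto simp: L2X_def\<close>)

lemma L2X_integrable: "L2X v \<Longrightarrow> integrable (lebesgue_on {0<..<T}) (\<lambda>t. N (v t))"
  using integral_time_eq(2)[of "\<lambda>t. N (v t)" T] L2_integrable[of "\<lambda>t. N (v t)" T] L2D(1)[of "\<lambda>t. N (v t)" T]
  by (simp add: L2X_def)

text \<open>The Bochner integral of \<open>v\<close> cut off after time \<open>t\<close>, added to
  \<open>u0\<close>, has the required inner products; it takes the place of a representation theorem
  for functionals.\<close>

lemma weak_integral_ex:
  assumes v: "L2X v" and u0: "u0 \<in> X"
  shows "\<exists>u. weak_integral u0 v u"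
proof -
  have "\<exists>U\<in>X. \<forall>w\<in>X. ip U w = ip u0 w + prim T (\<lambda>s. ip (v s) w) t" for t
  proof -
    let ?h = "\<lambda>s x. indicator {..t} s * v s x"
    have SMh: "SM ?h"
      by (rule SM_scale[OF L2X_SM[OF v]]) (simp add: measurable_time_iff borel_dom_measure)
    have h: "L2X ?h"
    proof (rule L2X_I[OF SMh])
      show "(\<lambda>t. N (v t)) \<in> L2 T" using v by (simp add: L2X_def)
      show "N (?h s) \<le> N (v s)" if "s \<in> {0<..<T}" for s
        using N_scale[OF L2X_mem[OF v that], of "indicator {..t} s"] N_nonneg[OF L2X_mem[OF v that]]
        by (auto simp: indicator_def)
    qed
    obtain J where hb: "has_bochner {0<..<T} X N ?h J"
      using bochner_ex[OF SMh L2X_integrable[OF h]] by blast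
    then have J: "J \<in> X" by (simp add: has_bochner_def)
    have "ip (\<lambda>x. u0 x + J x) w = ip u0 w + prim T (\<lambda>s. ip (v s) w) t" if w: "w \<in> X" for w
    proof -
      have "ip J w = (LINT s|lebesgue_on {0<..<T}. ip (?h s) w)"
        by (rule bochner_ip(2)[OF hb L2X_integrable[OF h] w])
      also have "\<dots> = (LINT s|lebesgue_on {0<..<T}. ip (v s) w * indicator {..t} s)"
        using ip_scale[OF L2X_mem[OF v] w] by (intro Bochner_Integration.integral_cong) auto
      also have "\<dots> = prim T (\<lambda>s. ip (v s) w) t"
        unfolding prim_def L2_inner_def
        by (rule integral_time_eq(1)) (intro borel_measurable_times L2D(1) L2X_ip v w indicator_L2, simp)
      finally show ?thesis using ip_add[OF u0 J w] by simp
    qed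
    with add_mem[OF u0 J] show ?thesis by blast
  qed
  then obtain u where "\<And>t. u t \<in> X" "\<And>t w. w \<in> X \<Longrightarrow> ip (u t) w = ip u0 w + prim T (\<lambda>s. ip (v s) w) t"
    by metis
  then show ?thesis unfolding weak_integral_def by blast
qed

lemma weak_integralD:
  assumes "weak_integral u0 v u" "t \<in> {0..T}"
  shows "u t \<in> X" "w \<in> X \<Longrightarrow> ip (u t) w = ip u0 w + prim T (\<lambda>s. ip (v s) w) t"
  using assms by (auto simp: weak_integral_def)

text \<open>Tested with the difference at time \<open>t\<close> itself, both sides contain its norm
  as a factor, which is cancelled. The majorant \<open>g\<close> is left free because Picard
  iteration and Gronwall insert different ones.\<close>

lemma weak_integral_diff_bound:
  assumes "weak_integral u0 v u" "weak_integral u0' v' u'" "L2X v" "L2X v'" "u0 \<in> X" "u0' \<in> X"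
    and g: "g \<in> L2 T" "AE s in dom_measure T. N (\<lambda>x. v s x - v' s x) \<le> g s" and t: "t \<in> {0..T}"
  shows "N (\<lambda>x. u t x - u' t x) \<le> N (\<lambda>x. u0 x - u0' x) + prim T g t"
proof -
  let ?d = "\<lambda>x. u t x - u' t x"
  note u = weak_integralD[OF assms(1) t] and u' = weak_integralD[OF assms(2) t]
  have d: "?d \<in> X" by (rule diff_mem[OF u(1) u'(1)])
  note Nd = N_nonneg[OF d] and d0 = diff_mem[OF assms(5,6)]
  note L = L2X_ip(1)[OF assms(3) d] L2X_ip(1)[OF assms(4) d]
  have "(N ?d)\<^sup>2 = ip (u t) ?d - ip (u' t) ?d" using N_sq[OF d] ip_diff[OF u(1) u'(1) d] by simp
  also have "\<dots> = ip (\<lambda>x. u0 x - u0' x) ?d + prim T (\<lambda>s. ip (v s) ?d - ip (v' s) ?d) t"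
    using u(2)[OF d] u'(2)[OF d] ip_diff[OF assms(5,6) d] prim_diff[OF L] by simp
  also have "prim T (\<lambda>s. ip (v s) ?d - ip (v' s) ?d) t \<le> prim T (\<lambda>s. N ?d * g s) t"
  proof (rule prim_mono[OF L2.diff_mem[OF L] L2.scale_mem[OF g(1)]])
    have "AE s in dom_measure T. s \<in> {0<..<T}" by (rule AE_dom)
    with g(2) show "AE s in dom_measure T. ip (v s) ?d - ip (v' s) ?d \<le> N ?d * g s"
    proof eventually_elim
      case (elim s)
      note m = L2X_mem[OF assms(3) elim(2)] L2X_mem[OF assms(4) elim(2)]
      have "ip (v s) ?d - ip (v' s) ?d \<le> N (\<lambda>x. v s x - v' s x) * N ?d"
        using Cauchy_Schwarz[OF diff_mem[OF m] d] ip_diff[OF m d] by simp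
      also have "\<dots> \<le> g s * N ?d" by (intro mult_right_mono elim Nd)
      finally show ?case by (simp add: mult.commute)
    qed
  qed
  also have "prim T (\<lambda>s. N ?d * g s) t = N ?d * prim T g t" by (rule prim_cmult)
  also have "ip (\<lambda>x. u0 x - u0' x) ?d \<le> N (\<lambda>x. u0 x - u0' x) * N ?d"
    using Cauchy_Schwarz[OF d0 d] by simp
  finally have "N ?d * N ?d \<le> (N (\<lambda>x. u0 x - u0' x) + prim T g t) * N ?d"
    by (simp add: power2_eq_square algebra_simps)
  moreover have "0 \<le> prim T g t"
  proof (rule prim_nonneg)
    have "AE s in dom_measure T. s \<in> {0<..<T}" by (rule AE_dom)
    with g(2) show "AE s in dom_measure T. 0 \<le> g s"
    proof eventually_elim
      case (elim s)
      show ?case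
        using elim(1) N_nonneg[OF diff_mem[OF L2X_mem[OF assms(3) elim(2)] L2X_mem[OF assms(4) elim(2)]]] by linarith
    qed
  qed
  ultimately show ?thesis using N_nonneg[OF d0] by (intro le_if_mult_self_le[OF Nd]) auto
qed

text \<open>Testing an increment with itself and \<open>prim_diff_bound\<close> give Hoelder
  continuity with exponent 1/2.\<close>

lemma weak_integral_CX:
  assumes w: "weak_integral u0 v u" and v: "L2X v"
  shows "CX u"
proof -
  let ?c = "L2_norm T (\<lambda>t. N (v t))"
  have *: "N (\<lambda>x. u t x - u s x) \<le> sqrt (t - s) * ?c" if "s \<in> {0..T}" "t \<in> {0..T}" "s \<le> t" for s t
  proof -
    let ?d = "\<lambda>x. u t x - u s x"
    note ut = weak_integralD[OF w that(2)] and us = weak_integralD[OF w that(1)]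
    have d: "?d \<in> X" by (rule diff_mem[OF ut(1) us(1)])
    have "(N ?d)\<^sup>2 = prim T (\<lambda>r. ip (v r) ?d) t - prim T (\<lambda>r. ip (v r) ?d) s"
      using N_sq[OF d] ip_diff[OF ut(1) us(1) d] ut(2)[OF d] us(2)[OF d] by simp
    also have "\<dots> \<le> sqrt (t - s) * L2_norm T (\<lambda>r. ip (v r) ?d)"
      using prim_diff_bound[OF L2X_ip(1)[OF v d] that(3)] by simp
    also have "\<dots> \<le> sqrt (t - s) * (N ?d * ?c)"
      using that(3) by (intro mult_left_mono L2X_ip(2)[OF v d]) simp
    finally show ?thesis
      using that(3) by (intro le_if_mult_self_le[OF N_nonneg[OF d]]) (auto simp: power2_eq_square mult_ac)
  qed
  show ?thesis unfolding CX_def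
  proof (intro ballI conjI)
    fix t assume t: "t \<in> {0..T}"
    show "u t \<in> X" by (rule weak_integralD[OF w t])
    show "((\<lambda>s. N (\<lambda>x. u s x - u t x)) \<longlongrightarrow> 0) (at t within {0..T})"
    proof (rule Lim_null_comparison)
      show "\<forall>\<^sub>F s in at t within {0..T}. norm (N (\<lambda>x. u s x - u t x)) \<le> sqrt \<bar>s - t\<bar> * ?c"
        unfolding eventually_at_filter
      proof (intro always_eventually allI impI)
        fix s assume s: "s \<in> {0..T}"
        note m = weak_integralD(1)[OF w s] weak_integralD(1)[OF w t]
        show "norm (N (\<lambda>x. u s x - u t x)) \<le> sqrt \<bar>s - t\<bar> * ?c"
          using *[OF s t] *[OF t s] N_commute[OF m] N_nonneg[OF diff_mem[OF m]] by (cases "s \<le> t") auto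
      qed
      have "((\<lambda>s. sqrt \<bar>s - t\<bar> * ?c) \<longlongrightarrow> sqrt \<bar>t - t\<bar> * ?c) (at t within {0..T})"
        by (intro tendsto_intros)
      then show "((\<lambda>s. sqrt \<bar>s - t\<bar> * ?c) \<longlongrightarrow> 0) (at t within {0..T})" by simp
    qed
  qed
qed

definition weak_time_deriv :: "(real \<Rightarrow> real \<Rightarrow> real) \<Rightarrow> (real \<Rightarrow> real \<Rightarrow> real) \<Rightarrow> bool" where
  "weak_time_deriv u v \<longleftrightarrow>
     (\<forall>\<eta>. test_function 0 T \<eta> \<longrightarrow>
        (\<exists>J. has_bochner {0<..<T} X N (\<lambda>t x. deriv \<eta> t * u t x) J \<and>
             has_bochner {0<..<T} X N (\<lambda>t x. - (\<eta> t * v t x)) J))"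

lemma L2X_scale:
  assumes "L2X v" "continuous_on {0..T} \<eta>" shows "L2X (\<lambda>t x. \<eta> t * v t x)"
proof -
  have \<eta>m: "\<eta> \<in> borel_measurable (dom_measure T)" by (rule L2D(1)[OF L2_continuous[OF assms(2)]])
  obtain B where B: "\<forall>t\<in>{0..T}. \<bar>\<eta> t\<bar> \<le> B"
    using compact_imp_bounded[OF compact_continuous_image[OF assms(2) compact_Icc]]
    unfolding bounded_iff by auto
  show ?thesis
  proof (rule L2X_I)
    show "SM (\<lambda>t x. \<eta> t * v t x)" by (rule SM_scale[OF L2X_SM[OF assms(1)]]) (simp add: measurable_time_iff \<eta>m)
    show "(\<lambda>t. B * N (v t)) \<in> L2 T" using assms(1) by (intro L2.scale_mem) (simp add: L2X_def)
    fix t assume t: "t \<in> {0<..<T}"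
    show "N (\<lambda>x. \<eta> t * v t x) \<le> B * N (v t)"
      unfolding N_scale[OF L2X_mem[OF assms(1) t]]
      by (intro mult_right_mono N_nonneg L2X_mem[OF assms(1) t]) (use t B in simp)
  qed
qed

lemma time_integral_scaled:
  assumes v: "L2X v" and \<eta>: "continuous_on {0..T} \<eta>" and w: "w \<in> X"
    and hb: "has_bochner {0<..<T} X N (\<lambda>t x. \<eta> t * v t x) J"
  shows "ip J w = L2_inner T (\<lambda>t. ip (v t) w) \<eta>"
proof -
  have "ip J w = (LINT t|lebesgue_on {0<..<T}. ip (\<lambda>x. \<eta> t * v t x) w)"
    by (rule bochner_ip(2)[OF hb L2X_integrable[OF L2X_scale[OF v \<eta>]] w])
  also have "\<dots> = (LINT t|lebesgue_on {0<..<T}. ip (v t) w * \<eta> t)"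
    using ip_scale[OF L2X_mem[OF v] w] by (intro Bochner_Integration.integral_cong) (auto simp: mult.commute)
  also have "\<dots> = L2_inner T (\<lambda>t. ip (v t) w) \<eta>"
    unfolding L2_inner_def
    by (rule integral_time_eq(1)) (intro borel_measurable_times L2D(1) L2X_ip v w L2_continuous \<eta>)
  finally show ?thesis .
qed

lemma test_continuous: "test_function 0 T \<eta> \<Longrightarrow> continuous_on A \<eta>" "test_function 0 T \<eta> \<Longrightarrow> continuous_on A (deriv \<eta>)"
  by (rule smooth_continuous, erule test_smooth) (rule smooth_continuous, rule smooth_deriv, erule test_smooth)

text \<open>For fixed \<open>w\<close> the function t \<mapsto> ip (u t) w has a scalar weak
  derivative, so it is almost everywhere a constant plus a primitive by
  \<open>weak_deriv_imp_prim\<close>. Continuity extends this to all times, and time 0 gives the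
  constant.\<close>

lemma weak_time_deriv_imp_weak_integral:
  assumes u: "CX u" and v: "L2X v" and td: "weak_time_deriv u v"
  shows "weak_integral (u 0) v u"
  unfolding weak_integral_def
proof (intro ballI conjI)
  fix t w assume t: "t \<in> {0..T}" and w: "w \<in> X"
  let ?a = "\<lambda>t. ip (u t) w" and ?b = "\<lambda>t. ip (v t) w"
  have ac: "continuous_on {0..T} ?a" by (rule CX_ip_continuous[OF u w])
  have bL: "?b \<in> L2 T" by (rule L2X_ip(1)[OF v w])
  have "weak_deriv T ?a ?b"
    unfolding weak_deriv_def
  proof (intro allI impI)
    fix \<eta> assume \<eta>: "test_function 0 T \<eta>"
    obtain J where J: "has_bochner {0<..<T} X N (\<lambda>t x. deriv \<eta> t * u t x) J" "has_bochner {0<..<T} X N (\<lambda>t x. - \<eta> t * v t x) J"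
      using td \<eta> unfolding weak_time_deriv_def by auto
    have "L2_inner T ?a (deriv \<eta>) = ip J w"
      using time_integral_scaled[OF CX_L2X[OF u] test_continuous(2)[OF \<eta>] w J(1)] by simp
    also have "\<dots> = L2_inner T ?b (\<lambda>t. - \<eta> t)"
      by (rule time_integral_scaled[OF v _ w J(2)]) (intro continuous_intros test_continuous \<eta>)
    also have "\<dots> = - L2_inner T ?b \<eta>" by (simp add: L2_inner_def)
    finally show "L2_inner T ?a (deriv \<eta>) = - L2_inner T ?b \<eta>" .
  qed
  then obtain c where c: "AE t in dom_measure T. ?a t = c + prim T ?b t"
    using weak_deriv_imp_prim[OF L2_continuous[OF ac] bL _ T_pos] by blast
  have eq: "?a s = c + prim T ?b s" if "s \<in> {0..T}" for s
    by (rule continuous_AE_eq[OF T_pos ac _ c that]) (intro continuous_intros prim_continuous bL)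
  then show "?a t = ip (u 0) w + prim T ?b t" using eq[OF t] eq[of 0] T_pos prim_0 by simp
qed (rule CX_mem[OF u])

text \<open>The two Bochner integrals exist separately. Their inner products agree by the scalar
  integration by parts \<open>weak_deriv_prim\<close>, the constant contribution of
  \<open>u0\<close> vanishing because the derivative of \<eta> has mean zero.\<close>

lemma weak_integral_imp_weak_time_deriv:
  assumes wi: "weak_integral u0 v u" and v: "L2X v"
  shows "weak_time_deriv u v"
  unfolding weak_time_deriv_def
proof (intro allI impI)
  fix \<eta> assume \<eta>: "test_function 0 T \<eta>"
  have u: "CX u" by (rule weak_integral_CX[OF wi v])
  have h1: "L2X (\<lambda>t x. deriv \<eta> t * u t x)" by (intro L2X_scale CX_L2X u test_continuous \<eta>)
  have \<eta>c: "continuous_on {0..T} (\<lambda>t. - \<eta> t)" by (intro continuous_intros test_continuous \<eta>)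
  have h2: "L2X (\<lambda>t x. - \<eta> t * v t x)" by (intro L2X_scale v \<eta>c)
  obtain J1 where J1: "has_bochner {0<..<T} X N (\<lambda>t x. deriv \<eta> t * u t x) J1"
    using bochner_ex[OF L2X_SM[OF h1] L2X_integrable[OF h1]] by blast
  obtain J2 where J2: "has_bochner {0<..<T} X N (\<lambda>t x. - \<eta> t * v t x) J2"
    using bochner_ex[OF L2X_SM[OF h2] L2X_integrable[OF h2]] by blast
  have JX: "J1 \<in> X" "J2 \<in> X" using J1 J2 by (auto simp: has_bochner_def)
  have ipJ: "ip J1 w = ip J2 w" if w: "w \<in> X" for w
  proof -
    let ?b = "\<lambda>t. ip (v t) w"
    have bL: "?b \<in> L2 T" by (rule L2X_ip(1)[OF v w])
    have dL: "deriv \<eta> \<in> L2 T" by (rule L2_continuous[OF test_continuous(2)[OF \<eta>]])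
    have "ip J1 w = L2_inner T (\<lambda>t. ip (u t) w) (deriv \<eta>)"
      by (rule time_integral_scaled[OF CX_L2X[OF u] test_continuous(2)[OF \<eta>] w J1])
    also have "\<dots> = L2_inner T (\<lambda>t. ip u0 w * 1 + 1 * prim T ?b t) (deriv \<eta>)"
      unfolding L2_inner_def using weak_integralD(2)[OF wi _ w]
      by (intro Bochner_Integration.integral_cong) auto
    also have "\<dots> = ip u0 w * L2_inner T (\<lambda>t. 1) (deriv \<eta>) + L2_inner T (prim T ?b) (deriv \<eta>)"
      unfolding L2.ip_lincomb[OF L2_const prim_L2[OF bL] dL] by simp
    also have "L2_inner T (\<lambda>t. 1) (deriv \<eta>) = 0"
      using test_deriv_mean[OF \<eta> T_pos] by (simp add: L2_inner_def)
    also have "L2_inner T (prim T ?b) (deriv \<eta>) = - L2_inner T ?b \<eta>"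
      using weak_deriv_prim[OF T_pos bL] \<eta> by (simp add: weak_deriv_def)
    also have "- L2_inner T ?b \<eta> = L2_inner T ?b (\<lambda>t. - \<eta> t)" by (simp add: L2_inner_def)
    also have "\<dots> = ip J2 w" by (rule time_integral_scaled[OF v \<eta>c w J2, symmetric])
    finally show ?thesis by simp
  qed
  have z: "N (\<lambda>x. J1 x - J2 x) = 0"
    using N_eq[OF diff_mem[OF JX]] ip_diff[OF JX diff_mem[OF JX]] ipJ[OF diff_mem[OF JX]] by simp
  \<comment> \<open>The definition demands one vector for both integrals. \<open>J1\<close> and
    \<open>J2\<close> may differ as functions, but only by norm zero, so \<open>J2\<close> also
    represents the first integral.\<close>
  have "has_bochner {0<..<T} X N (\<lambda>t x. deriv \<eta> t * u t x) J2"
  proof -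
    obtain S where S: "\<And>n. simple_valued {0<..<T} X (S n)"
      "(\<lambda>n. \<integral>\<^sup>+ t. ennreal (N (\<lambda>x. S n t x - deriv \<eta> t * u t x)) \<partial>lebesgue_on {0<..<T}) \<longlonglongrightarrow> 0"
      "(\<lambda>n. N (\<lambda>x. simple_integral {0<..<T} (S n) x - J1 x)) \<longlonglongrightarrow> 0"
      using J1 unfolding has_bochner_def by blast
    have SX: "simple_integral {0<..<T} (S n) \<in> X" for n
      by (rule simple_integral_ip(1)[OF _ _ zero_mem]) (use S(1)[of n] in \<open>auto simp: simple_valued_iff image_subset_iff\<close>)
    have "(\<lambda>n. N (\<lambda>x. simple_integral {0<..<T} (S n) x - J2 x)) \<longlonglongrightarrow> 0"
      by (rule Lim_null_comparison[OF _ S(3)])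
         (use N_diff_triangle[OF SX JX] z N_nonneg[OF diff_mem[OF SX JX(2)]] in simp)
    then show ?thesis unfolding has_bochner_def using J1 JX S(1,2) by (auto simp: has_bochner_def)
  qed
  with J2 show "\<exists>J. has_bochner {0<..<T} X N (\<lambda>t x. deriv \<eta> t * u t x) J \<and> has_bochner {0<..<T} X N (\<lambda>t x. - (\<eta> t * v t x)) J"
    by auto
qed

end

section \<open>Evolution equations with a Lipschitz right-hand side\<close>

context bochner_space
begin

lemma CX_const: "a \<in> X \<Longrightarrow> CX (\<lambda>t. a)"
  by (simp add: CX_def N_zero)

lemma CX_diff:
  assumes "CX a" "CX b" shows "CX (\<lambda>t x. a t x - b t x)"
  unfolding CX_def
proof (intro ballI conjI)
  fix t assume t: "t \<in> {0..T}"
  note m = CX_mem[OF assms(1)] CX_mem[OF assms(2)]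
  show "(\<lambda>x. a t x - b t x) \<in> X" by (rule diff_mem[OF m(1)[OF t] m(2)[OF t]])
  show "((\<lambda>s. N (\<lambda>x. (a s x - b s x) - (a t x - b t x))) \<longlongrightarrow> 0) (at t within {0..T})"
  proof (rule Lim_null_comparison)
    show "\<forall>\<^sub>F s in at t within {0..T}. norm (N (\<lambda>x. (a s x - b s x) - (a t x - b t x))) \<le>
        N (\<lambda>x. a s x - a t x) + N (\<lambda>x. b s x - b t x)"
      unfolding eventually_at_filter
    proof (intro always_eventually allI impI)
      fix s assume s: "s \<in> {0..T}"
      have "N (\<lambda>x. (a s x - b s x) - (a t x - b t x)) \<le> N (\<lambda>x. a s x - a t x) + N (\<lambda>x. b s x - b t x)"
        using N_le_add[OF diff_mem[OF m(1)[OF s] m(1)[OF t]] diff_mem[OF m(2)[OF s] m(2)[OF t]]]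
        by (simp add: algebra_simps)
      then show "norm (N (\<lambda>x. (a s x - b s x) - (a t x - b t x))) \<le> N (\<lambda>x. a s x - a t x) + N (\<lambda>x. b s x - b t x)"
        using N_nonneg[OF diff_mem[OF diff_mem[OF m(1)[OF s] m(2)[OF s]] diff_mem[OF m(1)[OF t] m(2)[OF t]]]] by simp
    qed
    show "((\<lambda>s. N (\<lambda>x. a s x - a t x) + N (\<lambda>x. b s x - b t x)) \<longlongrightarrow> 0) (at t within {0..T})"
      by (rule tendsto_add_zero) (use assms t in \<open>auto simp: CX_def\<close>)
  qed
qed

text \<open>Picard iteration for u' = q - F u with u(0) = x0. Measured with the weight exp(-2Kt),
  each step halves the bound on consecutive iterates, as the integral of K exp(2Ks) over (0, t) is
  at most exp(2Kt)/2; so all of [0, T] is covered at once.\<close>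

lemma picard:
  assumes q: "L2X q" and x0: "x0 \<in> X" and F: "\<And>a. a \<in> X \<Longrightarrow> F a \<in> X" and K: "0 < K"
    and L: "\<And>a b. a \<in> X \<Longrightarrow> b \<in> X \<Longrightarrow> N (\<lambda>x. F a x - F b x) \<le> K * N (\<lambda>x. a x - b x)"
  shows "\<exists>u. weak_integral x0 (\<lambda>t x. q t x - F (u t) x) u \<and> L2X (\<lambda>t x. q t x - F (u t) x)"
proof -
  define v where "v u = (\<lambda>t x. q t x - F (u t) x)" for u
  have vL: "L2X (v u)" if u: "CX u" for u
  proof -
    have "L2X (\<lambda>t. F (u t))"
    proof (rule L2X_I)
      show "SM (\<lambda>t. F (u t))"
      proof (rule SM_map2[OF CX_SM[OF u] CX_SM[OF u], where F="\<lambda>a b. F a" and C=K])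
        fix a b a' b' assume m: "a \<in> X" "b \<in> X" "a' \<in> X" "b' \<in> X"
        show "N (\<lambda>x. F a x - F a' x) \<le> K * (N (\<lambda>x. a x - a' x) + N (\<lambda>x. b x - b' x))"
          using L[OF m(1,3)] N_nonneg[OF diff_mem[OF m(2,4)]] K by (simp add: distrib_left add_increasing2)
      qed (rule F)
      show "(\<lambda>t. N (F (\<lambda>x. 0)) + K * N (u t)) \<in> L2 T"
        by (intro L2_continuous continuous_intros CX_N_continuous u)
      fix t assume "t \<in> {0<..<T}"
      then have ut: "u t \<in> X" using CX_mem[OF u, of t] by simp
      show "N (F (u t)) \<le> N (F (\<lambda>x. 0)) + K * N (u t)"
        using N_triangle_diff[OF F[OF ut] F[OF zero_mem]] L[OF ut zero_mem] by simp
    qed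
    then show ?thesis unfolding v_def by (rule L2X_diff[OF q])
  qed
  \<comment> \<open>An integral is unique only up to norm zero, so every iterate is a choice
    depending on the preceding one.\<close>
  have "\<exists>U. \<forall>n::nat. CX (U n) \<and> weak_integral x0 (v (U n)) (U (Suc n))"
  proof (rule dependent_nat_choice)
    show "\<exists>u. CX u" using CX_const[OF x0] by blast
    fix u assume "CX u"
    then obtain u' where "weak_integral x0 (v u) u'" using weak_integral_ex[OF vL x0] by blast
    moreover from this have "CX u'" using weak_integral_CX vL \<open>CX u\<close> by blast
    ultimately show "\<exists>y. CX y \<and> weak_integral x0 (v u) y" by blast
  qed
  then obtain U where UC: "\<And>n. CX (U n)" and UW: "\<And>n. weak_integral x0 (v (U n)) (U (Suc n))" by blast
  note UX = CX_mem[OF UC]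
  note UdC = CX_N_continuous[OF CX_diff[OF UC[of "Suc 0"] UC[of 0]]]
  obtain B where B: "\<forall>t\<in>{0..T}. \<bar>N (\<lambda>x. U (Suc 0) t x - U 0 t x)\<bar> \<le> B"
    using compact_imp_bounded[OF compact_continuous_image[OF UdC compact_Icc]] unfolding bounded_iff by auto
  have vdiff: "N (\<lambda>x. v a s x - v b s x) \<le> K * N (\<lambda>x. a s x - b s x)" if "CX a" "CX b" "s \<in> {0<..<T}" for a b s
  proof -
    have m: "a s \<in> X" "b s \<in> X" using CX_mem that by auto
    have "(\<lambda>x. v a s x - v b s x) = (\<lambda>x. F (b s) x - F (a s) x)" by (simp add: v_def)
    then show ?thesis using L[OF m(2,1)] N_commute[OF m] by simp
  qed
  have step: "N (\<lambda>x. U (Suc k) t x - U k t x) \<le> B * (1/2) ^ k * exp (2 * K * t)" if "t \<in> {0..T}" for k t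
    using that
  proof (induction k arbitrary: t)
    case 0
    have "N (\<lambda>x. U (Suc 0) t x - U 0 t x) \<le> B" using B 0 by fastforce
    moreover have "1 \<le> exp (2 * K * t)" using 0 K by simp
    moreover have "0 \<le> B" using B 0 abs_ge_zero order.trans by blast
    ultimately show ?case using mult_left_mono[of 1 "exp (2 * K * t)" B] by simp
  next
    case (Suc k)
    let ?g = "\<lambda>s. (K * B * (1/2) ^ k) * exp (2 * K * s)"
    have "N (\<lambda>x. U (Suc (Suc k)) t x - U (Suc k) t x) \<le> N (\<lambda>x. x0 x - x0 x) + prim T ?g t"
    proof (rule weak_integral_diff_bound[OF UW UW vL[OF UC] vL[OF UC] x0 x0 _ _ Suc.prems])
      show "?g \<in> L2 T" by (intro L2_continuous continuous_intros)
      show "AE s in dom_measure T. N (\<lambda>x. v (U (Suc k)) s x - v (U k) s x) \<le> ?g s"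
      proof (rule AE_dom)
        fix s assume s: "s \<in> {0<..<T}"
        have "N (\<lambda>x. v (U (Suc k)) s x - v (U k) s x) \<le> K * N (\<lambda>x. U (Suc k) s x - U k s x)"
          by (rule vdiff[OF UC UC s])
        also have "\<dots> \<le> K * (B * (1/2) ^ k * exp (2 * K * s))"
          using Suc.IH[of s] s K by (intro mult_left_mono) auto
        finally show "N (\<lambda>x. v (U (Suc k)) s x - v (U k) s x) \<le> ?g s" by (simp add: mult_ac)
      qed
    qed
    also have "\<dots> = B * (1/2) ^ Suc k * (exp (2 * K * t) - 1)"
      using prim_exp[of "2 * K" t T] K Suc.prems N_zero by (simp add: prim_cmult)
    also have "\<dots> \<le> B * (1/2) ^ Suc k * exp (2 * K * t)"
    proof (rule mult_left_mono)
      have "0 \<le> B" using B Suc.prems abs_ge_zero order.trans by blast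
      then show "0 \<le> B * (1/2) ^ Suc k" by simp
    qed simp
    finally show ?case .
  qed
  define B' where "B' = B * exp (2 * K * T)"
  have B0: "0 \<le> B" using B T_pos abs_ge_zero order.trans by (metis atLeastAtMost_iff less_imp_le order_refl)
  have B'0: "0 \<le> B'" using B0 by (simp add: B'_def)
  have step': "N (\<lambda>x. U (Suc k) t x - U k t x) \<le> B' * (1/2) ^ k" if t: "t \<in> {0..T}" for k t
  proof -
    have "B * (1/2) ^ k * exp (2 * K * t) \<le> B * (1/2) ^ k * exp (2 * K * T)"
      using t K B0 by (intro mult_left_mono) auto
    with step[OF t, of k] show ?thesis by (simp add: B'_def mult_ac)
  qed
  \<comment> \<open>The bracket is the closed form of the geometric sum of (1/2)^j for j from k to k
    + n - 1.\<close>
  have far: "N (\<lambda>x. U (k + n) t x - U k t x) \<le> B' * (2 * (1/2) ^ k - 2 * (1/2) ^ (k + n))" if t: "t \<in> {0..T}" for k n t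
  proof (induction n)
    case 0 then show ?case using N_zero by simp
  next
    case (Suc n)
    have "N (\<lambda>x. U (k + Suc n) t x - U k t x) \<le> N (\<lambda>x. U (Suc (k + n)) t x - U (k + n) t x) + N (\<lambda>x. U (k + n) t x - U k t x)"
      using N_diff_triangle[OF UX[OF t, of "Suc (k + n)"] UX[OF t, of "k + n"] UX[OF t, of k]] by simp
    also have "\<dots> \<le> B' * (1/2) ^ (k + n) + B' * (2 * (1/2) ^ k - 2 * (1/2) ^ (k + n))"
      by (intro add_mono step'[OF t] Suc)
    also have "\<dots> = B' * (2 * (1/2) ^ k - 2 * (1/2) ^ (k + Suc n))" by (simp add: algebra_simps)
    finally show ?case .
  qed
  have far': "N (\<lambda>x. U m t x - U k t x) \<le> 2 * B' * (1/2) ^ k" if t: "t \<in> {0..T}" and "k \<le> m" for k m t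
  proof -
    have "B' * (2 * (1/2) ^ k - 2 * (1/2) ^ m) \<le> B' * (2 * (1/2) ^ k)" by (intro mult_left_mono B'0) simp
    with far[OF t, of k "m - k"] that(2) show ?thesis by (simp add: mult_ac)
  qed
  have geo: "(\<lambda>k. c * (1/2) ^ k) \<longlonglongrightarrow> 0" for c :: real
    by (rule tendsto_mult_right_zero[OF LIMSEQ_realpow_zero]) auto
  have "\<forall>t\<in>{0..T}. \<exists>l\<in>X. (\<lambda>n. N (\<lambda>x. U n t x - l x)) \<longlonglongrightarrow> 0"
  proof
    fix t assume t: "t \<in> {0..T}"
    show "\<exists>l\<in>X. (\<lambda>n. N (\<lambda>x. U n t x - l x)) \<longlonglongrightarrow> 0"
    proof (rule complete[OF UX[OF t]])
      fix e :: real assume "0 < e"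
      then obtain M where M: "\<forall>k\<ge>M. norm (2 * B' * (1/2) ^ k - 0) < e" using LIMSEQ_D[OF geo] by blast
      have "N (\<lambda>x. U m t x - U n t x) < e" if "M \<le> m" "M \<le> n" for m n
      proof (cases "n \<le> m")
        case True
        have "norm (2 * B' * (1/2) ^ n - 0) < e" using M that by blast
        then show ?thesis using far'[OF t True] by simp
      next
        case False
        then have "m \<le> n" by simp
        moreover have "norm (2 * B' * (1/2) ^ m - 0) < e" using M that by blast
        ultimately show ?thesis using far'[OF t, of m n] N_commute[OF UX[OF t] UX[OF t], of m n] by simp
      qed
      then show "\<exists>M. \<forall>m\<ge>M. \<forall>n\<ge>M. N (\<lambda>x. U m t x - U n t x) < e" by blast
    qed
  qed
  then obtain u where uX: "\<And>t. t \<in> {0..T} \<Longrightarrow> u t \<in> X"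
    and ulim: "\<And>t. t \<in> {0..T} \<Longrightarrow> (\<lambda>n. N (\<lambda>x. U n t x - u t x)) \<longlonglongrightarrow> 0"
    by metis
  have near: "N (\<lambda>x. U k t x - u t x) \<le> 2 * B' * (1/2) ^ k" if t: "t \<in> {0..T}" for k t
  proof (rule LIMSEQ_le_const)
    show "(\<lambda>m. 2 * B' * (1/2) ^ k + N (\<lambda>x. U m t x - u t x)) \<longlonglongrightarrow> 2 * B' * (1/2) ^ k"
      using tendsto_add[OF tendsto_const ulim[OF t]] by simp
    have "N (\<lambda>x. U k t x - u t x) \<le> 2 * B' * (1/2) ^ k + N (\<lambda>x. U m t x - u t x)" if "k \<le> m" for m
      using N_diff_triangle[OF UX[OF t] UX[OF t] uX[OF t], of k m] far'[OF t that] N_commute[OF UX[OF t] UX[OF t], of m k] by simp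
    then show "\<exists>M. \<forall>m\<ge>M. N (\<lambda>x. U k t x - u t x) \<le> 2 * B' * (1/2) ^ k + N (\<lambda>x. U m t x - u t x)" by blast
  qed
  have uC: "CX u"
    unfolding CX_def
  proof (intro ballI conjI uX)
    fix t assume t: "t \<in> {0..T}"
    show "((\<lambda>s. N (\<lambda>x. u s x - u t x)) \<longlongrightarrow> 0) (at t within {0..T})"
    proof (rule tendstoI)
      fix e :: real assume e: "0 < e"
      \<comment> \<open>The constant 4 B' covers the two errors 2 B' (1/2)^k made by replacing
        \<open>u\<close> by \<open>U k\<close> at \<open>s\<close> and at \<open>t\<close>.\<close>
      then obtain k where "norm (4 * B' * (1/2) ^ k - 0) < e / 2" using LIMSEQ_D[OF geo, of "e / 2"] by (metis half_gt_zero order_refl)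
      then have k: "4 * B' * (1/2) ^ k < e / 2" by simp
      have "((\<lambda>s. N (\<lambda>x. U k s x - U k t x)) \<longlongrightarrow> 0) (at t within {0..T})"
        using UC[of k] t by (simp add: CX_def)
      from tendstoD[OF this, of "e / 2"] e
      have "\<forall>\<^sub>F s in at t within {0..T}. dist (N (\<lambda>x. U k s x - U k t x)) 0 < e / 2" by simp
      moreover have "\<forall>\<^sub>F s in at t within {0..T}. s \<in> {0..T}" by (simp add: eventually_at_filter)
      ultimately show "\<forall>\<^sub>F s in at t within {0..T}. dist (N (\<lambda>x. u s x - u t x)) 0 < e"
      proof eventually_elim
        case (elim s)
        note m = UX[OF elim(2), of k] UX[OF t, of k] uX[OF elim(2)] uX[OF t]
        have "N (\<lambda>x. u s x - u t x) \<le> N (\<lambda>x. u s x - U k s x) + (N (\<lambda>x. U k s x - U k t x) + N (\<lambda>x. U k t x - u t x))"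
          using N_diff_triangle[OF m(3,1,4)] N_diff_triangle[OF m(1,2,4)] by simp
        moreover have "N (\<lambda>x. u s x - U k s x) \<le> 2 * B' * (1/2) ^ k"
          using near[OF elim(2), of k] N_commute[OF m(1,3)] by simp
        moreover have "N (\<lambda>x. U k t x - u t x) \<le> 2 * B' * (1/2) ^ k" by (rule near[OF t])
        moreover have "N (\<lambda>x. U k s x - U k t x) < e / 2" using elim(1) by (simp add: dist_real_def)
        ultimately have "N (\<lambda>x. u s x - u t x) < e" using k by simp
        then show ?case using N_nonneg[OF diff_mem[OF m(3,4)]] by (simp add: dist_real_def)
      qed
    qed
  qed
  \<comment> \<open>The limit is identified as an integral of its own right-hand side by comparison:
    \<open>u\<close> and \<open>u'\<close> both stay within a multiple of (1/2)^k of the iterate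
    \<open>U (Suc k)\<close>, so they differ by norm zero.\<close>
  obtain u' where u': "weak_integral x0 (v u) u'" using weak_integral_ex[OF vL[OF uC] x0] by blast
  have "ip (u t) w = ip (u' t) w" if t: "t \<in> {0..T}" and w: "w \<in> X" for t w
  proof -
    note m = uX[OF t] weak_integralD(1)[OF u' t]
    have "N (\<lambda>x. u t x - u' t x) \<le> (2 * B' + K * (2 * B') * T) * (1/2) ^ k" for k
    proof -
      let ?c = "K * (2 * B' * (1/2) ^ k)"
      have c0: "0 \<le> ?c" using K B'0 by simp
      have "N (\<lambda>x. U (Suc k) t x - u' t x) \<le> N (\<lambda>x. x0 x - x0 x) + prim T (\<lambda>s. ?c) t"
      proof (rule weak_integral_diff_bound[OF UW u' vL[OF UC] vL[OF uC] x0 x0 L2_const _ t])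
        show "AE s in dom_measure T. N (\<lambda>x. v (U k) s x - v u s x) \<le> ?c"
        proof (rule AE_dom)
          fix s assume s: "s \<in> {0<..<T}"
          have "N (\<lambda>x. v (U k) s x - v u s x) \<le> K * N (\<lambda>x. U k s x - u s x)" by (rule vdiff[OF UC uC s])
          also have "\<dots> \<le> ?c" using near[of s k] s K by (intro mult_left_mono) auto
          finally show "N (\<lambda>x. v (U k) s x - v u s x) \<le> ?c" .
        qed
      qed
      also have "\<dots> \<le> ?c * T"
      proof -
        have "prim T (\<lambda>s. ?c) t \<le> sqrt T * (\<bar>?c\<bar> * sqrt T)"
          using prim_bound[OF _ L2_const, of T ?c t] L2_norm_const[of T ?c] T_pos by simp
        also have "\<dots> = ?c * T" using c0 T_pos by (simp add: mult_ac)
        finally show ?thesis by (simp add: N_zero)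
      qed
      finally have "N (\<lambda>x. U (Suc k) t x - u' t x) \<le> ?c * T" .
      moreover have "N (\<lambda>x. u t x - U (Suc k) t x) \<le> 2 * B' * (1/2) ^ k"
      proof -
        have "2 * B' * (1/2) ^ Suc k \<le> 2 * B' * (1/2) ^ k" using B'0 by (intro mult_left_mono power_decreasing) auto
        then show ?thesis using near[OF t, of "Suc k"] N_commute[OF UX[OF t, of "Suc k"] m(1)] by simp
      qed
      ultimately show ?thesis using N_diff_triangle[OF m(1) UX[OF t, of "Suc k"] m(2)] by (simp add: algebra_simps)
    qed
    then have "N (\<lambda>x. u t x - u' t x) \<le> 0" by (intro LIMSEQ_le_const[OF geo]) blast
    then have "N (\<lambda>x. u t x - u' t x) = 0" using N_nonneg[OF diff_mem[OF m]] by simp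
    then show ?thesis using Cauchy_Schwarz[OF diff_mem[OF m] w] ip_diff[OF m w] by simp
  qed
  then have "weak_integral x0 (v u) u"
    using u' uX unfolding weak_integral_def by simp
  then show ?thesis using vL[OF uC] unfolding v_def by blast
qed

text \<open>Only an estimate between the two derivatives is assumed, so the bound applies to
  arbitrary given solutions and not just to those produced by \<open>picard\<close>.\<close>

lemma weak_integral_stability:
  assumes w: "weak_integral u0 v u" "weak_integral u0' v' u'" and vL: "L2X v" "L2X v'"
    and u0: "u0 \<in> X" "u0' \<in> X" "N (\<lambda>x. u0 x - u0' x) = 0"
    and K: "0 < K" and r: "r \<in> L2 T" "AE s in dom_measure T. 0 \<le> r s"
    and le: "AE s in dom_measure T. N (\<lambda>x. v s x - v' s x) \<le> K * N (\<lambda>x. u s x - u' s x) + r s"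
    and t: "t \<in> {0..T}"
  shows "N (\<lambda>x. u t x - u' t x) \<le> 2 * exp (2 * K * T) * prim T r T"
proof (rule gronwall[OF T_pos K _ r _ t])
  show c: "continuous_on {0..T} (\<lambda>t. N (\<lambda>x. u t x - u' t x))"
    by (intro CX_N_continuous CX_diff weak_integral_CX[OF w(1) vL(1)] weak_integral_CX[OF w(2) vL(2)])
  fix s assume s: "s \<in> {0..T}"
  have "(\<lambda>s. K * N (\<lambda>x. u s x - u' s x) + 1 * r s) \<in> L2 T"
    by (intro L2_lincomb L2_continuous c r)
  then show "N (\<lambda>x. u s x - u' s x) \<le> prim T (\<lambda>s. K * N (\<lambda>x. u s x - u' s x) + r s) s"
    using weak_integral_diff_bound[OF w vL u0(1,2) _ le s] u0(3) by simp
qed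

end

section \<open>The Kelvin-Voigt problem\<close>

text \<open>Initial values are prescribed only almost everywhere; this turns their agreement into
  norm zero, the form in which the stability estimate needs it.\<close>

lemma H1_norm_AE_zero:
  assumes "v \<in> H1 \<Lambda>" "AE x in dom_measure \<Lambda>. v x = 0" shows "H1_norm \<Lambda> v = 0"
proof -
  have vL: "v \<in> L2 \<Lambda>" by (rule H1_L2[OF assms(1)])
  have "weak_deriv \<Lambda> v (\<lambda>x. 0)"
    unfolding weak_deriv_def
  proof (intro allI impI)
    fix \<phi> assume "test_function 0 \<Lambda> \<phi>"
    have "L2_inner \<Lambda> v (deriv \<phi>) = 0"
      unfolding L2_inner_def by (rule integral_eq_zero_AE) (use assms(2) in eventually_elim, simp)
    then show "L2_inner \<Lambda> v (deriv \<phi>) = - L2_inner \<Lambda> (\<lambda>x. 0) \<phi>" by (simp add: L2_inner_def)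
  qed
  then have D: "AE x in dom_measure \<Lambda>. D\<^sub>x \<Lambda> v x = 0" by (rule Dx_unique[OF vL L2.zero_mem])
  have "L2_norm \<Lambda> v = 0" "L2_norm \<Lambda> (D\<^sub>x \<Lambda> v) = 0"
    using L2_cong_AE(1)[OF assms(2)] L2_cong_AE(1)[OF D] L2D(1)[OF vL] L2D(1)[OF Dx(1)[OF assms(1)]] L2.N_zero
    by auto
  then show ?thesis by (simp add: H1_norm_def)
qed

text \<open>Essential suprema and infima give bounds only almost everywhere. One pair
  \<open>m\<close>, \<open>M\<close> is meant to serve all coefficients of an approximating
  sequence, which keeps the constants uniform.\<close>

definition coefficient :: "real \<Rightarrow> real \<Rightarrow> real \<Rightarrow> (real \<Rightarrow> real) \<Rightarrow> bool" where
  "coefficient \<Lambda> m M a \<longleftrightarrow> a \<in> borel_measurable (dom_measure \<Lambda>) \<and> 0 < m \<and> (AE x in dom_measure \<Lambda>. m \<le> a x \<and> a x \<le> M)"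

lemma coefficient_mult:
  assumes "coefficient \<Lambda> m M a" "0 \<le> M" "h \<in> L2 \<Lambda>"
  shows "(\<lambda>x. a x * h x) \<in> L2 \<Lambda>" "L2_norm \<Lambda> (\<lambda>x. a x * h x) \<le> M * L2_norm \<Lambda> h"
proof -
  have m: "a \<in> borel_measurable (dom_measure \<Lambda>)" using assms by (simp add: coefficient_def)
  have ae: "AE x in dom_measure \<Lambda>. m \<le> a x \<and> a x \<le> M" and m0: "0 < m" using assms by (auto simp: coefficient_def)
  from ae have b: "AE x in dom_measure \<Lambda>. \<bar>a x\<bar> \<le> M" by eventually_elim (use m0 in auto)
  show "(\<lambda>x. a x * h x) \<in> L2 \<Lambda>" "L2_norm \<Lambda> (\<lambda>x. a x * h x) \<le> M * L2_norm \<Lambda> h"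
    by (rule L2_mult_bounded[OF assms(3) m b assms(2)])+
qed

section \<open>The elliptic problem for the velocity in H10\<close>

locale kv_domain = domain +
  fixes T :: real
  assumes T_pos': "0 < T"
begin

sublocale H10: bochner_space "H10 \<Lambda>" "H1_inner \<Lambda>" "H1_norm \<Lambda>" T
proof
  show "(\<lambda>x. 0) \<in> H10 \<Lambda>"
    unfolding H10_iff
  proof (intro conjI allI impI H1.zero_mem)
    show "\<exists>\<phi>\<in>Collect (test_function 0 \<Lambda>). H1_norm \<Lambda> (\<lambda>x. 0 - \<phi> x) < e" if "0 < e" for e
      by (rule bexI[of _ "\<lambda>x. 0"]) (use that test_zero H1.N_zero in auto)
  qed
  show "(\<lambda>x. c * a x + d * b x) \<in> H10 \<Lambda>" if "a \<in> H10 \<Lambda>" "b \<in> H10 \<Lambda>" for a b c d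
    by (rule H10_lincomb[OF that])
  show "H1_inner \<Lambda> a b = H1_inner \<Lambda> b a" if "a \<in> H10 \<Lambda>" "b \<in> H10 \<Lambda>" for a b
    by (rule H1.ip_sym) (use that H10_H1 in auto)
  show "H1_inner \<Lambda> (\<lambda>x. c * a x + d * b x) w = c * H1_inner \<Lambda> a w + d * H1_inner \<Lambda> b w"
    if "a \<in> H10 \<Lambda>" "b \<in> H10 \<Lambda>" "w \<in> H10 \<Lambda>" for a b w c d
    by (rule H1.ip_lincomb) (use that H10_H1 in auto)
  show "0 \<le> H1_inner \<Lambda> a a" if "a \<in> H10 \<Lambda>" for a
    by (rule H1.ip_pos) (use that H10_H1 in auto)
  show "H1_norm \<Lambda> a = sqrt (H1_inner \<Lambda> a a)" if "a \<in> H10 \<Lambda>" for a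
    by (rule H1.N_eq) (use that H10_H1 in auto)
  show "0 < T" by (rule T_pos')
  fix g :: "nat \<Rightarrow> real \<Rightarrow> real"
  assume g: "\<And>n. g n \<in> H10 \<Lambda>"
    and C: "\<And>e. 0 < e \<Longrightarrow> \<exists>M. \<forall>m\<ge>M. \<forall>n\<ge>M. H1_norm \<Lambda> (\<lambda>x. g m x - g n x) < e"
  from H1_complete[OF H10_H1[OF g] C]
  obtain l where l: "l \<in> H1 \<Lambda>" "(\<lambda>n. H1_norm \<Lambda> (\<lambda>x. g n x - l x)) \<longlonglongrightarrow> 0" by blast
  show "\<exists>l\<in>H10 \<Lambda>. (\<lambda>n. H1_norm \<Lambda> (\<lambda>x. g n x - l x)) \<longlonglongrightarrow> 0"
  proof (rule bexI[of _ l])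
    show "(\<lambda>n. H1_norm \<Lambda> (\<lambda>x. g n x - l x)) \<longlonglongrightarrow> 0" by (rule l(2))
    show "l \<in> H10 \<Lambda>" by (rule H10_closed[OF g l])
  qed
qed

text \<open>Weak form of (\<nu> z')' = h' with zero boundary values. The right side enters through
  \<open>h\<close>, the form in which stresses occur.\<close>

definition solves :: "(real \<Rightarrow> real) \<Rightarrow> (real \<Rightarrow> real) \<Rightarrow> (real \<Rightarrow> real) \<Rightarrow> bool" where
  "solves \<nu> z h \<longleftrightarrow> z \<in> H10 \<Lambda> \<and>
     (\<forall>\<phi>\<in>H10 \<Lambda>. L2_inner \<Lambda> (\<lambda>x. \<nu> x * D\<^sub>x \<Lambda> z x) (D\<^sub>x \<Lambda> \<phi>) = L2_inner \<Lambda> h (D\<^sub>x \<Lambda> \<phi>))"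

lemma DL: "z \<in> H10 \<Lambda> \<Longrightarrow> D\<^sub>x \<Lambda> z \<in> L2 \<Lambda>" using Dx(1) H10_H1 by blast

lemma D_diff_AE:
  assumes "z \<in> H10 \<Lambda>" "w \<in> H10 \<Lambda>"
  shows "AE x in dom_measure \<Lambda>. D\<^sub>x \<Lambda> (\<lambda>x. z x - w x) x = D\<^sub>x \<Lambda> z x - D\<^sub>x \<Lambda> w x"
  using H1_lincomb(2)[OF assms[THEN H10_H1], of 1 "-1"] by simp

lemma D_diff_norm:
  "z \<in> H10 \<Lambda> \<Longrightarrow> w \<in> H10 \<Lambda> \<Longrightarrow> L2_norm \<Lambda> (\<lambda>x. D\<^sub>x \<Lambda> z x - D\<^sub>x \<Lambda> w x) \<le> H1_norm \<Lambda> (\<lambda>x. z x - w x)"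
  using Dx_diff_norm[OF H10_H1 H10_H1] L2_le_H1(2) by metis

context
  fixes m M :: real
  assumes M_nonneg: "0 \<le> M"
begin

text \<open>Testing with \<open>z\<close> itself and \<nu> \<ge> m bounds the derivative of
  \<open>z\<close> by the norm of \<open>h\<close> divided by \<open>m\<close>; the Poincare
  inequality costs the factor 1 + \<Lambda>.\<close>

lemma energy:
  assumes a: "coefficient \<Lambda> m M \<nu>" and h: "h \<in> L2 \<Lambda>" and z: "solves \<nu> z h"
  shows "H1_norm \<Lambda> z \<le> (1 + \<Lambda>) / m * L2_norm \<Lambda> h"
proof -
  have zX: "z \<in> H10 \<Lambda>" and m: "0 < m" using z a by (auto simp: solves_def coefficient_def)
  note D = DL[OF zX]
  let ?d = "L2_norm \<Lambda> (D\<^sub>x \<Lambda> z)"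
  have "m * ?d\<^sup>2 = (LINT x|dom_measure \<Lambda>. m * (D\<^sub>x \<Lambda> z x)\<^sup>2)" by (simp add: L2_norm_sq)
  also have "\<dots> \<le> (LINT x|dom_measure \<Lambda>. (\<nu> x * D\<^sub>x \<Lambda> z x) * D\<^sub>x \<Lambda> z x)"
  proof (rule integral_mono_AE)
    show "integrable (dom_measure \<Lambda>) (\<lambda>x. m * (D\<^sub>x \<Lambda> z x)\<^sup>2)" using L2D(2)[OF D] by simp
    show "integrable (dom_measure \<Lambda>) (\<lambda>x. (\<nu> x * D\<^sub>x \<Lambda> z x) * D\<^sub>x \<Lambda> z x)"
      by (rule L2_mult_integrable[OF coefficient_mult(1)[OF a M_nonneg D] D])
    have "AE x in dom_measure \<Lambda>. m \<le> \<nu> x \<and> \<nu> x \<le> M" using a by (simp add: coefficient_def)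
    then show "AE x in dom_measure \<Lambda>. m * (D\<^sub>x \<Lambda> z x)\<^sup>2 \<le> (\<nu> x * D\<^sub>x \<Lambda> z x) * D\<^sub>x \<Lambda> z x"
      by eventually_elim (simp add: power2_eq_square mult.assoc mult_right_mono)
  qed
  also have "\<dots> = L2_inner \<Lambda> h (D\<^sub>x \<Lambda> z)" using z zX by (simp add: solves_def L2_inner_def)
  also have "\<dots> \<le> L2_norm \<Lambda> h * ?d" using L2.Cauchy_Schwarz[OF h D] by simp
  finally have "(m * ?d) * (m * ?d) \<le> L2_norm \<Lambda> h * (m * ?d)"
    using m by (simp add: power2_eq_square mult_ac)
  then have "m * ?d \<le> L2_norm \<Lambda> h" by (rule le_if_mult_self_le[rotated 2]) (use m in auto)
  then have "?d \<le> L2_norm \<Lambda> h / m" using m by (simp add: pos_le_divide_eq mult.commute)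
  then have "(1 + \<Lambda>) * ?d \<le> (1 + \<Lambda>) * (L2_norm \<Lambda> h / m)" using \<Lambda>_pos by (intro mult_left_mono) auto
  then show ?thesis using H1_norm_le[OF zX] by simp
qed

lemma solves_diff:
  assumes a: "coefficient \<Lambda> m M \<nu>" and h: "h \<in> L2 \<Lambda>" "h' \<in> L2 \<Lambda>" and z: "solves \<nu> z h" "solves \<nu> z' h'"
  shows "solves \<nu> (\<lambda>x. z x - z' x) (\<lambda>x. h x - h' x)"
  unfolding solves_def
proof (intro conjI ballI)
  have zX: "z \<in> H10 \<Lambda>" "z' \<in> H10 \<Lambda>" using z by (auto simp: solves_def)
  show dX: "(\<lambda>x. z x - z' x) \<in> H10 \<Lambda>" by (rule H10.diff_mem[OF zX])
  fix \<phi> assume \<phi>: "\<phi> \<in> H10 \<Lambda>"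
  note D = DL[OF \<phi>] and aD = coefficient_mult(1)[OF a M_nonneg DL[OF zX(1)]] coefficient_mult(1)[OF a M_nonneg DL[OF zX(2)]]
  have "L2_inner \<Lambda> (\<lambda>x. \<nu> x * D\<^sub>x \<Lambda> (\<lambda>x. z x - z' x) x) (D\<^sub>x \<Lambda> \<phi>) =
    L2_inner \<Lambda> (\<lambda>x. \<nu> x * D\<^sub>x \<Lambda> z x - \<nu> x * D\<^sub>x \<Lambda> z' x) (D\<^sub>x \<Lambda> \<phi>)"
  proof (rule L2_cong_AE(2))
    show "AE x in dom_measure \<Lambda>. \<nu> x * D\<^sub>x \<Lambda> (\<lambda>x. z x - z' x) x = \<nu> x * D\<^sub>x \<Lambda> z x - \<nu> x * D\<^sub>x \<Lambda> z' x"
      using D_diff_AE[OF zX] by eventually_elim (simp add: right_diff_distrib)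
  qed (intro L2D(1) coefficient_mult[OF a M_nonneg] DL dX L2.diff_mem aD D)+
  then show "L2_inner \<Lambda> (\<lambda>x. \<nu> x * D\<^sub>x \<Lambda> (\<lambda>x. z x - z' x) x) (D\<^sub>x \<Lambda> \<phi>) = L2_inner \<Lambda> (\<lambda>x. h x - h' x) (D\<^sub>x \<Lambda> \<phi>)"
    using L2.ip_diff[OF aD D] L2.ip_diff[OF h D] z \<phi> by (simp add: solves_def)
qed

lemma solves_dist:
  assumes "coefficient \<Lambda> m M \<nu>" "h \<in> L2 \<Lambda>" "h' \<in> L2 \<Lambda>" "solves \<nu> z h" "solves \<nu> z' h'"
  shows "H1_norm \<Lambda> (\<lambda>x. z x - z' x) \<le> (1 + \<Lambda>) / m * L2_norm \<Lambda> (\<lambda>x. h x - h' x)"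
  by (rule energy[OF assms(1) L2.diff_mem[OF assms(2,3)] solves_diff[OF assms]])

lemma solves_ex:
  assumes a: "coefficient \<Lambda> m M \<nu>" and h: "h \<in> L2 \<Lambda>"
  shows "\<exists>z. solves \<nu> z h"
proof -
  have \<nu>m: "\<nu> \<in> borel_measurable (dom_measure \<Lambda>)" and m: "0 < m" and b: "AE x in dom_measure \<Lambda>. m \<le> \<nu> x \<and> \<nu> x \<le> M"
    using a by (auto simp: coefficient_def)
  have one: "(\<lambda>x. 1) \<in> L2 \<Lambda>" by (rule L2_const)
  let ?k = "\<lambda>x. 1 / \<nu> x"
  have km: "?k \<in> borel_measurable (dom_measure \<Lambda>)" using \<nu>m by measurable
  have kb: "AE x in dom_measure \<Lambda>. \<bar>?k x\<bar> \<le> 1 / m" using b by eventually_elim (use m in \<open>auto intro!: divide_left_mono\<close>)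
  note k_mult = L2_mult_bounded(1)[OF _ km kb]
  have kL: "?k \<in> L2 \<Lambda>" using L2_bounded[OF km kb] .
  \<comment> \<open>The mean of 1/\<nu> is about to become a divisor. Were it zero, 1/\<nu> would
    vanish almost everywhere on a domain of positive measure.\<close>
  have "L2_inner \<Lambda> ?k (\<lambda>x. 1) \<noteq> 0"
  proof
    assume z: "L2_inner \<Lambda> ?k (\<lambda>x. 1) = 0"
    have "AE x in dom_measure \<Lambda>. 0 \<le> ?k x" using b by eventually_elim (use m in auto)
    then have "AE x in dom_measure \<Lambda>. ?k x = 0"
      using z integral_nonneg_eq_0_iff_AE[OF L2_integrable[OF kL]] by (simp add: L2_inner_def)
    with b have "AE x in dom_measure \<Lambda>. False" by eventually_elim (use m in auto)
    then have "emeasure (dom_measure \<Lambda>) (space (dom_measure \<Lambda>)) = 0"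
      using AE_iff_measurable[of "space (dom_measure \<Lambda>)" "dom_measure \<Lambda>" "\<lambda>x. False"]
      by (simp add: atLeastAtMost_def atLeast_def atMost_def Collect_conj_eq)
    then show False using \<Lambda>_pos by (simp add: emeasure_restrict_space)
  qed
  then have k0: "L2_inner \<Lambda> ?k (\<lambda>x. 1) \<noteq> 0" .
  have khL: "(\<lambda>x. ?k x * h x) \<in> L2 \<Lambda>" using k_mult[OF h] m by simp
  define c where "c = L2_inner \<Lambda> (\<lambda>x. ?k x * h x) (\<lambda>x. 1) / L2_inner \<Lambda> ?k (\<lambda>x. 1)"
  let ?g = "\<lambda>x. 1 * (?k x * h x) + (- c) * ?k x"
  have gL: "?g \<in> L2 \<Lambda>" by (rule L2_lincomb[OF khL kL])
  have g0: "L2_inner \<Lambda> ?g (\<lambda>x. 1) = 0"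
    unfolding L2.ip_lincomb[OF khL kL one] using k0 by (simp add: c_def)
  note p = prim_H10[OF gL g0]
  have "solves \<nu> (prim \<Lambda> ?g) h"
    unfolding solves_def
  proof (intro conjI ballI p(1))
    fix \<phi> assume \<phi>: "\<phi> \<in> H10 \<Lambda>"
    note D = DL[OF \<phi>]
    \<comment> \<open>Multiplication by \<nu> returns h - c, and the constant disappears against a
      derivative of mean zero.\<close>
    have "L2_inner \<Lambda> (\<lambda>x. \<nu> x * D\<^sub>x \<Lambda> (prim \<Lambda> ?g) x) (D\<^sub>x \<Lambda> \<phi>) = L2_inner \<Lambda> (\<lambda>x. 1 * h x + (- c) * 1) (D\<^sub>x \<Lambda> \<phi>)"
    proof (rule L2_cong_AE(2))
      show "AE x in dom_measure \<Lambda>. \<nu> x * D\<^sub>x \<Lambda> (prim \<Lambda> ?g) x = 1 * h x + (- c) * 1"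
        using p(2) b by eventually_elim (use m in \<open>auto simp: field_simps\<close>)
    qed (intro L2D(1) coefficient_mult[OF a M_nonneg] DL p L2_lincomb h one D)+
    also have "\<dots> = 1 * L2_inner \<Lambda> h (D\<^sub>x \<Lambda> \<phi>) + (- c) * L2_inner \<Lambda> (\<lambda>x. 1) (D\<^sub>x \<Lambda> \<phi>)"
      by (rule L2.ip_lincomb[OF h one D])
    also have "L2_inner \<Lambda> (\<lambda>x. 1) (D\<^sub>x \<Lambda> \<phi>) = 0"
      using H10_mean[OF \<phi>] L2.ip_sym[OF one D] by simp
    finally show "L2_inner \<Lambda> (\<lambda>x. \<nu> x * D\<^sub>x \<Lambda> (prim \<Lambda> ?g) x) (D\<^sub>x \<Lambda> \<phi>) = L2_inner \<Lambda> h (D\<^sub>x \<Lambda> \<phi>)" by simp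
  qed
  then show ?thesis by blast
qed

end

definition weak_form :: "(real \<Rightarrow> real) \<Rightarrow> (real \<Rightarrow> real) \<Rightarrow> (real \<Rightarrow> real \<Rightarrow> real) \<Rightarrow>
    (real \<Rightarrow> real \<Rightarrow> real) \<Rightarrow> (real \<Rightarrow> real \<Rightarrow> real) \<Rightarrow> bool" where
  "weak_form E \<nu> f u v \<longleftrightarrow> (AE t in time_measure T. \<forall>\<phi>\<in>H10 \<Lambda>.
     L2_inner \<Lambda> (\<lambda>x. \<nu> x * D\<^sub>x \<Lambda> (v t) x) (D\<^sub>x \<Lambda> \<phi>) +
     L2_inner \<Lambda> (\<lambda>x. E x * D\<^sub>x \<Lambda> (u t) x) (D\<^sub>x \<Lambda> \<phi>) = L2_inner \<Lambda> (f t) \<phi>)"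

text \<open>Trades the distributional time derivative for the tested integral identity, to which the
  Picard and Gronwall results apply.\<close>

lemma kv_solution_iff:
  "kv_solution \<Lambda> T E \<nu> f us u \<longleftrightarrow> H10.CX u \<and> (AE x in dom_measure \<Lambda>. u 0 x = us x) \<and>
     (\<exists>v. H10.L2X v \<and> H10.weak_integral (u 0) v u \<and> weak_form E \<nu> f u v)"
proof -
  have 1: "u \<in> C_H10 \<Lambda> T \<longleftrightarrow> H10.CX u" by (simp add: C_H10_def H10.CX_def)
  have 2: "v \<in> L2_H10 \<Lambda> T \<longleftrightarrow> H10.L2X v" for v
  proof -
    have "integrable (time_measure T) (\<lambda>t. (H1_norm \<Lambda> (v t))\<^sup>2) \<longleftrightarrow> (\<lambda>t. H1_norm \<Lambda> (v t)) \<in> L2 T"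
      if "H10.SM v"
    proof -
      have m: "(\<lambda>t. H1_norm \<Lambda> (v t)) \<in> borel_measurable (dom_measure T)"
        using H10.SM_N_measurable[OF that] by (simp add: measurable_time_iff)
      then have "(\<lambda>t. (H1_norm \<Lambda> (v t))\<^sup>2) \<in> borel_measurable (dom_measure T)" by measurable
      from integral_time_eq(2)[OF this] m show ?thesis by (simp add: L2_def)
    qed
    then show ?thesis by (auto simp: L2_H10_def H10.L2X_def)
  qed
  have 3: "time_deriv \<Lambda> T u v \<longleftrightarrow> H10.weak_time_deriv u v" for v
    by (simp add: time_deriv_def H10.weak_time_deriv_def)
  have 4: "H10.weak_time_deriv u v \<longleftrightarrow> H10.weak_integral (u 0) v u" if "H10.CX u" "H10.L2X v" for v
    using H10.weak_time_deriv_imp_weak_integral[OF that] H10.weak_integral_imp_weak_time_deriv[OF _ that(2)] by blast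
  have "kv_solution \<Lambda> T E \<nu> f us u \<longleftrightarrow> H10.CX u \<and> (AE x in dom_measure \<Lambda>. u 0 x = us x) \<and>
      (\<exists>v. H10.L2X v \<and> H10.weak_time_deriv u v \<and> weak_form E \<nu> f u v)"
    by (simp only: kv_solution_def weak_form_def L2_inner_def 1 2 3 Bex_def)
  then show ?thesis using 4 by blast
qed

end

section \<open>Change of the coefficients: existence, stability and convergence\<close>

lemma coefficient_diff:
  assumes "coefficient \<Lambda> m M a" "coefficient \<Lambda> m M b"
  shows "(\<lambda>x. a x - b x) \<in> borel_measurable (dom_measure \<Lambda>)" "AE x in dom_measure \<Lambda>. \<bar>a x - b x\<bar> \<le> M"
proof -
  have [measurable]: "a \<in> borel_measurable (dom_measure \<Lambda>)" "b \<in> borel_measurable (dom_measure \<Lambda>)" and m: "0 < m"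
    using assms by (auto simp: coefficient_def)
  show "(\<lambda>x. a x - b x) \<in> borel_measurable (dom_measure \<Lambda>)" by measurable
  have "AE x in dom_measure \<Lambda>. m \<le> a x \<and> a x \<le> M" "AE x in dom_measure \<Lambda>. m \<le> b x \<and> b x \<le> M"
    using assms unfolding coefficient_def by blast+
  then show "AE x in dom_measure \<Lambda>. \<bar>a x - b x\<bar> \<le> M" by eventually_elim (use m in auto)
qed

context kv_domain
begin

lemma coefficient_flux:
  assumes "coefficient \<Lambda> m M E" "coefficient \<Lambda> m M \<nu>" "0 \<le> M" "a \<in> H10 \<Lambda>" "b \<in> H10 \<Lambda>"
  shows "(\<lambda>x. \<nu> x * D\<^sub>x \<Lambda> a x + E x * D\<^sub>x \<Lambda> b x) \<in> L2 \<Lambda>"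
  by (intro L2.add_mem coefficient_mult(1)[OF assms(2,3)] coefficient_mult(1)[OF assms(1,3)] DL assms)

lemma flux_Lipschitz:
  assumes "coefficient \<Lambda> m M a" "0 \<le> M" "z \<in> H10 \<Lambda>" "w \<in> H10 \<Lambda>"
  shows "L2_norm \<Lambda> (\<lambda>x. a x * D\<^sub>x \<Lambda> z x - a x * D\<^sub>x \<Lambda> w x) \<le> M * H1_norm \<Lambda> (\<lambda>x. z x - w x)"
proof -
  have "L2_norm \<Lambda> (\<lambda>x. a x * (D\<^sub>x \<Lambda> z x - D\<^sub>x \<Lambda> w x)) \<le> M * L2_norm \<Lambda> (\<lambda>x. D\<^sub>x \<Lambda> z x - D\<^sub>x \<Lambda> w x)"
    by (intro coefficient_mult(2)[OF assms(1,2)] L2.diff_mem DL assms)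
  also have "\<dots> \<le> M * H1_norm \<Lambda> (\<lambda>x. z x - w x)"
    by (intro mult_left_mono D_diff_norm assms)
  finally show ?thesis by (simp add: right_diff_distrib)
qed

text \<open>The initial value of an integral agrees with the base point up to norm zero, so the base
  point may be replaced by \<open>u 0\<close>, as in \<open>kv_solution_iff\<close>.\<close>

lemma weak_integral_start:
  assumes "H10.weak_integral u0 v u" "u0 \<in> H10 \<Lambda>"
  shows "H1_norm \<Lambda> (\<lambda>x. u 0 x - u0 x) = 0" "H10.weak_integral (u 0) v u"
proof -
  have 0: "0 \<in> {0..T}" using T_pos' by simp
  note u = H10.weak_integralD[OF assms(1) 0]
  have e: "H1_inner \<Lambda> (u 0) w = H1_inner \<Lambda> u0 w" if "w \<in> H10 \<Lambda>" for w
    using u(2)[OF that] by (simp add: prim_0)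
  have d: "(\<lambda>x. u 0 x - u0 x) \<in> H10 \<Lambda>" by (rule H10.diff_mem[OF u(1) assms(2)])
  show "H1_norm \<Lambda> (\<lambda>x. u 0 x - u0 x) = 0"
    using H10.N_eq[OF d] H10.ip_diff[OF u(1) assms(2) d] e[OF d] by simp
  show "H10.weak_integral (u 0) v u"
    unfolding H10.weak_integral_def
  proof (intro ballI conjI)
    fix t assume t: "t \<in> {0..T}"
    show "u t \<in> H10 \<Lambda>" by (rule H10.weak_integralD(1)[OF assms(1) t])
    fix w assume w: "w \<in> H10 \<Lambda>"
    show "H1_inner \<Lambda> (u t) w = H1_inner \<Lambda> (u 0) w + prim T (\<lambda>s. H1_inner \<Lambda> (v s) w) t"
      using H10.weak_integralD(2)[OF assms(1) t w] e[OF w] by simp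
  qed
qed

lemma H1_norm_zero_AE:
  assumes "a \<in> H10 \<Lambda>" "b \<in> H10 \<Lambda>" "H1_norm \<Lambda> (\<lambda>x. a x - b x) = 0"
  shows "AE x in dom_measure \<Lambda>. a x = b x"
proof -
  have "L2_norm \<Lambda> (\<lambda>x. a x - b x) = 0"
    using L2_le_H1(1)[of \<Lambda> "\<lambda>x. a x - b x"] assms(3) L2_norm_nonneg[of \<Lambda> "\<lambda>x. a x - b x"] by linarith
  from L2_norm_zero_AE[OF H1_L2[OF H10_H1[OF H10.diff_mem[OF assms(1,2)]]] this]
  show ?thesis by eventually_elim simp
qed

text \<open>The total stress \<open>G\<close> of the given solution carries the forcing, so
  existence passes from one pair of coefficients to another. The Lipschitz constant C M combines the
  energy bound of the elliptic problem with the upper bound of the coefficients.\<close>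

lemma kv_existence:
  assumes c: "coefficient \<Lambda> m M E" "coefficient \<Lambda> m M \<nu>" "coefficient \<Lambda> m M E'" "coefficient \<Lambda> m M \<nu>'"
    and M: "0 < M" and u: "kv_solution \<Lambda> T E \<nu> f us u"
  shows "\<exists>u'. kv_solution \<Lambda> T E' \<nu>' f us u'"
proof -
  obtain v where uC: "H10.CX u" and us: "AE x in dom_measure \<Lambda>. u 0 x = us x" and v: "H10.L2X v"
    and eq: "weak_form E \<nu> f u v"
    using u unfolding kv_solution_iff by blast
  have M0: "0 \<le> M" and m: "0 < m" using M c by (auto simp: coefficient_def)
  define C where "C = (1 + \<Lambda>) / m"
  have C: "0 < C" using \<Lambda>_pos m by (simp add: C_def)
  \<comment> \<open>\<open>R\<close> merely selects solutions and need not be linear as a map of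
    functions; \<open>solves_dist\<close> and \<open>solves_diff\<close> take the place of
    linearity.\<close>
  obtain R where R: "\<And>h. h \<in> L2 \<Lambda> \<Longrightarrow> solves \<nu>' (R h) h"
    using solves_ex[OF M0 c(4)] by metis
  have RX: "R h \<in> H10 \<Lambda>" if "h \<in> L2 \<Lambda>" for h using R[OF that] by (simp add: solves_def)
  have RL: "H1_norm \<Lambda> (\<lambda>x. R h x - R h' x) \<le> C * L2_norm \<Lambda> (\<lambda>x. h x - h' x)" if "h \<in> L2 \<Lambda>" "h' \<in> L2 \<Lambda>" for h h'
    unfolding C_def by (rule solves_dist[OF M0 c(4) that R[OF that(1)] R[OF that(2)]])
  define G where "G a b = (\<lambda>x. \<nu> x * D\<^sub>x \<Lambda> a x + E x * D\<^sub>x \<Lambda> b x)" for a b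
  define F where "F a = R (\<lambda>x. E' x * D\<^sub>x \<Lambda> a x)" for a
  have GL: "G a b \<in> L2 \<Lambda>" if "a \<in> H10 \<Lambda>" "b \<in> H10 \<Lambda>" for a b
    unfolding G_def by (rule coefficient_flux[OF c(1,2) M0 that])
  have E'L: "(\<lambda>x. E' x * D\<^sub>x \<Lambda> a x) \<in> L2 \<Lambda>" if "a \<in> H10 \<Lambda>" for a
    by (rule coefficient_mult(1)[OF c(3) M0 DL[OF that]])
  have FX: "F a \<in> H10 \<Lambda>" if "a \<in> H10 \<Lambda>" for a unfolding F_def by (rule RX[OF E'L[OF that]])
  have FL: "H1_norm \<Lambda> (\<lambda>x. F a x - F b x) \<le> (C * M) * H1_norm \<Lambda> (\<lambda>x. a x - b x)"
    if "a \<in> H10 \<Lambda>" "b \<in> H10 \<Lambda>" for a b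
  proof -
    have "H1_norm \<Lambda> (\<lambda>x. F a x - F b x) \<le> C * L2_norm \<Lambda> (\<lambda>x. E' x * D\<^sub>x \<Lambda> a x - E' x * D\<^sub>x \<Lambda> b x)"
      unfolding F_def by (rule RL[OF E'L[OF that(1)] E'L[OF that(2)]])
    also have "\<dots> \<le> C * (M * H1_norm \<Lambda> (\<lambda>x. a x - b x))"
      using C by (intro mult_left_mono flux_Lipschitz[OF c(3) M0 that]) auto
    finally show ?thesis by simp
  qed
  have GLip: "H1_norm \<Lambda> (\<lambda>x. R (G a b) x - R (G a' b') x) \<le> (C * M) * (H1_norm \<Lambda> (\<lambda>x. a x - a' x) + H1_norm \<Lambda> (\<lambda>x. b x - b' x))"
    if X: "a \<in> H10 \<Lambda>" "b \<in> H10 \<Lambda>" "a' \<in> H10 \<Lambda>" "b' \<in> H10 \<Lambda>" for a b a' b'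
  proof -
    let ?p = "\<lambda>x. \<nu> x * D\<^sub>x \<Lambda> a x - \<nu> x * D\<^sub>x \<Lambda> a' x" and ?q = "\<lambda>x. E x * D\<^sub>x \<Lambda> b x - E x * D\<^sub>x \<Lambda> b' x"
    have pq: "?p \<in> L2 \<Lambda>" "?q \<in> L2 \<Lambda>"
      by (intro L2.diff_mem coefficient_mult(1)[OF c(2) M0] coefficient_mult(1)[OF c(1) M0] DL X)+
    have "(\<lambda>x. G a b x - G a' b' x) = (\<lambda>x. ?p x + ?q x)" by (simp add: G_def algebra_simps)
    then have "L2_norm \<Lambda> (\<lambda>x. G a b x - G a' b' x) \<le> L2_norm \<Lambda> ?p + L2_norm \<Lambda> ?q"
      using L2.N_triangle[OF pq] by simp
    also have "\<dots> \<le> M * H1_norm \<Lambda> (\<lambda>x. a x - a' x) + M * H1_norm \<Lambda> (\<lambda>x. b x - b' x)"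
      by (intro add_mono flux_Lipschitz[OF c(2) M0] flux_Lipschitz[OF c(1) M0] X)
    finally have "C * L2_norm \<Lambda> (\<lambda>x. G a b x - G a' b' x) \<le> C * (M * H1_norm \<Lambda> (\<lambda>x. a x - a' x) + M * H1_norm \<Lambda> (\<lambda>x. b x - b' x))"
      using C by (intro mult_left_mono) auto
    with RL[OF GL[OF X(1,2)] GL[OF X(3,4)]] show ?thesis by (simp add: algebra_simps)
  qed
  define q where "q t = R (G (v t) (u t))" for t
  have qL: "H10.L2X q"
  proof (rule H10.L2X_I)
    show "H10.SM q"
      unfolding q_def by (rule H10.SM_map2[OF H10.L2X_SM[OF v] H10.CX_SM[OF uC], where F="\<lambda>a b. R (G a b)", OF RX[OF GL] GLip])
    let ?z = "\<lambda>x::real. 0::real"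
    show "(\<lambda>t. 1 * H1_norm \<Lambda> (R (G ?z ?z)) + 1 * ((C * M) * H1_norm \<Lambda> (v t) + (C * M) * H1_norm \<Lambda> (u t))) \<in> L2 T"
      using v H10.CX_L2X[OF uC] by (intro L2_lincomb L2_const) (auto simp: H10.L2X_def)
    fix t assume t: "t \<in> {0<..<T}"
    note X = H10.L2X_mem[OF v t] H10.L2X_mem[OF H10.CX_L2X[OF uC] t] H10.zero_mem
    show "H1_norm \<Lambda> (q t) \<le> 1 * H1_norm \<Lambda> (R (G ?z ?z)) + 1 * ((C * M) * H1_norm \<Lambda> (v t) + (C * M) * H1_norm \<Lambda> (u t))"
      using H10.N_triangle_diff[OF RX[OF GL[OF X(1,2)]] RX[OF GL[OF X(3,3)]]] GLip[OF X(1,2,3,3)]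
      by (simp add: q_def algebra_simps)
  qed
  have u0: "u 0 \<in> H10 \<Lambda>" using H10.CX_mem[OF uC, of 0] T_pos' by simp
  have "0 < C * M" using C M by simp
  from H10.picard[OF qL u0 FX this FL]
  obtain u' where w': "H10.weak_integral (u 0) (\<lambda>t x. q t x - F (u' t) x) u'" and v': "H10.L2X (\<lambda>t x. q t x - F (u' t) x)"
    by blast
  have u'C: "H10.CX u'" by (rule H10.weak_integral_CX[OF w' v'])
  note start = weak_integral_start[OF w' u0]
  have u'0: "u' 0 \<in> H10 \<Lambda>" using H10.CX_mem[OF u'C, of 0] T_pos' by simp
  have "kv_solution \<Lambda> T E' \<nu>' f us u'"
    unfolding kv_solution_iff
  proof (intro conjI exI)
    show "H10.CX u'" by (rule u'C)
    show "AE x in dom_measure \<Lambda>. u' 0 x = us x"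
      using H1_norm_zero_AE[OF u'0 u0 start(1)] us by eventually_elim simp
    show "H10.L2X (\<lambda>t x. q t x - F (u' t) x)" by (rule v')
    show "H10.weak_integral (u' 0) (\<lambda>t x. q t x - F (u' t) x) u'" by (rule start(2))
    show "weak_form E' \<nu>' f u' (\<lambda>t x. q t x - F (u' t) x)"
      unfolding weak_form_def
      using eq[unfolded weak_form_def] AE_space
    proof eventually_elim
      case (elim t)
      then have t: "t \<in> {0<..<T}" by simp
      note X = H10.L2X_mem[OF v t] H10.L2X_mem[OF H10.CX_L2X[OF uC] t] H10.L2X_mem[OF H10.CX_L2X[OF u'C] t]
      have s: "solves \<nu>' (\<lambda>x. q t x - F (u' t) x) (\<lambda>x. G (v t) (u t) x - E' x * D\<^sub>x \<Lambda> (u' t) x)"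
        unfolding q_def F_def
        by (rule solves_diff[OF M0 c(4) GL[OF X(1,2)] E'L[OF X(3)] R[OF GL[OF X(1,2)]] R[OF E'L[OF X(3)]]])
      show ?case
      proof
        fix \<phi> assume \<phi>: "\<phi> \<in> H10 \<Lambda>"
        have nu: "(\<lambda>x. \<nu> x * D\<^sub>x \<Lambda> (v t) x) \<in> L2 \<Lambda>" "(\<lambda>x. E x * D\<^sub>x \<Lambda> (u t) x) \<in> L2 \<Lambda>"
          by (intro coefficient_mult(1)[OF c(2) M0] coefficient_mult(1)[OF c(1) M0] DL X)+
        have "L2_inner \<Lambda> (\<lambda>x. \<nu>' x * D\<^sub>x \<Lambda> (\<lambda>x. q t x - F (u' t) x) x) (D\<^sub>x \<Lambda> \<phi>) =
            L2_inner \<Lambda> (G (v t) (u t)) (D\<^sub>x \<Lambda> \<phi>) - L2_inner \<Lambda> (\<lambda>x. E' x * D\<^sub>x \<Lambda> (u' t) x) (D\<^sub>x \<Lambda> \<phi>)"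
          using s \<phi> L2.ip_diff[OF GL[OF X(1,2)] E'L[OF X(3)] DL[OF \<phi>]] by (simp add: solves_def)
        moreover have "L2_inner \<Lambda> (G (v t) (u t)) (D\<^sub>x \<Lambda> \<phi>) = L2_inner \<Lambda> (f t) \<phi>"
          unfolding G_def L2.ip_add[OF nu DL[OF \<phi>]] using elim(1) \<phi> by blast
        ultimately show "L2_inner \<Lambda> (\<lambda>x. \<nu>' x * D\<^sub>x \<Lambda> (\<lambda>x. q t x - F (u' t) x) x) (D\<^sub>x \<Lambda> \<phi>) +
          L2_inner \<Lambda> (\<lambda>x. E' x * D\<^sub>x \<Lambda> (u' t) x) (D\<^sub>x \<Lambda> \<phi>) = L2_inner \<Lambda> (f t) \<phi>" by simp
      qed
    qed
  qed
  then show ?thesis by blast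
qed

text \<open>Size of the stress error that a coefficient error \<alpha> causes on the strain of
  \<open>a\<close>.\<close>

definition defect :: "(real \<Rightarrow> real) \<Rightarrow> (real \<Rightarrow> real) \<Rightarrow> real" where
  "defect \<alpha> a = L2_norm \<Lambda> (\<lambda>x. \<alpha> x * D\<^sub>x \<Lambda> a x)"

context
  fixes \<alpha> :: "real \<Rightarrow> real" and M :: real
  assumes \<alpha>m: "\<alpha> \<in> borel_measurable (dom_measure \<Lambda>)"
    and \<alpha>b: "AE x in dom_measure \<Lambda>. \<bar>\<alpha> x\<bar> \<le> M" and M0: "0 \<le> M"
begin

lemma defect_mult: "h \<in> L2 \<Lambda> \<Longrightarrow> (\<lambda>x. \<alpha> x * h x) \<in> L2 \<Lambda>" "h \<in> L2 \<Lambda> \<Longrightarrow> L2_norm \<Lambda> (\<lambda>x. \<alpha> x * h x) \<le> M * L2_norm \<Lambda> h"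
  by (rule L2_mult_bounded[OF _ \<alpha>m \<alpha>b M0], assumption)+

lemma defect_le: "a \<in> H10 \<Lambda> \<Longrightarrow> defect \<alpha> a \<le> M * H1_norm \<Lambda> a"
  unfolding defect_def
  by (rule order.trans[OF defect_mult(2)[OF DL] mult_left_mono[OF L2_le_H1(2) M0]])

lemma defect_L2:
  assumes "H10.L2X v" shows "(\<lambda>t. defect \<alpha> (v t)) \<in> L2 T"
proof -
  have "(\<lambda>t. defect \<alpha> (v t)) \<in> borel_measurable (time_measure T)"
  proof (rule H10.SM_Lipschitz_measurable[OF H10.L2X_SM[OF assms], where C=M])
    fix a b assume X: "a \<in> H10 \<Lambda>" "b \<in> H10 \<Lambda>"
    have "\<bar>defect \<alpha> a - defect \<alpha> b\<bar> \<le> L2_norm \<Lambda> (\<lambda>x. \<alpha> x * D\<^sub>x \<Lambda> a x - \<alpha> x * D\<^sub>x \<Lambda> b x)"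
      unfolding defect_def by (intro L2.N_abs_diff defect_mult DL X)
    also have "\<dots> = L2_norm \<Lambda> (\<lambda>x. \<alpha> x * (D\<^sub>x \<Lambda> a x - D\<^sub>x \<Lambda> b x))" by (simp add: right_diff_distrib)
    also have "\<dots> \<le> M * L2_norm \<Lambda> (\<lambda>x. D\<^sub>x \<Lambda> a x - D\<^sub>x \<Lambda> b x)" by (intro defect_mult L2.diff_mem DL X)
    also have "\<dots> \<le> M * H1_norm \<Lambda> (\<lambda>x. a x - b x)" by (intro mult_left_mono D_diff_norm X M0)
    finally show "\<bar>defect \<alpha> a - defect \<alpha> b\<bar> \<le> M * H1_norm \<Lambda> (\<lambda>x. a x - b x)" .
  qed
  then have m: "(\<lambda>t. defect \<alpha> (v t)) \<in> borel_measurable (dom_measure T)" by (simp add: measurable_time_iff)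
  have NL: "(\<lambda>t. H1_norm \<Lambda> (v t)) \<in> L2 T" using assms by (simp add: H10.L2X_def)
  show ?thesis
  proof (rule L2_mono(1)[OF L2.scale_mem[OF NL, of M] m])
    show "AE t in dom_measure T. \<bar>defect \<alpha> (v t)\<bar> \<le> \<bar>M * H1_norm \<Lambda> (v t)\<bar>"
    proof (rule H10.AE_dom)
      fix t assume "t \<in> {0<..<T}"
      from defect_le[OF H10.L2X_mem[OF assms this]]
      show "\<bar>defect \<alpha> (v t)\<bar> \<le> \<bar>M * H1_norm \<Lambda> (v t)\<bar>" by (simp add: defect_def)
    qed
  qed
qed

end

text \<open>Dominated convergence twice: in space at each time, with \<open>M\<close> times the
  modulus of the strain as majorant, and then in time, with \<open>M\<close> times the H1
  norm.\<close>

lemma defect_tendsto: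
  assumes \<alpha>: "\<And>n. \<alpha> n \<in> borel_measurable (dom_measure \<Lambda>)" "\<And>n. AE x in dom_measure \<Lambda>. \<bar>\<alpha> n x\<bar> \<le> M"
    and M0: "0 \<le> M" and lim: "AE x in dom_measure \<Lambda>. (\<lambda>n. \<alpha> n x) \<longlonglongrightarrow> 0" and v: "H10.L2X v"
  shows "(\<lambda>n. prim T (\<lambda>t. defect (\<alpha> n) (v t)) T) \<longlonglongrightarrow> 0"
proof -
  note dL = defect_L2[OF \<alpha> M0 v]
  have NL: "(\<lambda>t. H1_norm \<Lambda> (v t)) \<in> L2 T" using v by (simp add: H10.L2X_def)
  have "(\<lambda>n. LINT t|dom_measure T. defect (\<alpha> n) (v t)) \<longlonglongrightarrow> (LINT t|dom_measure T. 0)"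
  proof (rule integral_dominated_convergence[where w="\<lambda>t. M * H1_norm \<Lambda> (v t)"])
    show "(\<lambda>t. defect (\<alpha> n) (v t)) \<in> borel_measurable (dom_measure T)" for n by (rule L2D(1)[OF dL])
    show "integrable (dom_measure T) (\<lambda>t. M * H1_norm \<Lambda> (v t))" by (rule L2_integrable[OF L2.scale_mem[OF NL]])
    show "AE t in dom_measure T. (\<lambda>n. defect (\<alpha> n) (v t)) \<longlonglongrightarrow> 0"
    proof (rule H10.AE_dom)
      fix t assume "t \<in> {0<..<T}"
      then have D: "D\<^sub>x \<Lambda> (v t) \<in> L2 \<Lambda>" by (intro DL H10.L2X_mem[OF v])
      note [measurable] = L2D(1)[OF D] \<alpha>(1)
      have "(\<lambda>n. L2_norm \<Lambda> (\<lambda>x. \<alpha> n x * D\<^sub>x \<Lambda> (v t) x - 0)) \<longlonglongrightarrow> 0"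
      proof (rule L2_dominated(3)[where w="\<lambda>x. \<bar>M * D\<^sub>x \<Lambda> (v t) x\<bar>"])
        show "(\<lambda>x. \<bar>M * D\<^sub>x \<Lambda> (v t) x\<bar>) \<in> L2 \<Lambda>"
          by (rule L2_mono(1)[OF L2.scale_mem[OF D, of M]]) auto
        show "AE x in dom_measure \<Lambda>. (\<lambda>n. \<alpha> n x * D\<^sub>x \<Lambda> (v t) x) \<longlonglongrightarrow> 0"
          using lim by eventually_elim (rule tendsto_mult_left_zero)
        show "AE x in dom_measure \<Lambda>. \<bar>\<alpha> n x * D\<^sub>x \<Lambda> (v t) x\<bar> \<le> \<bar>M * D\<^sub>x \<Lambda> (v t) x\<bar>" for n
          using \<alpha>(2)[of n] by eventually_elim (use M0 in \<open>simp add: abs_mult mult_right_mono\<close>)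
      qed measurable
      then show "(\<lambda>n. defect (\<alpha> n) (v t)) \<longlonglongrightarrow> 0" by (simp add: defect_def)
    qed
    fix n
    show "AE t in dom_measure T. norm (defect (\<alpha> n) (v t)) \<le> M * H1_norm \<Lambda> (v t)"
    proof (rule H10.AE_dom)
      fix t assume "t \<in> {0<..<T}"
      from defect_le[OF \<alpha> M0 H10.L2X_mem[OF v this], of n]
      show "norm (defect (\<alpha> n) (v t)) \<le> M * H1_norm \<Lambda> (v t)" by (simp add: defect_def)
    qed
  qed simp
  then show ?thesis by (simp add: prim_end L2_inner_def)
qed

text \<open>Both velocities are regarded as solutions of the elliptic problem with viscosity \<nu>':
  \<open>v'\<close> because the forcing cancels between the two weak forms, and \<open>v\<close>
  trivially, with \<nu>' times its own strain as right side. \<open>solves_dist\<close> compares the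
  two right sides.\<close>

lemma kv_stability:
  assumes c: "coefficient \<Lambda> m M E" "coefficient \<Lambda> m M \<nu>" "coefficient \<Lambda> m M E'" "coefficient \<Lambda> m M \<nu>'"
    and M: "0 < M" and u': "kv_solution \<Lambda> T E' \<nu>' f us u'"
    and uC: "H10.CX u" and us: "AE x in dom_measure \<Lambda>. u 0 x = us x" and v: "H10.L2X v" and w: "H10.weak_integral (u 0) v u"
    and eq: "weak_form E \<nu> f u v"
    and t: "t \<in> {0..T}"
  defines "C \<equiv> (1 + \<Lambda>) / m"
  shows "H1_norm \<Lambda> (\<lambda>x. u' t x - u t x) \<le> 2 * exp (2 * (C * M) * T) *
     (C * (prim T (\<lambda>s. defect (\<lambda>x. \<nu> x - \<nu>' x) (v s)) T + prim T (\<lambda>s. defect (\<lambda>x. E x - E' x) (u s)) T))"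
proof -
  obtain v' where u'C: "H10.CX u'" and us': "AE x in dom_measure \<Lambda>. u' 0 x = us x" and v': "H10.L2X v'"
    and w': "H10.weak_integral (u' 0) v' u'"
    and eq': "weak_form E' \<nu>' f u' v'"
    using u' unfolding kv_solution_iff by blast
  have M0: "0 \<le> M" and m: "0 < m" using M c by (auto simp: coefficient_def)
  have C: "0 < C" using \<Lambda>_pos m by (simp add: C_def)
  let ?\<alpha> = "\<lambda>x. \<nu> x - \<nu>' x" and ?\<beta> = "\<lambda>x. E x - E' x"
  note \<alpha> = coefficient_diff[OF c(2,4)] and \<beta> = coefficient_diff[OF c(1,3)]
  note \<alpha>L = defect_L2[OF \<alpha> M0 v] and \<beta>L = defect_L2[OF \<beta> M0 H10.CX_L2X[OF uC]]
  let ?r = "\<lambda>s. C * defect ?\<alpha> (v s) + C * defect ?\<beta> (u s)"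
  have 0: "0 \<in> {0..T}" using T_pos' by simp
  note X0 = H10.CX_mem[OF u'C 0] H10.CX_mem[OF uC 0]
  have "H1_norm \<Lambda> (\<lambda>x. u' t x - u t x) \<le> 2 * exp (2 * (C * M) * T) * prim T ?r T"
  proof (rule H10.weak_integral_stability[OF w' w v' v X0 _ _ _ _ _ t])
    show "H1_norm \<Lambda> (\<lambda>x. u' 0 x - u 0 x) = 0"
    proof (rule H1_norm_AE_zero[OF H10_H1[OF H10.diff_mem[OF X0]]])
      show "AE x in dom_measure \<Lambda>. u' 0 x - u 0 x = 0" using us us' by eventually_elim simp
    qed
    show "0 < C * M" using C M by simp
    show "?r \<in> L2 T" by (rule L2_lincomb[OF \<alpha>L \<beta>L])
    show "AE s in dom_measure T. 0 \<le> ?r s" using C by (simp add: defect_def)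
    show "AE s in dom_measure T. H1_norm \<Lambda> (\<lambda>x. v' s x - v s x) \<le> C * M * H1_norm \<Lambda> (\<lambda>x. u' s x - u s x) + ?r s"
      unfolding AE_time_iff[symmetric]
      using eq[unfolded weak_form_def] eq'[unfolded weak_form_def] AE_space
    proof eventually_elim
      case (elim s)
      then have s: "s \<in> {0<..<T}" by simp
      note X = H10.L2X_mem[OF v s] H10.L2X_mem[OF H10.CX_L2X[OF uC] s] H10.L2X_mem[OF v' s] H10.L2X_mem[OF H10.CX_L2X[OF u'C] s]
      note D = DL[OF X(1)] DL[OF X(2)] DL[OF X(3)] DL[OF X(4)]
      note cm = coefficient_mult(1)[OF _ M0]
      note L = cm[OF c(2) D(1)] cm[OF c(1) D(2)] cm[OF c(4) D(3)] cm[OF c(3) D(4)] cm[OF c(4) D(1)] cm[OF c(3) D(2)]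
      let ?h = "\<lambda>x. (\<nu> x * D\<^sub>x \<Lambda> (v s) x + E x * D\<^sub>x \<Lambda> (u s) x) - E' x * D\<^sub>x \<Lambda> (u' s) x"
      have hL: "?h \<in> L2 \<Lambda>" by (intro L2.diff_mem L2.add_mem L)
      have "solves \<nu>' (v' s) ?h"
        unfolding solves_def
      proof (intro conjI ballI X)
        fix \<phi> assume \<phi>: "\<phi> \<in> H10 \<Lambda>"
        have "L2_inner \<Lambda> (\<lambda>x. \<nu> x * D\<^sub>x \<Lambda> (v s) x) (D\<^sub>x \<Lambda> \<phi>) + L2_inner \<Lambda> (\<lambda>x. E x * D\<^sub>x \<Lambda> (u s) x) (D\<^sub>x \<Lambda> \<phi>) = L2_inner \<Lambda> (f s) \<phi>"
          by (rule bspec[OF elim(1) \<phi>])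
        moreover have "L2_inner \<Lambda> (\<lambda>x. \<nu>' x * D\<^sub>x \<Lambda> (v' s) x) (D\<^sub>x \<Lambda> \<phi>) + L2_inner \<Lambda> (\<lambda>x. E' x * D\<^sub>x \<Lambda> (u' s) x) (D\<^sub>x \<Lambda> \<phi>) = L2_inner \<Lambda> (f s) \<phi>"
          by (rule bspec[OF elim(2) \<phi>])
        ultimately show "L2_inner \<Lambda> (\<lambda>x. \<nu>' x * D\<^sub>x \<Lambda> (v' s) x) (D\<^sub>x \<Lambda> \<phi>) = L2_inner \<Lambda> ?h (D\<^sub>x \<Lambda> \<phi>)"
          unfolding L2.ip_diff[OF L2.add_mem[OF L(1,2)] L(4) DL[OF \<phi>]] L2.ip_add[OF L(1,2) DL[OF \<phi>]] by linarith
      qed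
      moreover have "solves \<nu>' (v s) (\<lambda>x. \<nu>' x * D\<^sub>x \<Lambda> (v s) x)"
        using X by (simp add: solves_def)
      ultimately have "H1_norm \<Lambda> (\<lambda>x. v' s x - v s x) \<le> C * L2_norm \<Lambda> (\<lambda>x. ?h x - \<nu>' x * D\<^sub>x \<Lambda> (v s) x)"
        unfolding C_def by (intro solves_dist[OF M0 c(4) hL L(5)])
      \<comment> \<open>Regrouped so that coefficient differences meet only the fixed
        \<open>v\<close> and \<open>u\<close>; the last bracket is Lipschitz in the displacement
        difference and is left to Gronwall.\<close>
      also have "(\<lambda>x. ?h x - \<nu>' x * D\<^sub>x \<Lambda> (v s) x) =
          (\<lambda>x. (?\<alpha> x * D\<^sub>x \<Lambda> (v s) x + ?\<beta> x * D\<^sub>x \<Lambda> (u s) x) - (E' x * D\<^sub>x \<Lambda> (u' s) x - E' x * D\<^sub>x \<Lambda> (u s) x))"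
        by (simp add: algebra_simps)
      also have "C * L2_norm \<Lambda> \<dots> \<le> C * ((defect ?\<alpha> (v s) + defect ?\<beta> (u s)) + M * H1_norm \<Lambda> (\<lambda>x. u' s x - u s x))"
      proof (rule mult_left_mono)
        note ab = defect_mult(1)[OF \<alpha> M0 D(1)] defect_mult(1)[OF \<beta> M0 D(2)]
        show "L2_norm \<Lambda> (\<lambda>x. (?\<alpha> x * D\<^sub>x \<Lambda> (v s) x + ?\<beta> x * D\<^sub>x \<Lambda> (u s) x) - (E' x * D\<^sub>x \<Lambda> (u' s) x - E' x * D\<^sub>x \<Lambda> (u s) x)) \<le>
            (defect ?\<alpha> (v s) + defect ?\<beta> (u s)) + M * H1_norm \<Lambda> (\<lambda>x. u' s x - u s x)"
          unfolding defect_def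
          using L2.N_le_add[OF L2.add_mem[OF ab] L2.diff_mem[OF L(4,6)]] L2.N_triangle[OF ab]
            flux_Lipschitz[OF c(3) M0 X(4,2)] by linarith
      qed (use C in simp)
      finally show ?case by (simp add: algebra_simps)
    qed
  qed
  also have "prim T ?r T = C * (prim T (\<lambda>s. defect ?\<alpha> (v s)) T + prim T (\<lambda>s. defect ?\<beta> (u s)) T)"
    by (simp add: prim_lincomb[OF \<alpha>L \<beta>L] distrib_left)
  finally show ?thesis .
qed

lemma Z_norm_le:
  assumes "H10.CX a" "H10.CX b" "\<And>t. t \<in> {0..T} \<Longrightarrow> H1_norm \<Lambda> (\<lambda>x. a t x - b t x) \<le> B"
  shows "Z_norm \<Lambda> T (\<lambda>t x. a t x - b t x) \<le> ereal B"
  unfolding Z_norm_def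
proof (rule esssup_I)
  have "(\<lambda>t. L2_norm \<Lambda> (\<lambda>x. a t x - b t x)) \<in> borel_measurable (time_measure T)"
  proof (rule H10.SM_Lipschitz_measurable[OF H10.CX_SM[OF H10.CX_diff[OF assms(1,2)]], where C=1])
    fix c d assume "c \<in> H10 \<Lambda>" "d \<in> H10 \<Lambda>"
    then have "c \<in> L2 \<Lambda>" "d \<in> L2 \<Lambda>" using H1_L2 H10_H1 by blast+
    from L2.N_abs_diff[OF this] L2_le_H1(1)[of \<Lambda> "\<lambda>x. c x - d x"]
    show "\<bar>L2_norm \<Lambda> c - L2_norm \<Lambda> d\<bar> \<le> 1 * H1_norm \<Lambda> (\<lambda>x. c x - d x)" by simp
  qed
  then show "(\<lambda>t. ereal (L2_norm \<Lambda> (\<lambda>x. a t x - b t x))) \<in> borel_measurable (time_measure T)" by measurable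
  show "AE t in time_measure T. ereal (L2_norm \<Lambda> (\<lambda>x. a t x - b t x)) \<le> ereal B"
  proof (rule H10.AE_I)
    fix t assume "t \<in> {0<..<T}"
    then show "ereal (L2_norm \<Lambda> (\<lambda>x. a t x - b t x)) \<le> ereal B"
      using order.trans[OF L2_le_H1(1) assms(3)[of t]] by simp
  qed
qed

text \<open>The bound in \<open>kv_stability\<close> involves only the coefficients and the fixed
  solution, so it holds for all solutions of the perturbed problem simultaneously.\<close>

lemma kv_continuous_dependence:
  assumes c: "coefficient \<Lambda> m M E" "coefficient \<Lambda> m M \<nu>" "\<And>n::nat. coefficient \<Lambda> m M (E' n)" "\<And>n. coefficient \<Lambda> m M (\<nu>' n)"
    and lim: "AE x in dom_measure \<Lambda>. (\<lambda>n. E' n x) \<longlonglongrightarrow> E x" "AE x in dom_measure \<Lambda>. (\<lambda>n. \<nu>' n x) \<longlonglongrightarrow> \<nu> x"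
    and M: "0 < M" and u: "kv_solution \<Lambda> T E \<nu> f us u" and \<delta>: "0 < \<delta>"
  shows "\<forall>\<^sub>F n in sequentially. \<forall>u'. kv_solution \<Lambda> T (E' n) (\<nu>' n) f us u' \<longrightarrow>
    Z_norm \<Lambda> T (\<lambda>t x. u' t x - u t x) < ereal \<delta>"
proof -
  obtain v where uC: "H10.CX u" and us: "AE x in dom_measure \<Lambda>. u 0 x = us x" and v: "H10.L2X v"
    and w: "H10.weak_integral (u 0) v u"
    and eq: "weak_form E \<nu> f u v"
    using u unfolding kv_solution_iff by blast
  have M0: "0 \<le> M" and m: "0 < m" using M c(1) by (auto simp: coefficient_def)
  have l0: "AE x in dom_measure \<Lambda>. (\<lambda>n. a x - a' n x) \<longlonglongrightarrow> 0"
    if "AE x in dom_measure \<Lambda>. (\<lambda>n. a' n x) \<longlonglongrightarrow> a x" for a and a' :: "nat \<Rightarrow> real \<Rightarrow> real"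
    using that
  proof eventually_elim
    case (elim x)
    from tendsto_diff[OF tendsto_const[of "a x"] elim] show ?case by simp
  qed
  let ?C = "(1 + \<Lambda>) / m"
  let ?p = "\<lambda>n. prim T (\<lambda>s. defect (\<lambda>x. \<nu> x - \<nu>' n x) (v s)) T"
  let ?q = "\<lambda>n. prim T (\<lambda>s. defect (\<lambda>x. E x - E' n x) (u s)) T"
  let ?B = "\<lambda>n. 2 * exp (2 * (?C * M) * T) * (?C * (?p n + ?q n))"
  have "?p \<longlonglongrightarrow> 0" by (rule defect_tendsto[OF coefficient_diff[OF c(2,4)] M0 l0[OF lim(2)] v])
  moreover have "?q \<longlonglongrightarrow> 0" by (rule defect_tendsto[OF coefficient_diff[OF c(1,3)] M0 l0[OF lim(1)] H10.CX_L2X[OF uC]])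
  ultimately have "?B \<longlonglongrightarrow> 0" by (intro tendsto_mult_right_zero tendsto_add_zero)
  then have "\<forall>\<^sub>F n in sequentially. ?B n < \<delta>" using \<delta> by (rule order_tendstoD)
  then show ?thesis
  proof eventually_elim
    case (elim n)
    show ?case
    proof (intro allI impI)
      fix u' assume u': "kv_solution \<Lambda> T (E' n) (\<nu>' n) f us u'"
      then have u'C: "H10.CX u'" unfolding kv_solution_iff by blast
      have "Z_norm \<Lambda> T (\<lambda>t x. u' t x - u t x) \<le> ereal (?B n)"
        by (rule Z_norm_le[OF u'C uC kv_stability[OF c(1,2) c(3,4) M u' uC us v w eq]])
      also have "\<dots> < ereal \<delta>" using elim by simp
      finally show "Z_norm \<Lambda> T (\<lambda>t x. u' t x - u t x) < ereal \<delta>" .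
    qed
  qed
qed

end

section \<open>Piecewise constant coefficients\<close>

lemma periodic1_of_int:
  assumes "periodic1 \<xi>" shows "\<xi> (x + of_int k) = \<xi> x"
proof -
  have n: "\<xi> (x + real n) = \<xi> x" for n x
  proof (induction n)
    case (Suc n)
    have "\<xi> (x + real (Suc n)) = \<xi> ((x + real n) + 1)" by (simp add: algebra_simps)
    then show ?case using assms Suc by (simp add: periodic1_def)
  qed simp
  show ?thesis
  proof (cases "0 \<le> k")
    case True
    then show ?thesis using n[of x "nat k"] by simp
  next
    case False
    then show ?thesis using n[of "x + of_int k" "nat (- k)"] by simp
  qed
qed

lemma periodic1_frac: "periodic1 \<xi> \<Longrightarrow> \<xi> (frac x) = \<xi> x"
  using periodic1_of_int[of \<xi> "frac x" "\<lfloor>x\<rfloor>"] by (simp add: frac_def)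

lemma isCont_frac:
  assumes "periodic1 \<xi>" "isCont \<xi> (frac x)" shows "isCont \<xi> x"
proof -
  have "isCont (\<lambda>y. \<xi> (y - of_int \<lfloor>x\<rfloor>)) x"
    by (rule isCont_o2[of x "\<lambda>y. y - of_int \<lfloor>x\<rfloor>" \<xi>]) (use assms(2) in \<open>auto simp: frac_def\<close>)
  moreover have "(\<lambda>y. \<xi> (y - of_int \<lfloor>x\<rfloor>)) = \<xi>"
    using periodic1_of_int[OF assms(1), of _ "- \<lfloor>x\<rfloor>"] by auto
  ultimately show ?thesis by simp
qed

lemma countable_frac_vimage: 
  assumes "countable S" shows "countable {x :: real. frac x \<in> S}"
proof (rule countable_subset)
  show "{x. frac x \<in> S} \<subseteq> (\<lambda>(s, k :: int). s + of_int k) ` (S \<times> UNIV)"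
  proof
    fix x :: real assume "x \<in> {x. frac x \<in> S}"
    moreover have "x = (\<lambda>(s, k :: int). s + of_int k) (frac x, \<lfloor>x\<rfloor>)" by (simp add: frac_def)
    ultimately show "x \<in> (\<lambda>(s, k :: int). s + of_int k) ` (S \<times> UNIV)" by blast
  qed
  show "countable ((\<lambda>(s, k :: int). s + of_int k) ` (S \<times> (UNIV :: int set)))"
    by (intro countable_image countable_SIGMA assms) auto
qed

text \<open>On the line the exceptional points are integer translates of a finite set, hence
  countable, and a function continuous off a countable set is Borel measurable.\<close>

lemma piecewise_continuousD:
  assumes "piecewise_continuous \<xi>" "periodic1 \<xi>"
  obtains S where "finite S" "\<And>x. frac x \<notin> S \<Longrightarrow> isCont \<xi> x" "\<xi> \<in> borel_measurable borel"
proof -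
  obtain S where S: "finite S" "\<forall>x\<in>{0..<1} - S. isCont \<xi> x"
    using assms(1) unfolding piecewise_continuous_def by blast
  have c: "isCont \<xi> x" if "frac x \<notin> S" for x
    by (rule isCont_frac[OF assms(2)]) (use S that frac_lt_1[of x] in auto)
  have "\<xi> \<in> borel_measurable borel"
  proof (rule borel_measurable_continuous_countable_exceptions)
    show "countable {x. frac x \<in> S}" using S by (intro countable_frac_vimage countable_finite)
    show "continuous_on (- {x. frac x \<in> S}) \<xi>" using c by (intro continuous_at_imp_continuous_on) auto
  qed
  with S(1) c that show ?thesis by blast
qed

section \<open>Essential bounds and sampling on a uniform grid\<close>

lemma ess_bounds:
  assumes "ess_sup \<xi> < \<infinity>" "0 < ess_inf \<xi>"
  obtains m M where "0 < m" "AE x in lborel. m \<le> \<xi> x \<and> \<xi> x \<le> M"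
proof -
  obtain M where M: "ess_sup \<xi> < ereal M" using ereal_dense2[OF assms(1)] by auto
  have "esssup lebesgue (\<lambda>x. ereal (- \<xi> x)) < 0" using assms(2) by (simp add: ess_inf_def)
  then obtain z where z: "esssup lebesgue (\<lambda>x. ereal (- \<xi> x)) < ereal z" "ereal z < 0"
    using ereal_dense2 by blast
  have "AE x in lebesgue. ereal (\<xi> x) \<le> ess_sup \<xi>" unfolding ess_sup_def by (rule esssup_AE)
  moreover have "AE x in lebesgue. ereal (- \<xi> x) \<le> esssup lebesgue (\<lambda>x. ereal (- \<xi> x))" by (rule esssup_AE)
  ultimately have "AE x in lebesgue. - z \<le> \<xi> x \<and> \<xi> x \<le> M"
  proof eventually_elim
    case (elim x)
    have "ereal (\<xi> x) < ereal M" "ereal (- \<xi> x) < ereal z"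
      using le_less_trans[OF elim(1) M] le_less_trans[OF elim(2) z(1)] by auto
    then show ?case by simp
  qed
  with that[of "- z" M] z(2) show ?thesis by (simp add: AE_completion_iff)
qed

text \<open>The last cell is sampled at \<open>0\<close>, because periodicity forces a piecewise constant
  function to take the same value on the first and on the last interval.\<close>

definition sample_point :: "nat \<Rightarrow> real \<Rightarrow> real" where
  "sample_point n x = (let k = \<lfloor>real n * frac x\<rfloor> in if k = int n - 1 then 0 else real_of_int k / real n)"

text \<open>The value at a single sample point may violate the essential bounds. Clamping to [m, M]
  restores them everywhere without changing the limit at points where the bounds hold.\<close>

definition sampled :: "real \<Rightarrow> real \<Rightarrow> (real \<Rightarrow> real) \<Rightarrow> nat \<Rightarrow> real \<Rightarrow> real" where
  "sampled m M \<xi> n x = max m (min M (\<xi> (sample_point n x)))"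

lemma sample_point_const:
  assumes "1 \<le> n" "i < n" "x \<in> (if Suc i = n then {real i / n .. real (Suc i) / n} else {real i / n ..< real (Suc i) / n})"
  shows "sample_point n x = (if Suc i = n then 0 else real i / n)"
\<comment> \<open>At 1 \<open>frac\<close> has returned to 0, where the sample point is 0; this
  agrees with the convention for the last cell.\<close>
proof (cases "x = 1")
  case True
  then have "Suc i = n" using assms by (auto split: if_splits simp: divide_simps)
  then show ?thesis using True by (simp add: sample_point_def)
next
  case False
  have n: "0 < real n" using assms(1) by simp
  have lo: "real i \<le> real n * x" using assms(3) n by (auto simp: divide_le_eq mult.commute split: if_splits)
  have hi: "real n * x < real i + 1"
  proof (cases "Suc i = n")
    case True
    then have "x \<le> 1" using assms(3) n by auto
    with False have "x < 1" by simp
    then have "real n * x < real n" using n by simp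
    moreover have "real n = real i + 1" using True by auto
    ultimately show ?thesis by linarith
  next
    case F: False
    then have "x < real (Suc i) / n" using assms(3) by auto
    then show ?thesis using n by (simp add: less_divide_eq mult.commute)
  qed
  have "0 \<le> real n * x" using lo by (meson of_nat_0_le_iff order.trans)
  then have x0: "0 \<le> x" using n by (simp add: zero_le_mult_iff)
  have "real n * x < real n" using hi assms(2) by linarith
  then have "x < 1" using n by simp
  then have "frac x = x" using x0 by (simp add: frac_eq)
  moreover have "\<lfloor>real n * x\<rfloor> = int i" using lo hi by (intro floor_unique) auto
  ultimately show ?thesis by (auto simp: sample_point_def)
qed

lemma sample_point_borel [measurable]: "sample_point n \<in> borel_measurable borel"
proof -
  have [measurable]: "(\<lambda>x::real. \<lfloor>real n * frac x\<rfloor>) \<in> measurable borel (count_space UNIV)"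
    unfolding frac_def by measurable
  show ?thesis unfolding sample_point_def[abs_def] Let_def by measurable
qed

text \<open>Since \<open>frac x\<close> is less than 1, the point lies outside the last cell for
  large \<open>n\<close>; the exceptional rule no longer applies and the rounding error is at most
  1/n.\<close>

lemma sample_point_tendsto:
  assumes "frac x \<noteq> 0" shows "(\<lambda>n. sample_point n x) \<longlonglongrightarrow> frac x"
proof -
  let ?y = "frac x"
  have y: "0 < ?y" "?y < 1" using assms frac_ge_0[of x] frac_lt_1[of x] by linarith+
  have "\<forall>\<^sub>F n in sequentially. norm (sample_point n x - ?y) \<le> 1 / real n"
  proof -
    have "filterlim (\<lambda>n. real n * (1 - ?y)) at_top sequentially"
      using y by (intro filterlim_at_top_mult_tendsto_pos[OF tendsto_const _ filterlim_real_sequentially, THEN filterlim_cong[OF refl refl, THEN iffD1, rotated]]) (auto simp: mult.commute)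
    then have "\<forall>\<^sub>F n in sequentially. 1 < real n * (1 - ?y)" by (simp add: filterlim_at_top_dense)
    moreover have "\<forall>\<^sub>F n in sequentially. 0 < n" by (rule eventually_gt_at_top)
    ultimately show ?thesis
    proof eventually_elim
      case (elim n)
      have "real n * ?y < real n - 1" using elim(1) by (simp add: algebra_simps)
      then have "\<lfloor>real n * ?y\<rfloor> \<noteq> int n - 1" by linarith
      then have s: "sample_point n x = real_of_int \<lfloor>real n * ?y\<rfloor> / real n" by (simp add: sample_point_def Let_def)
      have "sample_point n x - ?y = (real_of_int \<lfloor>real n * ?y\<rfloor> - real n * ?y) / real n"
        using elim(2) unfolding s by (simp add: field_simps)
      moreover have "\<bar>real_of_int \<lfloor>real n * ?y\<rfloor> - real n * ?y\<bar> \<le> 1" by linarith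
      ultimately show ?case using elim(2) by (simp add: abs_divide divide_right_mono)
    qed
  qed
  then show ?thesis
    by (intro LIM_zero_cancel[OF Lim_null_comparison[OF _ lim_1_over_n]]) auto
qed

lemma sampled_bounds: "m \<le> M \<Longrightarrow> m \<le> sampled m M \<xi> n x \<and> sampled m M \<xi> n x \<le> M"
  by (simp add: sampled_def)

lemma sampled_borel: "\<xi> \<in> borel_measurable borel \<Longrightarrow> sampled m M \<xi> n \<in> borel_measurable borel"
  unfolding sampled_def[abs_def]
  by (intro borel_measurable_max borel_measurable_min borel_measurable_const
      measurable_compose[OF sample_point_borel])

lemma sampled_tendsto:
  assumes "periodic1 \<xi>" "isCont \<xi> x" "frac x \<noteq> 0" "m \<le> \<xi> x" "\<xi> x \<le> M"
  shows "(\<lambda>n. sampled m M \<xi> n x) \<longlonglongrightarrow> \<xi> x"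
proof -
  have "isCont \<xi> (frac x)"
  proof -
    have "isCont (\<lambda>y. \<xi> (y + of_int \<lfloor>x\<rfloor>)) (frac x)"
      by (rule isCont_o2[of "frac x" "\<lambda>y. y + of_int \<lfloor>x\<rfloor>" \<xi>]) (use assms(2) in \<open>auto simp: frac_def\<close>)
    then show ?thesis by (simp add: periodic1_of_int[OF assms(1)])
  qed
  from isCont_tendsto_compose[OF this sample_point_tendsto[OF assms(3)]]
  have "(\<lambda>n. \<xi> (sample_point n x)) \<longlonglongrightarrow> \<xi> x" by (simp add: periodic1_frac[OF assms(1)])
  then have "(\<lambda>n. sampled m M \<xi> n x) \<longlonglongrightarrow> max m (min M (\<xi> x))"
    unfolding sampled_def by (intro tendsto_max tendsto_min tendsto_const)
  then show ?thesis using assms(4,5) by simp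
qed

lemma sampled_piecewise_constant:
  assumes "0 < m" "1 \<le> n"
  shows "piecewise_constant (sampled m M \<xi> n) (sampled m M \<zeta> n)"
  unfolding piecewise_constant_def
proof (intro conjI exI[of _ n] exI[of _ "\<lambda>i. real i / n"] allI impI)
  have "sample_point n (x + 1) = sample_point n x" for x by (simp add: sample_point_def frac_1_eq)
  then show "periodic1 (sampled m M \<xi> n)" "periodic1 (sampled m M \<zeta> n)"
    by (simp_all add: periodic1_def sampled_def)
  show "0 < sampled m M \<xi> n x" "0 < sampled m M \<zeta> n x" for x
    using assms(1) by (simp_all add: sampled_def less_max_iff_disj)
  show "real i / n < real (Suc i) / n" for i using assms(2) by (simp add: divide_strict_right_mono)
  fix i assume i: "i < n"
  let ?s = "if Suc i = n then 0 else real i / n"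
  show "let P = (if Suc i = n then {real i / n..real (Suc i) / n} else {real i / n..<real (Suc i) / n})
    in (\<exists>c. \<forall>x\<in>P. sampled m M \<xi> n x = c) \<and> (\<exists>d. \<forall>x\<in>P. sampled m M \<zeta> n x = d)"
    unfolding Let_def sampled_def
    by (intro conjI exI[of _ "max m (min M (\<xi> ?s))"] exI[of _ "max m (min M (\<zeta> ?s))"] ballI)
       (simp_all only: sample_point_const[OF assms(2) i])
qed (use assms in auto)

lemma AE_scaled:
  assumes "AE x in lborel. P x" "Measurable.pred borel P" "\<epsilon> \<noteq> 0"
  shows "AE x in dom_measure \<Lambda>. P (x / \<epsilon>)"
proof -
  have "AE x in lborel. P (0 + (1 / \<epsilon>) * x)"
    by (rule AE_borel_affine) (use assms in auto)
  then have "AE x in lebesgue. P (x / \<epsilon>)" by (simp add: AE_completion_iff)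
  then show ?thesis by (subst AE_restrict_space_iff) (auto elim: eventually_mono)
qed

theorem theorem3p4:
  fixes \<Lambda> T \<epsilon> :: real
    and E \<nu> us :: "real \<Rightarrow> real"
    and f u :: "real \<Rightarrow> real \<Rightarrow> real"
  assumes "0 < \<Lambda>" and "0 < T"
    and "\<forall>x. 0 < E x" and "\<forall>x. 0 < \<nu> x"
    and "periodic1 E" and "periodic1 \<nu>"
    and "piecewise_continuous E" and "piecewise_continuous \<nu>"
    and "ess_sup E < \<infinity>" and "ess_sup \<nu> < \<infinity>"
    and "0 < ess_inf E" and "0 < ess_inf \<nu>"
    and "\<forall>t\<in>{0..T}. f t \<in> L2 \<Lambda>"
    and "strongly_measurable {0<..<T} (L2 \<Lambda>) (L2_norm \<Lambda>) f"
    and "Z_norm \<Lambda> T f < \<infinity>"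
    and "us \<in> H10 \<Lambda>"
    and "0 < \<epsilon>"
    and "kv_solution \<Lambda> T (\<lambda>x. E (x / \<epsilon>)) (\<lambda>x. \<nu> (x / \<epsilon>)) f us u"
  shows "\<forall>\<delta>::real. 0 < \<delta> \<longrightarrow>
    (\<exists>EPC \<nu>PC. piecewise_constant EPC \<nu>PC \<and>
       (\<exists>uPC. kv_solution \<Lambda> T (\<lambda>x. EPC (x / \<epsilon>)) (\<lambda>x. \<nu>PC (x / \<epsilon>)) f us uPC) \<and>
       (\<forall>uPC. kv_solution \<Lambda> T (\<lambda>x. EPC (x / \<epsilon>)) (\<lambda>x. \<nu>PC (x / \<epsilon>)) f us uPC \<longrightarrow>
          Z_norm \<Lambda> T (\<lambda>t x. uPC t x - u t x) < ereal \<delta>))"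
proof (intro allI impI)
  fix \<delta> :: real assume \<delta>: "0 < \<delta>"
  interpret kv_domain \<Lambda> T by unfold_locales (use assms in auto)
  obtain S1 where S1: "finite S1" "\<And>x. frac x \<notin> S1 \<Longrightarrow> isCont E x" and [measurable]: "E \<in> borel_measurable borel"
    using piecewise_continuousD[OF assms(7,5)] by blast
  obtain S2 where S2: "finite S2" "\<And>x. frac x \<notin> S2 \<Longrightarrow> isCont \<nu> x" and [measurable]: "\<nu> \<in> borel_measurable borel"
    using piecewise_continuousD[OF assms(8,6)] by blast
  obtain m1 M1 where b1: "0 < m1" "AE x in lborel. m1 \<le> E x \<and> E x \<le> M1" using ess_bounds[OF assms(9,11)] by blast
  obtain m2 M2 where b2: "0 < m2" "AE x in lborel. m2 \<le> \<nu> x \<and> \<nu> x \<le> M2" using ess_bounds[OF assms(10,12)] by blast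
  \<comment> \<open>One pair of bounds serves both coefficients; including \<open>m\<close> in the
    maximum gives m \<le> M at once.\<close>
  define m M where "m = min m1 m2" and "M = max m (max M1 M2)"
  have m: "0 < m" and mM: "m \<le> M" using b1 b2 by (auto simp: m_def M_def)
  then have M: "0 < M" by simp
  \<comment> \<open>Adding 0 removes the integers, as \<open>sampled_tendsto\<close>
    requires.\<close>
  define S where "S = insert 0 (S1 \<union> S2)"
  have S: "finite S" using S1 S2 by (simp add: S_def)
  \<comment> \<open>All almost-everywhere conditions are collected in one Borel predicate, so the
    change of variable from x to x/\<epsilon> is made only once.\<close>
  define P where "P x \<longleftrightarrow> (m \<le> E x \<and> E x \<le> M) \<and> (m \<le> \<nu> x \<and> \<nu> x \<le> M) \<and> x \<notin> {x. frac x \<in> S}" for x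
  have c: "countable {x :: real. frac x \<in> S}" by (intro countable_frac_vimage countable_finite S)
  then have [measurable]: "{x :: real. frac x \<in> S} \<in> sets borel" by (rule sets.countable[rotated]) simp
  have "AE x in lborel. x \<notin> {x. frac x \<in> S}"
    by (intro AE_not_in countable_imp_null_set_lborel c)
  with b1(2) b2(2) have "AE x in lborel. P x"
    by eventually_elim (auto simp: P_def m_def M_def)
  moreover have "Measurable.pred borel P" unfolding P_def[abs_def] by measurable
  ultimately have AE_P: "AE x in dom_measure \<Lambda>. P (x / \<epsilon>)" by (rule AE_scaled) (use assms(17) in simp)
  have scale: "(\<lambda>x. a (x / \<epsilon>)) \<in> borel_measurable (dom_measure \<Lambda>)" if "a \<in> borel_measurable borel" for a :: "real \<Rightarrow> real"
    by (rule borel_dom_measure) (use that in measurable)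
  have cE: "coefficient \<Lambda> m M (\<lambda>x. E (x / \<epsilon>))"
    unfolding coefficient_def using AE_P m by (auto intro!: scale simp: P_def elim!: eventually_mono)
  have c\<nu>: "coefficient \<Lambda> m M (\<lambda>x. \<nu> (x / \<epsilon>))"
    unfolding coefficient_def using AE_P m by (auto intro!: scale simp: P_def elim!: eventually_mono)
  have cE': "coefficient \<Lambda> m M (\<lambda>x. sampled m M E n (x / \<epsilon>))" for n
    unfolding coefficient_def using sampled_bounds[OF mM] m by (auto intro!: scale sampled_borel)
  have c\<nu>': "coefficient \<Lambda> m M (\<lambda>x. sampled m M \<nu> n (x / \<epsilon>))" for n
    unfolding coefficient_def using sampled_bounds[OF mM] m by (auto intro!: scale sampled_borel)
  have lE: "AE x in dom_measure \<Lambda>. (\<lambda>n. sampled m M E n (x / \<epsilon>)) \<longlonglongrightarrow> E (x / \<epsilon>)"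
    using AE_P by eventually_elim (rule sampled_tendsto[OF assms(5)], auto simp: P_def S_def intro: S1)
  have l\<nu>: "AE x in dom_measure \<Lambda>. (\<lambda>n. sampled m M \<nu> n (x / \<epsilon>)) \<longlonglongrightarrow> \<nu> (x / \<epsilon>)"
    using AE_P by eventually_elim (rule sampled_tendsto[OF assms(6)], auto simp: P_def S_def intro: S2)
  from kv_continuous_dependence[OF cE c\<nu> cE' c\<nu>' lE l\<nu> M assms(18) \<delta>]
  obtain n0 where n0: "\<And>n. n \<ge> n0 \<Longrightarrow> \<forall>u'. kv_solution \<Lambda> T (\<lambda>x. sampled m M E n (x / \<epsilon>)) (\<lambda>x. sampled m M \<nu> n (x / \<epsilon>)) f us u' \<longrightarrow>
      Z_norm \<Lambda> T (\<lambda>t x. u' t x - u t x) < ereal \<delta>"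
    unfolding eventually_sequentially by blast
  \<comment> \<open>The maximum with 1 provides the at least one interval of a piecewise constant
    pair.\<close>
  define n where "n = max 1 n0"
  show "\<exists>EPC \<nu>PC. piecewise_constant EPC \<nu>PC \<and>
       (\<exists>uPC. kv_solution \<Lambda> T (\<lambda>x. EPC (x / \<epsilon>)) (\<lambda>x. \<nu>PC (x / \<epsilon>)) f us uPC) \<and>
       (\<forall>uPC. kv_solution \<Lambda> T (\<lambda>x. EPC (x / \<epsilon>)) (\<lambda>x. \<nu>PC (x / \<epsilon>)) f us uPC \<longrightarrow>
          Z_norm \<Lambda> T (\<lambda>t x. uPC t x - u t x) < ereal \<delta>)"
  proof (rule exI[of _ "sampled m M E n"], rule exI[of _ "sampled m M \<nu> n"], intro conjI)
    show "piecewise_constant (sampled m M E n) (sampled m M \<nu> n)"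
      by (rule sampled_piecewise_constant[OF m]) (simp add: n_def)
    show "\<exists>uPC. kv_solution \<Lambda> T (\<lambda>x. sampled m M E n (x / \<epsilon>)) (\<lambda>x. sampled m M \<nu> n (x / \<epsilon>)) f us uPC"
      by (rule kv_existence[OF cE c\<nu> cE' c\<nu>' M assms(18)])
    show "\<forall>uPC. kv_solution \<Lambda> T (\<lambda>x. sampled m M E n (x / \<epsilon>)) (\<lambda>x. sampled m M \<nu> n (x / \<epsilon>)) f us uPC \<longrightarrow>
          Z_norm \<Lambda> T (\<lambda>t x. uPC t x - u t x) < ereal \<delta>"
      by (rule n0) (simp add: n_def)
  qed
qed

end
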